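(* Let $S_1$ and $S_2$ be finite generating sets for a non-elementary word-hyperbolic group $G$. There is an algebraic number $\lambda_{1,2}$ such that for any $\epsilon>0$ there are a constant $K$ and an integer $N$ so that for every $n\ge N$, if $G_n$ denotes the set of elements $g\in G$ with $|g|_{S_1}=n$, there is a subset $G_n'\subset G_n$ with $|G_n'|/|G_n|\ge 1-\epsilon$ such that for all $g\in G_n'$ $$\bigl||g|_{S_1}-\lambda_{1,2}|g|_{S_2}\bigr|\le K\cdot\sqrt{n}.$$
   Context: Generating sets are sets generating $G$ as a semigroup (not necessarily symmetric); $|g|_{S_i}$ is the word length of $g$ with respect to $S_i$. A word-hyperbolic group is elementary if it contains a finite index cyclic subgroup. *)

theory Defs
  imports Complex_Main "HOL-Computational_Algebra.Polynomial" "HOL-Algebra.Elementary_Groups"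
begin

(* Generation as a semigroup: only products of positive words count, no inverses. *)
definition semigroup_generates :: "('a, 'b) monoid_scheme \<Rightarrow> 'a set \<Rightarrow> bool" where
  "semigroup_generates G S \<longleftrightarrow> S \<subseteq> carrier G \<and>
     (\<forall>g\<in>carrier G. \<exists>w. w \<noteq> [] \<and> set w \<subseteq> S \<and> foldr (\<otimes>\<^bsub>G\<^esub>) w \<one>\<^bsub>G\<^esub> = g)"

(* The empty word represents the identity, so the identity has length 0.  The value is only
   meaningful for elements that are represented by some word over S. *)
definition word_length :: "('a, 'b) monoid_scheme \<Rightarrow> 'a set \<Rightarrow> 'a \<Rightarrow> nat" where
  "word_length G S g =
     (LEAST n. \<exists>w. set w \<subseteq> S \<and> length w = n \<and> foldr (\<otimes>\<^bsub>G\<^esub>) w \<one>\<^bsub>G\<^esub> = g)"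

definition word_dist :: "('a, 'b) monoid_scheme \<Rightarrow> 'a set \<Rightarrow> 'a \<Rightarrow> 'a \<Rightarrow> nat" where
  "word_dist G S g h = word_length G S (inv\<^bsub>G\<^esub> g \<otimes>\<^bsub>G\<^esub> h)"

(* A geodesic edge path from x to y in the Cayley graph, given as its list of vertices. *)
definition cayley_geodesic ::
  "('a, 'b) monoid_scheme \<Rightarrow> 'a set \<Rightarrow> 'a \<Rightarrow> 'a \<Rightarrow> 'a list \<Rightarrow> bool" where
  "cayley_geodesic G S x y p \<longleftrightarrow>
     p \<noteq> [] \<and> set p \<subseteq> carrier G \<and> hd p = x \<and> last p = y \<and>
     (\<forall>i j. i \<le> j \<and> j < length p \<longrightarrow> word_dist G S (p ! i) (p ! j) = j - i)"

(* Slim triangles: each side lies in the delta-neighbourhood of the union of the other two.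
   Quantifying over all corners and all sides makes it enough to state this for one side.
   Only triangles with corners at vertices occur; allowing corners and points inside edges
   of the geometric realization changes delta by a bounded amount. *)
definition cayley_slim_triangles ::
  "('a, 'b) monoid_scheme \<Rightarrow> 'a set \<Rightarrow> real \<Rightarrow> bool" where
  "cayley_slim_triangles G S \<delta> \<longleftrightarrow>
     (\<forall>x\<in>carrier G. \<forall>y\<in>carrier G. \<forall>z\<in>carrier G. \<forall>p q r.
        cayley_geodesic G S x y p \<and> cayley_geodesic G S y z q \<and> cayley_geodesic G S z x r \<longrightarrow>
        (\<forall>u\<in>set p. \<exists>v\<in>set q \<union> set r. real (word_dist G S u v) \<le> \<delta>))"

(* The generating set used for hyperbolicity is symmetric, so that word_dist is the path metric
   of the undirected Cayley graph. *)
definition word_hyperbolic :: "('a, 'b) monoid_scheme \<Rightarrow> bool" where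
  "word_hyperbolic G \<longleftrightarrow> group G \<and>
     (\<exists>S \<delta>. finite S \<and> semigroup_generates G S \<and> (\<forall>s\<in>S. inv\<^bsub>G\<^esub> s \<in> S) \<and>
            0 \<le> \<delta> \<and> cayley_slim_triangles G S \<delta>)"

definition elementary_group :: "('a, 'b) monoid_scheme \<Rightarrow> bool" where
  "elementary_group G \<longleftrightarrow>
     (\<exists>H. subgroup H G \<and> cyclic_group (G\<lparr>carrier := H\<rparr>) \<and> finite (rcosets\<^bsub>G\<^esub> H))"

definition word_sphere :: "('a, 'b) monoid_scheme \<Rightarrow> 'a set \<Rightarrow> nat \<Rightarrow> 'a set" where
  "word_sphere G S n = {g \<in> carrier G. word_length G S g = n}"

end

theory Submission
  imports Defs
begin

text \<open>
  Write \<open>f g = |g|\<^bsub>S2\<^esub>\<close> and let \<open>S n\<close> be the sphere of radius \<open>n\<close> for \<open>S1\<close>. Quasigeodesic stability shows that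
  \<open>f\<close> is additive up to a constant along \<open>S1\<close>-geodesics, and non-elementarity allows to concatenate any
  two geodesics after inserting a bounded correction. Hence \<open>S (n + m)\<close> and \<open>S n \<times> S m\<close>, with the
  functions \<open>f\<close> and \<open>f + f\<close>, agree up to bounded multiplicity and bounded error.

  Consequently the sum of \<open>exp (s * f g)\<close> over \<open>S n\<close> is \<open>exp (n * P s)\<close> up to a constant factor that does not
  depend on \<open>n\<close>, nor on \<open>s \<in> {-1..1}\<close>. If the one-sided derivatives of \<open>P\<close> at \<open>0\<close> differed, a definite proportion
  of \<open>S n\<close> would drift at either speed, and by concatenation also at all intermediate speeds, which is
  impossible. So \<open>f g / n\<close> concentrates at a single drift \<open>b\<close>, and the sum \<open>W n\<close> of \<open>(f g - b * n)\<^sup>2\<close> over \<open>S n\<close>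
  is \<open>o(n\<^sup>2)\<close> relative to the size of \<open>S n\<close>.

  By Cannon's theory of cone types \<open>W\<close> satisfies a linear recurrence, so its generating function is
  rational. The bound \<open>o(n\<^sup>2)\<close> forbids a pole of order three, hence the normalised \<open>W\<close> is linear on average; splitting
  geodesics in two pieces of suitable length and Chebyshev's inequality give the square root bound for
  every \<open>n\<close>. The drift is a limit of a rational function over the rationals at an algebraic point, hence
  algebraic. No Perron-Frobenius theory and no boundary measures are needed.
\<close>

section \<open>Linear recurrences and algebraic limits\<close>

text \<open>The automaton of cone types need not be irreducible or aperiodic, so its spectrum says
  little by itself; near additivity on spheres supplies the missing information. It makes sphere
  sizes purely exponential, with no polynomial factor, and keeps the error in the exponential sums
  bounded even for \<open>s\<close> of order \<open>1 / n\<close>. That scale detects a definite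
  proportion of the sphere at each extreme drift, where the usual tail estimates give upper bounds
  only.

  Poles on the circle of convergence away from the positive axis are not excluded. Hence only the
  pole on the positive axis is estimated, and nonnegativity yields a bound for sums over radii, not
  for each radius; a geodesic is therefore cut where both pieces have a good length.

  Neither \<open>S1\<close> nor \<open>S2\<close> has to be symmetric, so both distances may be
  asymmetric. Gromov products are taken for an auxiliary symmetric generating set \<open>S\<close>,
  with respect to which geodesics of \<open>S1\<close> and \<open>S2\<close> are uniform
  quasigeodesics. The algebraic number is the inverse of the drift, which is positive because the
  two lengths are comparable.\<close>

text \<open>Gaussian elimination, by induction on the equations. The field is left general: the
  variance leads to real coefficients, algebraicity to rational ones.\<close>

lemma homogeneous_system_nonzero_solution:
  fixes M :: "'i \<Rightarrow> 'j \<Rightarrow> 'k::field"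
  assumes "finite I" and "finite J" and "card I < card J"
  shows "\<exists>c. (\<exists>j\<in>J. c j \<noteq> 0) \<and> (\<forall>i\<in>I. (\<Sum>j\<in>J. c j * M i j) = 0)"
  using assms
proof (induction I arbitrary: J M rule: finite_induct)
  case empty
  then obtain j where "j \<in> J" by fastforce
  then show ?case by (intro exI[of _ "\<lambda>_. 1"]) auto
next
  case (insert i I)
  show ?case
  proof (cases "\<exists>j\<in>J. M i j \<noteq> 0")
    case False
    have "card I < card J" using insert by simp
    then obtain c where c: "\<exists>j\<in>J. c j \<noteq> 0" "\<forall>i\<in>I. (\<Sum>j\<in>J. c j * M i j) = 0"
      using insert.IH insert.prems by blast
    have "(\<Sum>j\<in>J. c j * M i j) = 0" using False by simp
    then show ?thesis using c by blast
  next
    case True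
    then obtain p where p: "p \<in> J" "M i p \<noteq> 0" by blast
    have "card I < card (J - {p})" using insert p by simp
    then obtain c where c: "\<exists>j\<in>J - {p}. c j \<noteq> 0"
      "\<forall>i'\<in>I. (\<Sum>j\<in>J - {p}. c j * (M i' j - M i' p * M i j / M i p)) = 0"
      using insert.IH[of "J - {p}" "\<lambda>i' j. M i' j - M i' p * M i j / M i p"] insert.prems by auto
    define s where "s = (\<Sum>j\<in>J - {p}. c j * M i j)"
    define c' where "c' = c(p := - s / M i p)"
    have split: "(\<Sum>j\<in>J. c' j * M i' j) = (\<Sum>j\<in>J - {p}. c j * M i' j) - s * M i' p / M i p" for i'
    proof -
      have "(\<Sum>j\<in>J. c' j * M i' j) = c' p * M i' p + (\<Sum>j\<in>J - {p}. c' j * M i' j)"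
        using p(1) insert.prems(1) by (rule sum.remove[rotated])
      also have "(\<Sum>j\<in>J - {p}. c' j * M i' j) = (\<Sum>j\<in>J - {p}. c j * M i' j)"
        by (rule sum.cong) (auto simp: c'_def)
      finally show ?thesis by (simp add: c'_def)
    qed
    have "(\<Sum>j\<in>J. c' j * M i' j) = 0" if "i' \<in> insert i I" for i'
    proof (cases "i' = i")
      case True
      then show ?thesis using p by (simp add: split s_def)
    next
      case False
      then have "i' \<in> I" using that by simp
      then have "0 = (\<Sum>j\<in>J - {p}. c j * (M i' j - M i' p * M i j / M i p))" using c by simp
      also have "\<dots> = (\<Sum>j\<in>J - {p}. c j * M i' j - (c j * M i j) * (M i' p / M i p))"
        by (rule sum.cong) (auto simp: algebra_simps)
      also have "\<dots> = (\<Sum>j\<in>J - {p}. c j * M i' j) - s * (M i' p / M i p)"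
        unfolding sum_subtractf s_def sum_distrib_right ..
      finally show ?thesis by (simp add: split)
    qed
    moreover have "\<exists>j\<in>J. c' j \<noteq> 0" using c(1) by (auto simp: c'_def)
    ultimately show ?thesis by blast
  qed
qed

text \<open>The vectors \<open>v 0\<close>, ..., \<open>v (card I)\<close> live in a space of
  dimension \<open>card I\<close>, hence are dependent, and applying the matrix \<open>A\<close>
  carries a dependence to all later times. The top coefficient may vanish, so only some nonzero
  coefficient is asserted.\<close>

lemma linear_system_recurrence:
  fixes v :: "nat \<Rightarrow> 'i \<Rightarrow> 'k::field"
  assumes "finite I" and step: "\<And>n i. i \<in> I \<Longrightarrow> v (Suc n) i = (\<Sum>j\<in>I. A i j * v n j)"
  shows "\<exists>c d. (\<exists>k\<le>d. c k \<noteq> 0) \<and> (\<forall>n. \<forall>i\<in>I. (\<Sum>k\<le>d. c k * v (n + k) i) = 0)"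
proof -
  obtain c where c: "\<exists>k\<in>{..card I}. c k \<noteq> 0" "\<forall>i\<in>I. (\<Sum>k\<le>card I. c k * v k i) = 0"
    using homogeneous_system_nonzero_solution[of I "{..card I}" "\<lambda>i k. v k i"] assms(1) by auto
  have "\<forall>i\<in>I. (\<Sum>k\<le>card I. c k * v (n + k) i) = 0" for n
  proof (induction n)
    case 0
    then show ?case using c by simp
  next
    case (Suc n)
    show ?case
    proof
      fix i assume i: "i \<in> I"
      have "(\<Sum>k\<le>card I. c k * v (Suc n + k) i)
          = (\<Sum>k\<le>card I. \<Sum>j\<in>I. A i j * (c k * v (n + k) j))"
        using i by (simp add: step sum_distrib_left algebra_simps)
      also have "\<dots> = (\<Sum>j\<in>I. A i j * (\<Sum>k\<le>card I. c k * v (n + k) j))"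
        by (subst sum.swap) (simp add: sum_distrib_left)
      also have "\<dots> = 0" using Suc by simp
      finally show "(\<Sum>k\<le>card I. c k * v (Suc n + k) i) = 0" .
    qed
  qed
  then show ?thesis using c(1) by (intro exI[of _ c] exI[of _ "card I"]) auto
qed

text \<open>\<open>Q\<close> is the characteristic polynomial of the recurrence with its
  coefficients reversed. In the product with the series every full window of the recurrence cancels;
  \<open>P\<close> collects the initial terms that are left. The last clause tracks rationality for
  the algebraicity argument.\<close>

lemma recurrence_generating_function:
  fixes v c :: "nat \<Rightarrow> real"
  assumes rec: "\<And>n. (\<Sum>k\<le>d. c k * v (n + k)) = 0" and nz: "\<exists>k\<le>d. c k \<noteq> 0"
  shows "\<exists>P Q. Q \<noteq> 0 \<and> (\<forall>x. summable (\<lambda>n. v n * x ^ n) \<longrightarrow> poly Q x * (\<Sum>n. v n * x ^ n) = poly P x)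
    \<and> ((\<forall>k. c k \<in> \<rat>) \<longrightarrow> (\<forall>n. v n \<in> \<rat>) \<longrightarrow> (\<forall>i. coeff P i \<in> \<rat>) \<and> (\<forall>i. coeff Q i \<in> \<rat>))"
proof -
  define Q where "Q = (\<Sum>k\<le>d. monom (c k) (d - k))"
  define P where "P = (\<Sum>k\<le>d. \<Sum>n<k. monom (c k * v n) (n + (d - k)))"
  have "Q \<noteq> 0"
  proof -
    obtain k where k: "k \<le> d" "c k \<noteq> 0" using nz by blast
    have "coeff Q (d - k) = (\<Sum>j\<le>d. if j = k then c j else 0)"
      unfolding Q_def coeff_sum by (rule sum.cong) (use k in auto)
    also have "\<dots> = c k" using k by simp
    finally show ?thesis using k by auto
  qed
  moreover have "poly Q x * (\<Sum>n. v n * x ^ n) = poly P x" if sm: "summable (\<lambda>n. v n * x ^ n)" for x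
  proof -
    have sm': "summable (\<lambda>n. v (n + k) * x ^ (n + k))" for k
      using sm summable_iff_shift[of "\<lambda>n. v n * x ^ n" k] by simp
    have shift: "(\<Sum>n. v n * x ^ n) = (\<Sum>n. v (n + k) * x ^ (n + k)) + (\<Sum>n<k. v n * x ^ n)" for k
      using suminf_split_initial_segment[OF sm, of k] by simp
    have pw: "x ^ (d - k) * x ^ (n + k) = x ^ d * x ^ n" if "k \<le> d" for n k
      using that by (simp flip: power_add)
    have sm2: "summable (\<lambda>n. c k * x ^ (d - k) * (v (n + k) * x ^ (n + k)))" for k
      by (intro summable_mult sm')
    have "poly Q x * (\<Sum>n. v n * x ^ n) = (\<Sum>k\<le>d. c k * x ^ (d - k) * (\<Sum>n. v n * x ^ n))"
      by (simp add: Q_def poly_sum poly_monom sum_distrib_right)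
    also have "\<dots> = (\<Sum>k\<le>d. c k * x ^ (d - k) * (\<Sum>n. v (n + k) * x ^ (n + k)))
        + (\<Sum>k\<le>d. c k * x ^ (d - k) * (\<Sum>n<k. v n * x ^ n))"
      unfolding sum.distrib[symmetric] distrib_left[symmetric] shift[symmetric] ..
    also have "(\<Sum>k\<le>d. c k * x ^ (d - k) * (\<Sum>n<k. v n * x ^ n)) = poly P x"
      unfolding P_def poly_sum
      by (intro sum.cong refl) (simp only: poly_monom sum_distrib_left power_add mult_ac)
    also have "(\<Sum>k\<le>d. c k * x ^ (d - k) * (\<Sum>n. v (n + k) * x ^ (n + k)))
        = (\<Sum>k\<le>d. \<Sum>n. c k * x ^ (d - k) * (v (n + k) * x ^ (n + k)))"
      by (intro sum.cong refl suminf_mult[symmetric] sm')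
    also have "\<dots> = (\<Sum>n. \<Sum>k\<le>d. c k * x ^ (d - k) * (v (n + k) * x ^ (n + k)))"
      by (rule suminf_sum[symmetric]) (rule sm2)
    also have "(\<lambda>n. \<Sum>k\<le>d. c k * x ^ (d - k) * (v (n + k) * x ^ (n + k))) = (\<lambda>n. 0)"
    proof
      fix n
      have "(\<Sum>k\<le>d. c k * x ^ (d - k) * (v (n + k) * x ^ (n + k)))
          = (\<Sum>k\<le>d. (c k * v (n + k)) * (x ^ d * x ^ n))"
        by (rule sum.cong) (auto simp: pw[symmetric] algebra_simps)
      also have "\<dots> = 0" using rec[of n] by (simp flip: sum_distrib_right)
      finally show "(\<Sum>k\<le>d. c k * x ^ (d - k) * (v (n + k) * x ^ (n + k))) = 0" .
    qed
    finally show ?thesis by simp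
  qed
  moreover have "(\<forall>i. coeff P i \<in> \<rat>) \<and> (\<forall>i. coeff Q i \<in> \<rat>)"
    if "\<forall>k. c k \<in> \<rat>" "\<forall>n. v n \<in> \<rat>"
    using that by (auto simp: P_def Q_def coeff_sum intro!: Rats_sum)
  ultimately show ?thesis by blast
qed

lemma poly_split_order:
  fixes P :: "real poly"
  assumes "P \<noteq> 0"
  obtains k P1 where "P = [:- a, 1:] ^ k * P1" "poly P1 a \<noteq> 0"
  using order_decomp[OF assms, of a] by (metis poly_eq_0_iff_dvd)

lemma tendsto_poly_at_left: "(poly P \<longlongrightarrow> poly P a) (at_left (a::real))"
  using isCont_def[of a "poly P"] poly_isCont[of a P]
  by (meson filterlim_at_split)

section \<open>Order of a pole at 1 and growth of the coefficients\<close>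

text \<open>The order of a pole is an integer, so a pole weaker than order three has order at most
  two. The relation is kept as a product because \<open>Q\<close> may vanish elsewhere on the
  interval.\<close>

lemma rational_pole_order_drop:
  fixes V :: "real \<Rightarrow> real"
  assumes Q: "Q \<noteq> 0" and eq: "\<And>x. 0 \<le> x \<Longrightarrow> x < 1 \<Longrightarrow> poly Q x * V x = poly P x"
    and lim: "((\<lambda>x. (1 - x) ^ 3 * V x) \<longlongrightarrow> 0) (at_left 1)"
  shows "\<exists>B. \<forall>\<^sub>F x in at_left 1. (1 - x)\<^sup>2 * V x \<le> B"
proof -
  obtain k Q1 where Q1: "Q = [:- 1, 1:] ^ k * Q1" "poly Q1 1 \<noteq> 0"
    using poly_split_order[OF Q, of 1] by metis
  have ev01: "\<forall>\<^sub>F x in at_left (1::real). 0 < x \<and> x < 1"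
    using eventually_at_left_field[of "\<lambda>x. 0 < x \<and> x < 1" "1::real"] zero_less_one by blast
  have evQ1: "\<forall>\<^sub>F x in at_left 1. poly Q1 x \<noteq> 0"
    using tendsto_poly_at_left[of Q1 1] Q1(2) by (rule tendsto_imp_eventually_ne)
  show ?thesis
  proof (cases "P = 0")
    case True
    have "\<forall>\<^sub>F x in at_left 1. (1 - x)\<^sup>2 * V x \<le> 0"
      using ev01 evQ1
    proof eventually_elim
      case (elim x)
      have "poly Q x \<noteq> 0" using elim Q1 by (simp add: poly_power)
      then have "V x = 0" using eq[of x] elim True by simp
      then show ?case by simp
    qed
    then show ?thesis by blast
  next
    case False
    obtain j P1 where P1: "P = [:- 1, 1:] ^ j * P1" "poly P1 1 \<noteq> 0"
      using poly_split_order[OF False, of 1] by metis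
    have Veq: "\<forall>\<^sub>F x in at_left 1. (x - 1) ^ k * V x = (x - 1) ^ j * (poly P1 x / poly Q1 x)"
      using ev01 evQ1
    proof eventually_elim
      case (elim x)
      have "poly Q1 x * ((x - 1) ^ k * V x) = (x - 1) ^ j * poly P1 x"
        using eq[of x] elim Q1 P1 by (simp add: poly_power algebra_simps)
      then show ?case using elim by (simp add: field_simps)
    qed
    have lq: "((\<lambda>x. poly P1 x / poly Q1 x) \<longlongrightarrow> poly P1 1 / poly Q1 1) (at_left 1)"
      using Q1(2) by (intro tendsto_divide tendsto_poly_at_left)
    show ?thesis
    proof (cases "k \<le> j + 2")
      case True
      have "((\<lambda>x. (x - 1) ^ (j + 2 - k) * (poly P1 x / poly Q1 x)) \<longlongrightarrow>
          (1 - 1) ^ (j + 2 - k) * (poly P1 1 / poly Q1 1)) (at_left 1)"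
        by (intro tendsto_mult lq tendsto_power tendsto_diff tendsto_const tendsto_ident_at)
      then have "\<forall>\<^sub>F x in at_left 1. (x - 1) ^ (j + 2 - k) * (poly P1 x / poly Q1 x)
          < (1 - 1) ^ (j + 2 - k) * (poly P1 1 / poly Q1 1) + 1" (is "\<forall>\<^sub>F x in _. _ < ?B")
        by (rule order_tendstoD) simp
      then have "\<forall>\<^sub>F x in at_left 1. (1 - x)\<^sup>2 * V x \<le> ?B"
        using Veq ev01
      proof eventually_elim
        case (elim x)
        have "(x - 1) ^ k * ((x - 1)\<^sup>2 * V x) = (x - 1)\<^sup>2 * ((x - 1) ^ k * V x)" by simp
        also have "\<dots> = (x - 1)\<^sup>2 * ((x - 1) ^ j * (poly P1 x / poly Q1 x))"
          unfolding elim(2) ..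
        also have "\<dots> = (x - 1) ^ k * ((x - 1) ^ (j + 2 - k) * (poly P1 x / poly Q1 x))"
        proof -
          have "(x - 1)\<^sup>2 * (x - 1) ^ j = (x - 1) ^ k * (x - 1) ^ (j + 2 - k)"
          proof -
            have "2 + j = k + (j + 2 - k)" using True by simp
            then show ?thesis unfolding power_add[symmetric] by (rule arg_cong)
          qed
          then show ?thesis unfolding mult.assoc[symmetric] by (rule arg_cong)
        qed
        finally have "(x - 1) ^ k * ((x - 1)\<^sup>2 * V x)
            = (x - 1) ^ k * ((x - 1) ^ (j + 2 - k) * (poly P1 x / poly Q1 x))" .
        moreover have "(x - 1) ^ k \<noteq> 0" using elim by simp
        ultimately have "(x - 1)\<^sup>2 * V x = (x - 1) ^ (j + 2 - k) * (poly P1 x / poly Q1 x)"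
          by (metis mult_left_cancel)
        then show ?case using elim by (simp add: power2_commute)
      qed
      then show ?thesis by blast
    next
      case False
      \<comment> \<open>Here the pole would have order at least three, with excess \<open>e\<close>.
        Its leading coefficient \<open>poly P1 1 / poly Q1 1\<close> would be a limit of terms
        tending to 0, so \<open>P1\<close> would vanish at 1.\<close>
      define e where "e = k - j - 3"
      have k: "k = j + 3 + e" using False by (simp add: e_def)
      have "\<forall>\<^sub>F x in at_left 1. - ((x - 1) ^ e * ((1 - x) ^ 3 * V x)) = poly P1 x / poly Q1 x"
        using Veq ev01
      proof eventually_elim
        case (elim x)
        have cube: "(1 - x) ^ 3 = - ((x - 1) ^ 3)" by (simp add: power3_eq_cube algebra_simps)
        have "(x - 1) ^ j * ((x - 1) ^ e * (x - 1) ^ 3 * V x) = (x - 1) ^ j * (poly P1 x / poly Q1 x)"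
          using elim by (simp add: k power_add algebra_simps)
        moreover have "(x - 1) ^ j \<noteq> 0" using elim by simp
        ultimately have "(x - 1) ^ e * (x - 1) ^ 3 * V x = poly P1 x / poly Q1 x"
          by (metis mult_left_cancel)
        then show ?case unfolding cube by (simp add: mult.assoc)
      qed
      moreover have "((\<lambda>x. - ((x - 1) ^ e * ((1 - x) ^ 3 * V x))) \<longlongrightarrow> - ((1 - 1) ^ e * 0)) (at_left 1)"
        by (intro tendsto_minus tendsto_mult lim tendsto_power tendsto_diff tendsto_const tendsto_ident_at)
      ultimately have "((\<lambda>x. poly P1 x / poly Q1 x) \<longlongrightarrow> - ((1 - 1) ^ e * 0)) (at_left 1)"
        by (rule Lim_transform_eventually[rotated])
      then have "poly P1 1 / poly Q1 1 = - ((1 - 1) ^ e * 0)"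
        using lq tendsto_unique trivial_limit_at_left_real by blast
      then show ?thesis using P1 Q1 by simp
    qed
  qed
qed

text \<open>Elementary Tauberian bound: for nonnegative terms the partial sum up to \<open>n\<close>
  is at most twice the power series at a point where \<open>x ^ n\<close> is still at least
  \<open>1 / 2\<close>.\<close>

lemma partial_sums_quadratic_bound:
  fixes v :: "nat \<Rightarrow> real"
  assumes v0: "\<And>n. v n \<ge> 0" and sm: "\<And>x. 0 \<le> x \<Longrightarrow> x < 1 \<Longrightarrow> summable (\<lambda>n. v n * x ^ n)"
    and ev: "\<forall>\<^sub>F x in at_left 1. (1 - x)\<^sup>2 * (\<Sum>n. v n * x ^ n) \<le> B"
  shows "\<exists>B N. \<forall>n\<ge>N. (\<Sum>k\<le>n. v k) \<le> B * (real n)\<^sup>2"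
proof -
  obtain b where b: "b < 1" "\<And>x. b < x \<Longrightarrow> x < 1 \<Longrightarrow> (1 - x)\<^sup>2 * (\<Sum>n. v n * x ^ n) \<le> B"
    using ev eventually_at_left_field[of _ "1::real"] by auto
  obtain N where N: "real N > 1 / (1 - b)" using reals_Archimedean2 by blast
  have "(\<Sum>k\<le>n. v k) \<le> 8 * B * (real n)\<^sup>2" if n: "n \<ge> max N 1" for n
  proof -
    \<comment> \<open>Bernoulli's inequality gives \<open>x ^ n \<ge> 1 / 2\<close>, and
      \<open>(1 - x) ^ 2\<close> is \<open>1 / (4 * n ^ 2)\<close>; together they account for the
      factor 8.\<close>
    define x where "x = 1 - 1 / (2 * real n)"
    have n1: "real n \<ge> 1" using n by simp
    have x: "0 \<le> x" "x < 1" using n1 by (auto simp: x_def field_simps)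
    have "1 / (1 - b) < real n" using N n by (smt (verit) max.bounded_iff of_nat_le_iff)
    then have "1 / real n < 1 - b" using b(1) n1 by (simp add: field_simps)
    moreover have "1 / (2 * real n) \<le> 1 / real n" using n1 by (simp add: field_simps)
    ultimately have "b < x" unfolding x_def by linarith
    have "1 + real n * (- (1 / (2 * real n))) \<le> (1 + (- (1 / (2 * real n)))) ^ n"
      by (rule Bernoulli_inequality) (use n1 in \<open>simp add: field_simps\<close>)
    then have xn: "1 / 2 \<le> x ^ n" using n1 by (simp add: x_def)
    have "(\<Sum>k\<le>n. v k) * (1 / 2) \<le> (\<Sum>k\<le>n. v k * x ^ k)"
      unfolding sum_distrib_right
    proof (intro sum_mono mult_left_mono v0)
      fix k assume "k \<in> {..n}"
      then have "x ^ n \<le> x ^ k" using x by (intro power_decreasing) auto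
      then show "1 / 2 \<le> x ^ k" using xn by simp
    qed
    also have "\<dots> \<le> (\<Sum>n. v n * x ^ n)"
      by (rule sum_le_suminf[OF sm]) (use x v0 in auto)
    finally have 1: "(\<Sum>k\<le>n. v k) \<le> 2 * (\<Sum>n. v n * x ^ n)" by simp
    have "(1 - x)\<^sup>2 * (\<Sum>n. v n * x ^ n) \<le> B" using b \<open>b < x\<close> x by blast
    then have "(\<Sum>n. v n * x ^ n) \<le> B * (4 * (real n)\<^sup>2)"
      using n1 by (simp add: x_def field_simps power2_eq_square)
    then show ?thesis using 1 by simp
  qed
  then show ?thesis by blast
qed

text \<open>Second derivative of the geometric series, for finite sums: multiplying by
  \<open>1 - x\<close> lowers the degree of the coefficients by one and leaves a boundary term of
  the favourable sign. A bound for all partial sums gives summability and the bound of the value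
  together.\<close>

lemma sum_rising_two_le:
  fixes x :: real
  assumes x: "0 \<le> x" "x < 1"
  shows "(\<Sum>n<m. real ((n + 2) * (n + 1)) * x ^ n) \<le> 2 / (1 - x) ^ 3"
proof -
  have 1: "(1 - x) * (\<Sum>n<m. x ^ n) = 1 - x ^ m"
    by (rule one_diff_power_eq[symmetric])
  have 2: "(1 - x) * (\<Sum>n<m. real (n + 1) * x ^ n) = (\<Sum>n<m. x ^ n) - real m * x ^ m"
  proof (induction m)
    case (Suc m)
    have "(1 - x) * (\<Sum>n<Suc m. real (n + 1) * x ^ n)
        = (1 - x) * (\<Sum>n<m. real (n + 1) * x ^ n) + (1 - x) * (real (m + 1) * x ^ m)"
      by (simp only: sum.lessThan_Suc distrib_left)
    moreover have "(1 - x) * (real (m + 1) * x ^ m) - real m * x ^ m = x ^ m - real (Suc m) * x ^ Suc m"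
      by (simp add: algebra_simps)
    ultimately show ?case using Suc unfolding sum.lessThan_Suc by linarith
  qed simp
  have 3: "(1 - x) * (\<Sum>n<m. real ((n + 2) * (n + 1)) * x ^ n)
      = 2 * (\<Sum>n<m. real (n + 1) * x ^ n) - real (m * (m + 1)) * x ^ m"
  proof (induction m)
    case (Suc m)
    have "(1 - x) * (\<Sum>n<Suc m. real ((n + 2) * (n + 1)) * x ^ n)
        = (1 - x) * (\<Sum>n<m. real ((n + 2) * (n + 1)) * x ^ n)
          + (1 - x) * (real ((m + 2) * (m + 1)) * x ^ m)"
      by (simp only: sum.lessThan_Suc distrib_left)
    moreover have "(1 - x) * (real ((m + 2) * (m + 1)) * x ^ m) - real (m * (m + 1)) * x ^ m
        = 2 * (real (m + 1) * x ^ m) - real (Suc m * (Suc m + 1)) * x ^ Suc m"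
      by (simp add: algebra_simps)
    ultimately show ?case using Suc unfolding sum.lessThan_Suc distrib_left by linarith
  qed simp
  have "(1 - x) ^ 3 * (\<Sum>n<m. real ((n + 2) * (n + 1)) * x ^ n)
      = (1 - x)\<^sup>2 * ((1 - x) * (\<Sum>n<m. real ((n + 2) * (n + 1)) * x ^ n))"
    by (simp add: power3_eq_cube power2_eq_square)
  also have "\<dots> \<le> (1 - x)\<^sup>2 * (2 * (\<Sum>n<m. real (n + 1) * x ^ n))"
    unfolding 3 using x by (intro mult_left_mono) auto
  also have "\<dots> = 2 * ((1 - x) * ((1 - x) * (\<Sum>n<m. real (n + 1) * x ^ n)))"
    by (simp add: power2_eq_square)
  also have "\<dots> \<le> 2 * ((1 - x) * (\<Sum>n<m. x ^ n))"
    unfolding 2 using x by (intro mult_left_mono) auto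
  also have "\<dots> \<le> 2" unfolding 1 using x by simp
  finally show ?thesis using x by (simp add: field_simps)
qed

text \<open>Since \<open>v n\<close> is \<open>o(n ^ 2)\<close>, the series is
  \<open>o(1 / (1 - x) ^ 3)\<close> at 1; being rational, it has a pole of order at most two there.
  Other poles on the unit circle may exist, so the conclusion concerns partial sums, for which
  nonnegativity suffices.\<close>

lemma recurrence_partial_sums_bound:
  fixes v c :: "nat \<Rightarrow> real"
  assumes rec: "\<And>n. (\<Sum>k\<le>d. c k * v (n + k)) = 0" and nz: "\<exists>k\<le>d. c k \<noteq> 0"
    and v0: "\<And>n. v n \<ge> 0"
    and small: "\<And>\<epsilon>. \<epsilon> > 0 \<Longrightarrow> \<exists>N. \<forall>n\<ge>N. v n \<le> \<epsilon> * (real n)\<^sup>2"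
  shows "\<exists>B N. \<forall>n\<ge>N. (\<Sum>k\<le>n. v k) \<le> B * (real n)\<^sup>2"
proof -
  from recurrence_generating_function[OF rec nz]
  obtain P Q where "Q \<noteq> 0 \<and> (\<forall>x. summable (\<lambda>n. v n * x ^ n) \<longrightarrow> poly Q x * (\<Sum>n. v n * x ^ n) = poly P x)"
    by (elim exE conjE) (rule that, rule conjI)
  then have PQ: "Q \<noteq> 0"
    "\<And>x. summable (\<lambda>n. v n * x ^ n) \<Longrightarrow> poly Q x * (\<Sum>n. v n * x ^ n) = poly P x"
    by simp_all
  have sum2: "summable (\<lambda>n. real ((n + 2) * (n + 1)) * x ^ n) \<and>
      (\<Sum>n. real ((n + 2) * (n + 1)) * x ^ n) \<le> 2 / (1 - x) ^ 3" if x: "0 \<le> x" "x < 1" for x :: real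
  proof -
    have "summable (\<lambda>n. real ((n + 2) * (n + 1)) * x ^ n)"
      by (rule summableI_nonneg_bounded[OF _ sum_rising_two_le[OF x]]) (use x in auto)
    then show ?thesis using sum_rising_two_le[OF x] by (blast intro: suminf_le_const)
  qed
  \<comment> \<open>The weights \<open>(n + 2) * (n + 1)\<close> majorise the square, and their
    power series is bounded explicitly.\<close>
  have "\<exists>M. M \<ge> 0 \<and> (\<forall>n. v n \<le> \<epsilon> * real ((n + 2) * (n + 1)) + M)" if "\<epsilon> > 0" for \<epsilon> :: real
  proof -
    obtain N where N: "\<forall>n\<ge>N. v n \<le> \<epsilon> * (real n)\<^sup>2" using small \<open>\<epsilon> > 0\<close> by blast
    have "v n \<le> \<epsilon> * real ((n + 2) * (n + 1)) + (\<Sum>k<N. v k)" for n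
    proof (cases "n < N")
      case True
      then have "v n \<le> (\<Sum>k<N. v k)" using v0 by (intro member_le_sum) auto
      moreover have "0 \<le> \<epsilon> * real ((n + 2) * (n + 1))" using that by simp
      ultimately show ?thesis by linarith
    next
      case False
      then have "v n \<le> \<epsilon> * (real n)\<^sup>2" using N by simp
      also have "\<dots> \<le> \<epsilon> * real ((n + 2) * (n + 1))"
        using that by (intro mult_left_mono) (auto simp: power2_eq_square algebra_simps)
      also have "\<dots> \<le> \<dots> + (\<Sum>k<N. v k)" using v0 by (simp add: sum_nonneg)
      finally show ?thesis .
    qed
    moreover have "(\<Sum>k<N. v k) \<ge> 0" using v0 by (simp add: sum_nonneg)
    ultimately show ?thesis by blast
  qed
  note bound = this
  have sm: "summable (\<lambda>n. v n * x ^ n)" if x: "0 \<le> x" "x < 1" for x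
  proof -
    obtain M where M: "M \<ge> 0" "\<And>n. v n \<le> 1 * real ((n + 2) * (n + 1)) + M" using bound[of 1] by auto
    have "summable (\<lambda>n. real ((n + 2) * (n + 1)) * x ^ n + M * x ^ n)"
      using sum2[OF x] x by (intro summable_add summable_mult summable_geometric) auto
    then show ?thesis
    proof (rule summable_comparison_test')
      fix n show "norm (v n * x ^ n) \<le> real ((n + 2) * (n + 1)) * x ^ n + M * x ^ n"
        using mult_right_mono[OF M(2)[of n], of "x ^ n"] v0[of n] x
        by (simp add: abs_mult algebra_simps)
    qed
  qed
  have lim: "((\<lambda>x. (1 - x) ^ 3 * (\<Sum>n. v n * x ^ n)) \<longlongrightarrow> 0) (at_left 1)"
  proof (rule tendstoI)
    fix e :: real assume e: "e > 0"
    \<comment> \<open>With \<open>e / 4\<close> the main part contributes at most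
      \<open>e / 2\<close>, and the range of \<open>x\<close> below keeps the part coming from
      \<open>M\<close> under the other half.\<close>
    obtain M where M: "M \<ge> 0" "\<And>n. v n \<le> e / 4 * real ((n + 2) * (n + 1)) + M"
      using bound[of "e / 4"] e by auto
    have ev: "\<forall>\<^sub>F x in at_left (1::real). 0 < x \<and> x < 1 \<and> 1 - x < e / (4 * (M + 1))"
      unfolding eventually_at_left_field
      by (rule exI[of _ "max 0 (1 - e / (4 * (M + 1)))"]) (use e M in auto)
    then show "\<forall>\<^sub>F x in at_left 1. dist ((1 - x) ^ 3 * (\<Sum>n. v n * x ^ n)) 0 < e"
    proof eventually_elim
      case (elim x)
      then have x: "0 \<le> x" "x < 1" by auto
      have geo: "(\<lambda>n. x ^ n) sums (1 / (1 - x))" using x by (intro geometric_sums) auto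
      have s1: "summable (\<lambda>n. e / 4 * (real ((n + 2) * (n + 1)) * x ^ n))"
        using sum2[OF x] by (intro summable_mult) auto
      have s2: "summable (\<lambda>n. M * x ^ n)" by (intro summable_mult sums_summable[OF geo])
      have "(\<Sum>n. v n * x ^ n) \<le> (\<Sum>n. e / 4 * (real ((n + 2) * (n + 1)) * x ^ n) + M * x ^ n)"
      proof (intro suminf_le sm summable_add s1 s2 x)
        fix n show "v n * x ^ n \<le> e / 4 * (real ((n + 2) * (n + 1)) * x ^ n) + M * x ^ n"
          using mult_right_mono[OF M(2)[of n], of "x ^ n"] x by (simp add: algebra_simps)
      qed
      also have "\<dots> = e / 4 * (\<Sum>n. real ((n + 2) * (n + 1)) * x ^ n) + M * (1 / (1 - x))"
      proof -
        have "(\<Sum>n. M * x ^ n) = M * (1 / (1 - x))"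
          using suminf_mult[OF sums_summable[OF geo], of M] sums_unique[OF geo] by simp
        moreover have "(\<Sum>n. e / 4 * (real ((n + 2) * (n + 1)) * x ^ n))
            = e / 4 * (\<Sum>n. real ((n + 2) * (n + 1)) * x ^ n)"
          using sum2[OF x] by (intro suminf_mult) auto
        ultimately show ?thesis using suminf_add[OF s1 s2] by simp
      qed
      also have "\<dots> \<le> e / 4 * (2 / (1 - x) ^ 3) + M * (1 / (1 - x))"
        using sum2[OF x] e by (intro add_right_mono mult_left_mono) auto
      finally have "(1 - x) ^ 3 * (\<Sum>n. v n * x ^ n)
          \<le> (1 - x) ^ 3 * (e / 4 * (2 / (1 - x) ^ 3) + M * (1 / (1 - x)))"
        using x by (intro mult_left_mono) auto
      also have "\<dots> = e / 2 + M * (1 - x)\<^sup>2"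
      proof -
        have "y ^ 3 * (e / 4 * (2 / y ^ 3) + M * (1 / y)) = e / 2 + M * y\<^sup>2" if "y \<noteq> 0" for y :: real
          using that by (simp add: field_simps power2_eq_square power3_eq_cube)
        then show ?thesis using x by simp
      qed
      also have "M * (1 - x)\<^sup>2 \<le> (M + 1) * (1 - x)"
        using M x by (intro mult_mono) (auto simp: power2_eq_square mult_left_le_one_le)
      also have "(M + 1) * (1 - x) < e / 2"
        using elim M e by (simp add: field_simps)
      finally have "(1 - x) ^ 3 * (\<Sum>n. v n * x ^ n) < e" by simp
      moreover have "0 \<le> (1 - x) ^ 3 * (\<Sum>n. v n * x ^ n)"
        using x v0 sm by (intro mult_nonneg_nonneg suminf_nonneg) auto
      ultimately show ?case by (simp add: dist_real_def)
    qed
  qed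
  have "poly Q x * (\<Sum>n. v n * x ^ n) = poly P x" if "0 \<le> x" "x < 1" for x
    by (intro PQ(2) sm that)
  from rational_pole_order_drop[OF PQ(1) this lim]
  obtain B where "\<forall>\<^sub>F x in at_left 1. (1 - x)\<^sup>2 * (\<Sum>n. v n * x ^ n) \<le> B" ..
  from partial_sums_quadratic_bound[OF v0 sm this] show ?thesis .
qed

section \<open>Algebraicity of values and limits of rational functions\<close>

text \<open>Differentiation extracts the cofactor at the root without leaving the polynomials with
  rational coefficients; dividing by \<open>[:- a, 1:] ^ i\<close> may leave them when
  \<open>a\<close> is irrational.\<close>

lemma poly_higher_pderiv_at_root:
  fixes U :: "'a::field_char_0 poly"
  shows "poly ((pderiv ^^ i) ([:- a, 1:] ^ i * U)) a = fact i * poly U a"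
proof (induction i arbitrary: U)
  case (Suc i)
  have "pderiv ([:- a, 1:] ^ Suc i * U)
      = [:- a, 1:] ^ i * (smult (of_nat (Suc i)) U + [:- a, 1:] * pderiv U)"
    by (simp only: pderiv_mult pderiv_power_Suc) (simp add: pderiv_pCons algebra_simps)
  then have "poly ((pderiv ^^ Suc i) ([:- a, 1:] ^ Suc i * U)) a
      = poly ((pderiv ^^ i) ([:- a, 1:] ^ i * (smult (of_nat (Suc i)) U + [:- a, 1:] * pderiv U))) a"
    by (simp only: funpow_Suc_right o_apply)
  also have "\<dots> = fact i * (of_nat (Suc i) * poly U a)"
    unfolding Suc by simp
  finally show ?case by (simp add: algebra_simps)
qed simp

lemma coeff_higher_pderiv_Rats:
  fixes P :: "'a::field_char_0 poly"
  shows "(\<forall>i. coeff P i \<in> \<rat>) \<Longrightarrow> coeff ((pderiv ^^ k) P) i \<in> \<rat>"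
  by (induction k arbitrary: i) (auto simp: coeff_pderiv intro!: Rats_mult Rats_add)

text \<open>Reduction modulo a rational polynomial that annihilates \<open>\<alpha>\<close>;
  \<open>n\<close> is its degree.\<close>

lemma algebraic_power_rational_span:
  fixes \<alpha> :: "'a::field_char_0"
  assumes "algebraic \<alpha>"
  shows "\<exists>n. \<forall>k. \<exists>c. \<alpha> ^ k = (\<Sum>i<n. of_rat (c i) * \<alpha> ^ i)"
proof -
  obtain p where p: "\<forall>i. coeff p i \<in> \<rat>" "p \<noteq> 0" "poly p \<alpha> = 0"
    using assms unfolding algebraic_altdef by blast
  have "\<forall>i. \<exists>r. coeff p i = of_rat r" using p(1) by (auto elim: Rats_cases)
  from choice[OF this] obtain q where q: "\<And>i. coeff p i = of_rat (q i)" by auto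
  define n where "n = degree p"
  have qn: "q n \<noteq> 0" using p(2) q[of n] by (auto simp: n_def)
  have "0 = (\<Sum>i\<le>n. of_rat (q i) * \<alpha> ^ i)"
    using p(3) by (simp add: poly_altdef q n_def)
  then have *: "of_rat (q n) * \<alpha> ^ n = - (\<Sum>i<n. of_rat (q i) * \<alpha> ^ i)"
    by (simp add: lessThan_Suc_atMost[symmetric] eq_neg_iff_add_eq_0 add.commute)
  have top: "\<alpha> ^ n = (\<Sum>i<n. of_rat (- q i / q n) * \<alpha> ^ i)"
  proof -
    have "\<alpha> ^ n = - (\<Sum>i<n. of_rat (q i) * \<alpha> ^ i) / of_rat (q n)"
      using qn unfolding *[symmetric] by simp
    then show ?thesis
      by (simp add: sum_divide_distrib sum_negf of_rat_divide of_rat_minus)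
  qed
  have "\<exists>c. \<alpha> ^ k = (\<Sum>i<n. of_rat (c i) * \<alpha> ^ i)" for k
  proof (induction k)
    case 0
    show ?case
    proof (cases n)
      case 0
      then show ?thesis using top by auto
    next
      case (Suc m)
      then show ?thesis
        by (intro exI[of _ "\<lambda>i. if i = 0 then 1 else 0"]) (simp add: sum.lessThan_Suc_shift del: sum.lessThan_Suc)
    qed
  next
    case (Suc k)
    then obtain c where c: "\<alpha> ^ k = (\<Sum>i<n. of_rat (c i) * \<alpha> ^ i)" by blast
    show ?case
    proof (cases n)
      case 0
      then show ?thesis using top by auto
    next
      case (Suc m)
      have "\<alpha> ^ Suc k = (\<Sum>i<n. of_rat (c i) * \<alpha> ^ Suc i)"
        by (simp add: c sum_distrib_left algebra_simps)
      also have "\<dots> = (\<Sum>i<m. of_rat (c i) * \<alpha> ^ Suc i) + of_rat (c m) * \<alpha> ^ n"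
        by (simp add: Suc)
      also have "(\<Sum>i<m. of_rat (c i) * \<alpha> ^ Suc i)
          = (\<Sum>i<n. of_rat (case i of 0 \<Rightarrow> 0 | Suc j \<Rightarrow> c j) * \<alpha> ^ i)"
        unfolding Suc sum.lessThan_Suc_shift by simp
      also have "of_rat (c m) * \<alpha> ^ n = (\<Sum>i<n. of_rat (c m * (- q i / q n)) * \<alpha> ^ i)"
        unfolding top sum_distrib_left by (simp only: of_rat_mult mult.assoc)
      finally have "\<alpha> ^ Suc k = (\<Sum>i<n. of_rat ((case i of 0 \<Rightarrow> 0 | Suc j \<Rightarrow> c j) + c m * (- q i / q n)) * \<alpha> ^ i)"
        by (simp only: sum.distrib[symmetric] of_rat_add distrib_right)
      then show ?thesis by (rule exI[of _ "\<lambda>i. (case i of 0 \<Rightarrow> 0 | Suc j \<Rightarrow> c j) + c m * (- q i / q n)"])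
    qed
  qed
  then show ?thesis by blast
qed

text \<open>The \<open>n + 1\<close> products of total degree \<open>n\<close> in the two values lie
  in the rational span of \<open>n\<close> numbers, so they satisfy a rational relation; dividing it
  by \<open>poly B \<alpha> ^ n\<close> gives a polynomial that annihilates the quotient.
  Homogeneity keeps inverses out of the span.\<close>

lemma algebraic_divide_rational_polys:
  fixes \<alpha> :: "'a::field_char_0"
  assumes "algebraic \<alpha>" and A: "\<forall>i. coeff A i \<in> \<rat>" and B: "\<forall>i. coeff B i \<in> \<rat>" and nz: "poly B \<alpha> \<noteq> 0"
  shows "algebraic (poly A \<alpha> / poly B \<alpha>)"
proof -
  obtain n where n: "\<And>k. \<exists>c. \<alpha> ^ k = (\<Sum>i<n. of_rat (c i) * \<alpha> ^ i)"
    using algebraic_power_rational_span[OF assms(1)] by blast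
  then obtain w where w: "\<And>k. \<alpha> ^ k = (\<Sum>i<n. of_rat (w k i) * \<alpha> ^ i)" by metis
  have span: "\<exists>c. poly P \<alpha> = (\<Sum>i<n. of_rat (c i) * \<alpha> ^ i)" if P: "\<forall>i. coeff P i \<in> \<rat>" for P
  proof -
    have "\<forall>i. \<exists>r. coeff P i = of_rat r" using P by (auto elim: Rats_cases)
    from choice[OF this] obtain q where q: "\<And>i. coeff P i = of_rat (q i)" by auto
    have "poly P \<alpha> = (\<Sum>k\<le>degree P. of_rat (q k) * (\<Sum>i<n. of_rat (w k i) * \<alpha> ^ i))"
      unfolding poly_altdef q w[symmetric] ..
    also have "\<dots> = (\<Sum>i<n. \<Sum>k\<le>degree P. of_rat (q k) * (of_rat (w k i) * \<alpha> ^ i))"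
      unfolding sum_distrib_left by (rule sum.swap)
    also have "\<dots> = (\<Sum>i<n. of_rat (\<Sum>k\<le>degree P. q k * w k i) * \<alpha> ^ i)"
      by (simp add: of_rat_sum of_rat_mult sum_distrib_right mult.assoc)
    finally show ?thesis by (rule exI[of _ "\<lambda>i. \<Sum>k\<le>degree P. q k * w k i"])
  qed
  have rat: "\<forall>i. coeff (P ^ k) i \<in> \<rat>" if "\<forall>i. coeff P i \<in> \<rat>" for P :: "'a poly" and k
    using that
    by (induction k) (auto simp: coeff_mult coeff_1 intro!: Rats_sum Rats_mult)
  have "\<exists>c. poly A \<alpha> ^ k * poly B \<alpha> ^ (n - k) = (\<Sum>i<n. of_rat (c i) * \<alpha> ^ i)" for k
    using span[of "A ^ k * B ^ (n - k)"] rat[OF A, of k] rat[OF B, of "n - k"]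
    by (auto simp: coeff_mult poly_power intro!: Rats_sum Rats_mult)
  then obtain C where C: "\<And>k. poly A \<alpha> ^ k * poly B \<alpha> ^ (n - k) = (\<Sum>i<n. of_rat (C k i) * \<alpha> ^ i)"
    by metis
  obtain c where c: "\<exists>k\<in>{..n}. c k \<noteq> 0" "\<forall>i\<in>{..<n}. (\<Sum>k\<le>n. c k * C k i) = 0"
    using homogeneous_system_nonzero_solution[of "{..<n}" "{..n}" "\<lambda>i k. C k i"] by auto
  have "(\<Sum>k\<le>n. of_rat (c k) * (poly A \<alpha> ^ k * poly B \<alpha> ^ (n - k)))
      = (\<Sum>i<n. \<Sum>k\<le>n. of_rat (c k) * (of_rat (C k i) * \<alpha> ^ i))"
    unfolding C sum_distrib_left by (rule sum.swap)
  also have "\<dots> = (\<Sum>i<n. of_rat (\<Sum>k\<le>n. c k * C k i) * \<alpha> ^ i)"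
    by (simp add: of_rat_sum of_rat_mult sum_distrib_right mult.assoc)
  also have "\<dots> = 0" using c(2) by simp
  finally have 0: "(\<Sum>k\<le>n. of_rat (c k) * (poly A \<alpha> ^ k * poly B \<alpha> ^ (n - k))) = 0" .
  define p where "p = (\<Sum>k\<le>n. monom (of_rat (c k) :: 'a) k)"
  have coeff: "coeff p i = (if i \<le> n then of_rat (c i) else 0)" for i
    by (simp add: p_def coeff_sum)
  have "poly p (poly A \<alpha> / poly B \<alpha>) * poly B \<alpha> ^ n
      = (\<Sum>k\<le>n. of_rat (c k) * (poly A \<alpha> ^ k * poly B \<alpha> ^ (n - k)))"
    unfolding p_def poly_sum poly_monom sum_distrib_right
    using nz by (intro sum.cong refl) (simp add: power_divide power_diff)
  then have "poly p (poly A \<alpha> / poly B \<alpha>) = 0" using 0 nz by simp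
  moreover have "p \<noteq> 0"
  proof -
    obtain k where "k \<le> n" "c k \<noteq> 0" using c(1) by auto
    then have "coeff p k \<noteq> 0" by (simp add: coeff)
    then show ?thesis by auto
  qed
  ultimately show ?thesis by (intro algebraicI'[of p]) (auto simp: coeff)
qed

text \<open>A finite limit forces \<open>R\<close> to vanish at \<open>\<alpha>\<close> at least to
  the order \<open>i\<close> of \<open>T\<close>, and then the limit is the quotient of the
  \<open>i\<close>-th derivatives. The cofactors may have irrational coefficients, hence the passage
  to derivatives.\<close>

lemma algebraic_limit_rational_function:
  fixes R T :: "real poly"
  assumes alg: "algebraic \<alpha>" and R: "\<forall>i. coeff R i \<in> \<rat>" and T: "\<forall>i. coeff T i \<in> \<rat>" and "T \<noteq> 0"
    and lim: "((\<lambda>x. poly R x / poly T x) \<longlongrightarrow> l) (at_left \<alpha>)"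
  shows "algebraic l"
proof -
  obtain i T1 where T1: "T = [:- \<alpha>, 1:] ^ i * T1" "poly T1 \<alpha> \<noteq> 0"
    using poly_split_order[OF \<open>T \<noteq> 0\<close>] by metis
  have ne: "\<forall>\<^sub>F x in at_left \<alpha>. x \<noteq> \<alpha>" by (simp add: eventually_at_filter)
  have "[:- \<alpha>, 1:] ^ i dvd R"
  proof (cases "R = 0")
    case False
    obtain j R1 where R1: "R = [:- \<alpha>, 1:] ^ j * R1" "poly R1 \<alpha> \<noteq> 0"
      using poly_split_order[OF False] by metis
    have "i \<le> j"
    proof (rule ccontr)
      assume "\<not> i \<le> j"
      \<comment> \<open>A smaller order \<open>j\<close> would make \<open>R1\<close> the limit of
        \<open>(x - \<alpha>) ^ Suc e\<close> times a convergent expression, hence zero at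
        \<open>\<alpha>\<close>.\<close>
      then obtain e where e: "i = j + Suc e" using less_imp_Suc_add[of j i] by auto
      have "\<forall>\<^sub>F x in at_left \<alpha>. (x - \<alpha>) ^ Suc e * poly T1 x * (poly R x / poly T x) = poly R1 x"
        using ne tendsto_imp_eventually_ne[OF tendsto_poly_at_left T1(2)]
      proof eventually_elim
        case (elim x)
        then have "x - \<alpha> \<noteq> 0" by simp
        moreover have "poly R x = (x - \<alpha>) ^ j * poly R1 x"
          unfolding R1 by (simp add: poly_power)
        moreover have "poly T x = (x - \<alpha>) ^ (j + Suc e) * poly T1 x"
          unfolding T1 e poly_mult poly_power by simp
        ultimately show ?case using elim by (simp add: power_add)
      qed
      moreover have "((\<lambda>x. (x - \<alpha>) ^ Suc e * poly T1 x * (poly R x / poly T x))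
          \<longlongrightarrow> (\<alpha> - \<alpha>) ^ Suc e * poly T1 \<alpha> * l) (at_left \<alpha>)"
        by (intro tendsto_intros lim tendsto_poly_at_left)
      ultimately have "(poly R1 \<longlongrightarrow> (\<alpha> - \<alpha>) ^ Suc e * poly T1 \<alpha> * l) (at_left \<alpha>)"
        by (rule Lim_transform_eventually[rotated])
      then have "poly R1 \<alpha> = (\<alpha> - \<alpha>) ^ Suc e * poly T1 \<alpha> * l"
        by (rule tendsto_unique[OF trivial_limit_at_left_real tendsto_poly_at_left])
      then show False using R1 by simp
    qed
    then show ?thesis unfolding R1 by (intro dvd_mult2 le_imp_power_dvd)
  qed simp
  then obtain R2 where R2: "R = [:- \<alpha>, 1:] ^ i * R2" by (rule dvdE)
  have "\<forall>\<^sub>F x in at_left \<alpha>. poly R x / poly T x = poly R2 x / poly T1 x"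
    using ne by eventually_elim (simp add: R2 T1 poly_power)
  then have "((\<lambda>x. poly R2 x / poly T1 x) \<longlongrightarrow> l) (at_left \<alpha>)"
    by (rule Lim_transform_eventually[OF lim])
  moreover have "((\<lambda>x. poly R2 x / poly T1 x) \<longlongrightarrow> poly R2 \<alpha> / poly T1 \<alpha>) (at_left \<alpha>)"
    using T1(2) by (intro tendsto_divide tendsto_poly_at_left)
  ultimately have "l = poly R2 \<alpha> / poly T1 \<alpha>"
    by (rule tendsto_unique[OF trivial_limit_at_left_real])
  also have "\<dots> = poly ((pderiv ^^ i) R) \<alpha> / poly ((pderiv ^^ i) T) \<alpha>"
    unfolding R2 T1 poly_higher_pderiv_at_root by simp
  finally have l: "l = poly ((pderiv ^^ i) R) \<alpha> / poly ((pderiv ^^ i) T) \<alpha>" .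
  have "poly ((pderiv ^^ i) T) \<alpha> \<noteq> 0"
    unfolding T1 poly_higher_pderiv_at_root using T1(2) by simp
  moreover have "\<forall>j. coeff ((pderiv ^^ i) R) j \<in> \<rat>" "\<forall>j. coeff ((pderiv ^^ i) T) j \<in> \<rat>"
    using coeff_higher_pderiv_Rats[OF R] coeff_higher_pderiv_Rats[OF T] by simp_all
  ultimately show ?thesis unfolding l using alg by (intro algebraic_divide_rational_polys)
qed

section \<open>Concentration of almost additive functions\<close>

text \<open>Comparing \<open>u m / m\<close> and \<open>u n / n\<close> with
  \<open>u (m * n) / (m * n)\<close> shows that they differ by at most \<open>K / m + K / n\<close>.
  The limit is therefore approached at rate \<open>K / n\<close>, and the error stays bounded by the
  same \<open>K\<close>.\<close>

lemma nearly_additive_linear: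
  fixes u :: "nat \<Rightarrow> real"
  assumes add: "\<And>m n. \<bar>u (m + n) - u m - u n\<bar> \<le> K"
  shows "\<exists>L. \<forall>n. \<bar>u n - real n * L\<bar> \<le> K"
proof -
  have K: "K \<ge> 0" using add[of 0 0] by linarith
  have mult: "\<bar>u (Suc k * n) - real (Suc k) * u n\<bar> \<le> real (Suc k) * K" for k n
  proof (induction k)
    case (Suc k)
    have "\<bar>u (Suc k * n + n) - u (Suc k * n) - u n\<bar> \<le> K" by (rule add)
    moreover have "u (Suc (Suc k) * n) = u (Suc k * n + n)" by (simp add: add.commute)
    moreover have "real (Suc (Suc k)) * u n = real (Suc k) * u n + u n"
      "real (Suc (Suc k)) * K = real (Suc k) * K + K" by (simp_all add: algebra_simps)
    ultimately show ?case using Suc by linarith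
  qed (use K in simp)
  define r where "r n = u (Suc n) / real (Suc n)" for n
  have comp: "\<bar>u (Suc m * Suc n) / real (Suc m * Suc n) - r n\<bar> \<le> K / real (Suc n)" for m n
  proof -
    have "u (Suc m * Suc n) / real (Suc m * Suc n) - r n
        = (u (Suc m * Suc n) - real (Suc m) * u (Suc n)) / real (Suc m * Suc n)"
      unfolding r_def of_nat_mult by (simp add: field_simps del: of_nat_Suc)
    also have "\<bar>\<dots>\<bar> \<le> real (Suc m) * K / real (Suc m * Suc n)"
      unfolding abs_divide using mult[of m "Suc n"] by (simp add: divide_right_mono del: of_nat_Suc)
    also have "\<dots> = K / real (Suc n)" unfolding of_nat_mult by (simp add: field_simps del: of_nat_Suc)
    finally show ?thesis .
  qed
  have close: "\<bar>r m - r n\<bar> \<le> K / real (Suc m) + K / real (Suc n)" for m n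
    using comp[of m n] comp[of n m] by (simp add: mult.commute)
  have "Cauchy r"
  proof (rule metric_CauchyI)
    fix e :: real assume e: "e > 0"
    obtain M where M: "2 * K / e < real M" using reals_Archimedean2 by blast
    have small: "K / real (Suc m) < e / 2" if "m \<ge> M" for m
    proof -
      have "2 * K / e < real (Suc m)" using M that by simp
      then show ?thesis using e by (simp add: field_simps del: of_nat_Suc)
    qed
    have "dist (r m) (r n) < e" if "m \<ge> M" "n \<ge> M" for m n
      unfolding dist_real_def using close[of m n] small[OF that(1)] small[OF that(2)] by linarith
    then show "\<exists>M. \<forall>m\<ge>M. \<forall>n\<ge>M. dist (r m) (r n) < e" by blast
  qed
  then obtain L where L: "r \<longlonglongrightarrow> L" using Cauchy_convergent convergent_def by blast
  have "\<bar>L - r n\<bar> \<le> K / real (Suc n)" for n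
  proof (rule LIMSEQ_le)
    show "(\<lambda>m. \<bar>r m - r n\<bar>) \<longlonglongrightarrow> \<bar>L - r n\<bar>" by (intro tendsto_intros L)
    have "(\<lambda>m. K * inverse (real (Suc m)) + K / real (Suc n)) \<longlonglongrightarrow> K * 0 + K / real (Suc n)"
      by (intro tendsto_intros LIMSEQ_inverse_real_of_nat)
    then show "(\<lambda>m. K / real (Suc m) + K / real (Suc n)) \<longlonglongrightarrow> K / real (Suc n)"
      by (simp add: divide_inverse)
    show "\<exists>N. \<forall>m\<ge>N. \<bar>r m - r n\<bar> \<le> K / real (Suc m) + K / real (Suc n)" using close by blast
  qed
  then have "\<bar>u (Suc n) - real (Suc n) * L\<bar> \<le> K" for n
  proof -
    have "\<bar>u (Suc n) - real (Suc n) * L\<bar> = real (Suc n) * \<bar>L - r n\<bar>"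
      unfolding r_def by (simp add: abs_mult_pos' field_simps abs_minus_commute del: of_nat_Suc)
    also have "\<dots> \<le> real (Suc n) * (K / real (Suc n))"
      by (intro mult_left_mono \<open>\<bar>L - r n\<bar> \<le> K / real (Suc n)\<close>) simp
    finally show ?thesis by simp
  qed
  moreover have "\<bar>u 0 - real 0 * L\<bar> \<le> K" using add[of 0 0] by simp
  ultimately have "\<bar>u n - real n * L\<bar> \<le> K" for n by (cases n) blast+
  then show ?thesis by blast
qed

lemma nonpos_if_multiples_bounded:
  fixes x K :: real
  assumes "\<And>n. real n * x \<le> K"
  shows "x \<le> 0"
  using reals_Archimedean3[of x] assms by (meson linorder_not_le)

text \<open>All that the concentration estimates know of the geometry. In the application
  \<open>split\<close> cuts an element along a geodesic, injectively because the element is the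
  product of its pieces; \<open>join\<close> concatenates after a correction, and up to
  \<open>C\<close> pairs may collide.\<close>

locale near_additive_spheres =
  fixes Sph :: "nat \<Rightarrow> 'a set" and f :: "'a \<Rightarrow> real" and C A :: real
  assumes C_ge_1: "C \<ge> 1"
    and finite_Sph: "finite (Sph n)" and Sph_nonempty: "Sph n \<noteq> {}"
    and split: "\<exists>\<psi>. inj_on \<psi> (Sph (n + m)) \<and> (\<forall>x\<in>Sph (n + m). fst (\<psi> x) \<in> Sph n \<and>
      snd (\<psi> x) \<in> Sph m \<and> \<bar>f x - f (fst (\<psi> x)) - f (snd (\<psi> x))\<bar> \<le> C)"
    and join: "\<exists>\<phi>. (\<forall>p\<in>Sph n \<times> Sph m. \<phi> p \<in> Sph (n + m) \<and> \<bar>f (\<phi> p) - f (fst p) - f (snd p)\<bar> \<le> C) \<and>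
      (\<forall>x\<in>Sph (n + m). real (card {p\<in>Sph n \<times> Sph m. \<phi> p = x}) \<le> C)"
    and f_bound: "x \<in> Sph n \<Longrightarrow> \<bar>f x\<bar> \<le> A * real n"
begin

text \<open>Arbitrary weights are allowed since it is applied to exponential sums, to cardinalities
  and to indicators of deviation sets.\<close>

lemma split_sum_le:
  fixes u :: "'a \<Rightarrow> real" and w :: "'a \<times> 'a \<Rightarrow> real"
  assumes w0: "\<And>p. w p \<ge> 0"
    and uw: "\<And>x g h. x \<in> Sph (n + m) \<Longrightarrow> g \<in> Sph n \<Longrightarrow> h \<in> Sph m \<Longrightarrow> \<bar>f x - f g - f h\<bar> \<le> C \<Longrightarrow> u x \<le> w (g, h)"
  shows "sum u (Sph (n + m)) \<le> sum w (Sph n \<times> Sph m)"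
proof -
  obtain \<psi> where inj: "inj_on \<psi> (Sph (n + m))"
    and \<psi>: "\<forall>x\<in>Sph (n + m). fst (\<psi> x) \<in> Sph n \<and> snd (\<psi> x) \<in> Sph m \<and> \<bar>f x - f (fst (\<psi> x)) - f (snd (\<psi> x))\<bar> \<le> C"
    using split[of n m] by blast
  have "sum u (Sph (n + m)) \<le> (\<Sum>x\<in>Sph (n + m). w (\<psi> x))"
  proof (rule sum_mono)
    fix x assume x: "x \<in> Sph (n + m)"
    then show "u x \<le> w (\<psi> x)" using uw[of x "fst (\<psi> x)" "snd (\<psi> x)"] \<psi> by simp
  qed
  also have "\<dots> = sum w (\<psi> ` Sph (n + m))" using inj by (simp add: sum.reindex)
  also have "\<dots> \<le> sum w (Sph n \<times> Sph m)"
  proof (rule sum_mono2)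
    show "\<psi> ` Sph (n + m) \<subseteq> Sph n \<times> Sph m"
      using \<psi> by (intro image_subsetI) (simp add: mem_Times_iff)
  qed (use w0 in \<open>auto simp: finite_Sph\<close>)
  finally show ?thesis .
qed

lemma join_sum_le:
  fixes u :: "'a \<Rightarrow> real" and w :: "'a \<times> 'a \<Rightarrow> real"
  assumes u0: "\<And>x. u x \<ge> 0"
    and wu: "\<And>x g h. x \<in> Sph (n + m) \<Longrightarrow> g \<in> Sph n \<Longrightarrow> h \<in> Sph m \<Longrightarrow> \<bar>f x - f g - f h\<bar> \<le> C \<Longrightarrow> w (g, h) \<le> u x"
  shows "sum w (Sph n \<times> Sph m) \<le> C * sum u (Sph (n + m))"
proof -
  obtain \<phi> where \<phi>: "\<forall>p\<in>Sph n \<times> Sph m. \<phi> p \<in> Sph (n + m) \<and> \<bar>f (\<phi> p) - f (fst p) - f (snd p)\<bar> \<le> C"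
    and fib: "\<forall>x\<in>Sph (n + m). real (card {p\<in>Sph n \<times> Sph m. \<phi> p = x}) \<le> C"
    using join[of n m] by blast
  have "sum w (Sph n \<times> Sph m) \<le> (\<Sum>p\<in>Sph n \<times> Sph m. u (\<phi> p))"
  proof (rule sum_mono)
    fix p assume p: "p \<in> Sph n \<times> Sph m"
    then show "w p \<le> u (\<phi> p)" using wu[of "\<phi> p" "fst p" "snd p"] \<phi> by auto
  qed
  also have "\<dots> = (\<Sum>x\<in>Sph (n + m). \<Sum>p\<in>{p\<in>Sph n \<times> Sph m. \<phi> p = x}. u (\<phi> p))"
    using \<phi> by (intro sum.group[symmetric]) (auto simp: finite_Sph)
  also have "\<dots> = (\<Sum>x\<in>Sph (n + m). real (card {p\<in>Sph n \<times> Sph m. \<phi> p = x}) * u x)"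
  proof (rule sum.cong[OF refl])
    fix x
    have "(\<Sum>p\<in>{p\<in>Sph n \<times> Sph m. \<phi> p = x}. u (\<phi> p)) = (\<Sum>p\<in>{p\<in>Sph n \<times> Sph m. \<phi> p = x}. u x)"
      by (rule sum.cong) auto
    then show "(\<Sum>p\<in>{p\<in>Sph n \<times> Sph m. \<phi> p = x}. u (\<phi> p)) = real (card {p\<in>Sph n \<times> Sph m. \<phi> p = x}) * u x"
      by simp
  qed
  also have "\<dots> \<le> (\<Sum>x\<in>Sph (n + m). C * u x)"
    using fib u0 by (intro sum_mono mult_right_mono) auto
  finally show ?thesis by (simp add: sum_distrib_left)
qed

section \<open>Exponential sums over spheres and their pressure\<close>

definition N :: "nat \<Rightarrow> real" where "N n = real (card (Sph n))"

lemma N_pos: "N n > 0"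
  unfolding N_def using finite_Sph Sph_nonempty by (simp add: card_gt_0_iff)

text \<open>The partition function of \<open>f\<close> on the sphere; \<open>P\<close> below is its
  pressure, the exponential growth rate.\<close>

definition U :: "real \<Rightarrow> nat \<Rightarrow> real" where "U s n = (\<Sum>x\<in>Sph n. exp (s * f x))"

lemma U_0: "U 0 n = N n" by (simp add: U_def N_def)

lemma U_pos: "U s n > 0"
  unfolding U_def using finite_Sph Sph_nonempty by (intro sum_pos) auto

lemma U_mult: "U s n * U s m = (\<Sum>p\<in>Sph n \<times> Sph m. exp (s * f (fst p) + s * f (snd p)))"
  unfolding U_def sum_product sum.cartesian_product by (simp add: exp_add case_prod_unfold)

lemma U_add_le:
  assumes "\<bar>s\<bar> \<le> 1"
  shows "U s (n + m) \<le> exp C * (U s n * U s m)"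
  unfolding U_mult sum_distrib_left unfolding U_def
proof (rule split_sum_le)
  fix x g h assume "\<bar>f x - f g - f h\<bar> \<le> C"
  then have "\<bar>s * (f x - f g - f h)\<bar> \<le> 1 * C"
    unfolding abs_mult using assms by (intro mult_mono) auto
  then have "s * (f x - f g - f h) \<le> C" by linarith
  then show "exp (s * f x) \<le> exp C * exp (s * f (fst (g, h)) + s * f (snd (g, h)))"
    by (simp flip: exp_add add: algebra_simps)
qed simp

lemma U_mult_le:
  assumes "\<bar>s\<bar> \<le> 1"
  shows "U s n * U s m \<le> C * exp C * U s (n + m)"
proof -
  have "U s n * U s m \<le> C * (\<Sum>x\<in>Sph (n + m). exp C * exp (s * f x))"
    unfolding U_mult
  proof (rule join_sum_le)
    fix x g h assume "\<bar>f x - f g - f h\<bar> \<le> C"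
    then have "\<bar>s * (f x - f g - f h)\<bar> \<le> 1 * C"
      unfolding abs_mult using assms by (intro mult_mono) auto
    then have "- C \<le> s * (f x - f g - f h)" by linarith
    then show "exp (s * f (fst (g, h)) + s * f (snd (g, h))) \<le> exp C * exp (s * f x)"
      by (simp flip: exp_add add: algebra_simps)
  qed simp
  then show ?thesis by (simp add: U_def sum_distrib_left mult_ac)
qed

text \<open>The loss of one concatenation on the logarithmic scale: \<open>C\<close> from the error
  of \<open>f\<close>, as long as \<open>|s| \<le> 1\<close>, and \<open>ln C\<close> from the
  multiplicity of \<open>join\<close>.\<close>

definition K :: real where "K = C + ln C"

lemma K_nonneg: "K \<ge> 0" unfolding K_def using C_ge_1 by simp

lemma ln_U_nearly_additive:
  assumes "\<bar>s\<bar> \<le> 1"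
  shows "\<bar>ln (U s (n + m)) - ln (U s n) - ln (U s m)\<bar> \<le> K"
proof -
  have "ln (U s (n + m)) \<le> ln (exp C * (U s n * U s m))"
    using U_add_le[OF assms] U_pos by (simp add: mult_pos_pos)
  also have "\<dots> = C + ln (U s n) + ln (U s m)"
    using U_pos[of s n] U_pos[of s m] by (simp add: ln_mult)
  finally have 1: "ln (U s (n + m)) \<le> C + ln (U s n) + ln (U s m)" .
  have "ln (U s n * U s m) \<le> ln (C * exp C * U s (n + m))"
    using U_mult_le[OF assms] U_pos C_ge_1 by (simp add: mult_pos_pos)
  then have 2: "ln (U s n) + ln (U s m) \<le> ln C + C + ln (U s (n + m))"
    using U_pos[of s n] U_pos[of s m] U_pos[of s "n + m"] C_ge_1 by (simp add: ln_mult)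
  have "ln C \<ge> 0" using C_ge_1 by simp
  then show ?thesis using 1 2 unfolding K_def by linarith
qed

definition P :: "real \<Rightarrow> real" where "P s = (SOME L. \<forall>n. \<bar>ln (U s n) - real n * L\<bar> \<le> K)"

lemma P:
  assumes "\<bar>s\<bar> \<le> 1"
  shows "\<bar>ln (U s n) - real n * P s\<bar> \<le> K"
proof -
  have "\<exists>L. \<forall>n. \<bar>ln (U s n) - real n * L\<bar> \<le> K"
    by (rule nearly_additive_linear) (rule ln_U_nearly_additive[OF assms])
  from someI_ex[OF this] show ?thesis unfolding P_def by blast
qed

text \<open>There is no polynomial factor, so normalising sphere sums by
  \<open>exp (P 0) ^ n\<close> costs only a constant.\<close>

lemma N_growth: "N n \<le> exp K * exp (P 0) ^ n" "exp (P 0) ^ n \<le> exp K * N n"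
proof -
  have *: "\<bar>ln (N n) - real n * P 0\<bar> \<le> K" using P[of 0 n] by (simp add: U_0)
  have "N n = exp (ln (N n))" using N_pos by simp
  also have "\<dots> \<le> exp (K + real n * P 0)" using * by (subst exp_le_cancel_iff) linarith
  finally show "N n \<le> exp K * exp (P 0) ^ n" by (simp add: exp_add exp_of_nat_mult)
  have "exp (P 0) ^ n = exp (real n * P 0)" by (simp add: exp_of_nat_mult)
  also have "\<dots> \<le> exp (K + ln (N n))" using * by (subst exp_le_cancel_iff) linarith
  finally show "exp (P 0) ^ n \<le> exp K * N n" using N_pos by (simp add: exp_add)
qed

definition \<Lambda> :: "real \<Rightarrow> real" where "\<Lambda> s = P s - P 0"

text \<open>The error \<open>2 * K\<close> comes from the two pressures \<open>P s\<close> and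
  \<open>P 0\<close>. It is independent of \<open>s\<close>, so the bounds stay informative when
  \<open>s\<close> is of order \<open>1 / n\<close>.\<close>

lemma U_bounds:
  assumes "\<bar>s\<bar> \<le> 1"
  shows "U s n \<le> N n * exp (real n * \<Lambda> s + 2 * K)" "N n * exp (real n * \<Lambda> s - 2 * K) \<le> U s n"
proof -
  have *: "\<bar>ln (N n) - real n * P 0\<bar> \<le> K" "\<bar>ln (U s n) - real n * P s\<bar> \<le> K"
    using P[of 0 n] P[OF assms, of n] by (simp_all add: U_0)
  have "U s n = exp (ln (U s n))" using U_pos by simp
  also have "\<dots> \<le> exp (ln (N n) + (real n * \<Lambda> s + 2 * K))"
    unfolding \<Lambda>_def using * by (subst exp_le_cancel_iff) (simp add: algebra_simps)
  finally show "U s n \<le> N n * exp (real n * \<Lambda> s + 2 * K)" using N_pos by (simp add: exp_add)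
  have "N n * exp (real n * \<Lambda> s - 2 * K) = exp (ln (N n) + (real n * \<Lambda> s - 2 * K))"
    using N_pos by (simp add: exp_add)
  also have "\<dots> \<le> exp (ln (U s n))"
    unfolding \<Lambda>_def using * by (subst exp_le_cancel_iff) (simp add: algebra_simps)
  finally show "N n * exp (real n * \<Lambda> s - 2 * K) \<le> U s n" using U_pos by simp
qed

lemma \<Lambda>_lower:
  assumes "0 < s" "s \<le> 1"
  shows "- A \<le> \<Lambda> s / s"
proof -
  have "real n * (- (A * s) - \<Lambda> s) \<le> 2 * K" for n
  proof -
    have "N n * exp (- (s * (A * real n))) = (\<Sum>x\<in>Sph n. exp (- (s * (A * real n))))"
      by (simp add: N_def)
    also have "\<dots> \<le> U s n" unfolding U_def
    proof (rule sum_mono)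
      fix x assume "x \<in> Sph n"
      then have "- (A * real n) \<le> f x" using f_bound[of x n] by linarith
      then have "s * - (A * real n) \<le> s * f x" using assms by (intro mult_left_mono) auto
      then show "exp (- (s * (A * real n))) \<le> exp (s * f x)" by simp
    qed
    also have "\<dots> \<le> N n * exp (real n * \<Lambda> s + 2 * K)" using U_bounds assms by simp
    finally have "exp (- (s * (A * real n))) \<le> exp (real n * \<Lambda> s + 2 * K)" using N_pos by simp
    then show ?thesis by (simp add: algebra_simps)
  qed
  then have "- (A * s) - \<Lambda> s \<le> 0" by (rule nonpos_if_multiples_bounded)
  then show ?thesis using assms by (simp add: field_simps)
qed

section \<open>Extreme drifts and concentration at a single drift\<close>

text \<open>The right derivative of \<open>\<Lambda>\<close> at 0: the slopes of a convex function
  vanishing at 0 decrease to it. As an infimum it exists by the lower bound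
  \<open>\<Lambda>_lower\<close>.\<close>

definition b :: real where "b = Inf ((\<lambda>s. \<Lambda> s / s) ` {0<..1})"

lemma b_le: "0 < s \<Longrightarrow> s \<le> 1 \<Longrightarrow> b * s \<le> \<Lambda> s"
proof -
  assume s: "0 < s" "s \<le> 1"
  have "b \<le> \<Lambda> s / s" unfolding b_def
    by (rule cInf_lower) (use s \<Lambda>_lower in \<open>auto intro!: bdd_belowI[of _ "- A"]\<close>)
  then show ?thesis using s by (simp add: field_simps)
qed

text \<open>Chernoff bound with a fixed \<open>s\<close> whose slope is within
  \<open>\<epsilon> / 2\<close> of the infimum \<open>b\<close>; the remaining
  \<open>\<epsilon> / 2\<close> beats the constant \<open>2 * K\<close> for large
  \<open>n\<close>.\<close>

lemma upper_tail:
  assumes "\<epsilon> > 0" "\<eta> > 0"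
  shows "\<exists>n0. \<forall>n\<ge>n0. real (card {x\<in>Sph n. f x \<ge> (b + \<epsilon>) * real n}) \<le> \<eta> * N n"
proof -
  have "\<exists>s\<in>{0<..1}. \<Lambda> s / s < b + \<epsilon> / 2"
  proof -
    have "Inf ((\<lambda>s. \<Lambda> s / s) ` {0<..1}) < b + \<epsilon> / 2" using assms by (simp add: b_def)
    moreover have "(\<lambda>s. \<Lambda> s / s) ` {0<..1} \<noteq> {}" by (auto simp: ex_in_conv intro: exI[of _ 1])
    ultimately have "\<exists>y\<in>(\<lambda>s. \<Lambda> s / s) ` {0<..1}. y < b + \<epsilon> / 2" by (intro cInf_lessD)
    then show ?thesis by simp
  qed
  then obtain s where s: "0 < s" "s \<le> 1" "\<Lambda> s < (b + \<epsilon> / 2) * s" by (auto simp: field_simps)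
  obtain n0 where n0: "(2 * K - ln \<eta>) / (s * \<epsilon> / 2) < real n0" using reals_Archimedean2 by blast
  have "real (card {x\<in>Sph n. f x \<ge> (b + \<epsilon>) * real n}) \<le> \<eta> * N n" if n: "n \<ge> n0" for n
  proof -
    let ?T = "{x\<in>Sph n. f x \<ge> (b + \<epsilon>) * real n}"
    have "real (card ?T) * exp (s * ((b + \<epsilon>) * real n)) = (\<Sum>x\<in>?T. exp (s * ((b + \<epsilon>) * real n)))"
      by simp
    also have "\<dots> \<le> (\<Sum>x\<in>?T. exp (s * f x))"
      using s by (intro sum_mono) (auto intro!: mult_left_mono)
    also have "\<dots> \<le> U s n" unfolding U_def by (intro sum_mono2) (auto simp: finite_Sph)
    also have "\<dots> \<le> N n * exp (real n * \<Lambda> s + 2 * K)" using U_bounds s by simp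
    finally have "real (card ?T) \<le> N n * exp (real n * \<Lambda> s + 2 * K) / exp (s * ((b + \<epsilon>) * real n))"
      by (simp add: field_simps)
    also have "\<dots> = N n * exp (real n * \<Lambda> s + 2 * K - s * ((b + \<epsilon>) * real n))"
      by (simp add: exp_diff)
    also have "\<dots> \<le> N n * exp (ln \<eta>)"
    proof (intro mult_left_mono)
      have "(2 * K - ln \<eta>) / (s * \<epsilon> / 2) < real n" using n0 n by (meson less_le_trans of_nat_le_iff)
      then have "2 * K - ln \<eta> < real n * (s * \<epsilon> / 2)"
        using s assms by (simp add: pos_divide_less_eq)
      moreover have "real n * \<Lambda> s \<le> real n * ((b + \<epsilon> / 2) * s)"
        using s by (intro mult_left_mono) auto
      moreover have "real n * ((b + \<epsilon> / 2) * s) - s * ((b + \<epsilon>) * real n) = - (real n * (s * \<epsilon> / 2))"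
        by (simp add: algebra_simps)
      ultimately show "exp (real n * \<Lambda> s + 2 * K - s * ((b + \<epsilon>) * real n)) \<le> exp (ln \<eta>)"
        by (subst exp_le_cancel_iff) linarith
    qed (use N_pos less_imp_le in blast)
    finally show ?thesis using assms by (simp add: mult.commute)
  qed
  then show ?thesis by blast
qed

text \<open>At \<open>s = \<sigma> / n\<close> the sum \<open>U s n\<close> is at least
  \<open>N n * exp (\<sigma> * b - 2 * K)\<close>. Elements slower than
  \<open>b - \<epsilon>\<close> contribute at most a quarter of this, and so do elements faster than
  \<open>b + 1 / \<sigma>\<close>; half of it must come from the remaining ones, each of weight at
  most \<open>exp (\<sigma> * b + 1)\<close>.\<close>

lemma end_mass:
  assumes "\<epsilon> > 0"
  shows "\<exists>n0. \<forall>n\<ge>n0. real (card {x\<in>Sph n. f x > (b - \<epsilon>) * real n}) \<ge> exp (- 2 * K - 1) / 2 * N n"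
proof -
  \<comment> \<open>Makes \<open>\<sigma> * \<epsilon> = 2 * K + 2\<close>, so the slow elements
    lose the factor \<open>exp (- 2) \<le> 1 / 4\<close> against the lower bound.\<close>
  define \<sigma> where "\<sigma> = (2 * K + 2) / \<epsilon>"
  have \<sigma>: "\<sigma> > 0" using assms K_nonneg by (simp add: \<sigma>_def)
  \<comment> \<open>So small that even with the largest possible weight
    \<open>exp (\<sigma> * A)\<close> the fast elements contribute only a quarter.\<close>
  define \<eta> where "\<eta> = exp (\<sigma> * b - 2 * K - \<sigma> * A) / 4"
  obtain n0 where n0: "\<forall>n\<ge>n0. real (card {x\<in>Sph n. f x \<ge> (b + 1 / \<sigma>) * real n}) \<le> \<eta> * N n"
    using upper_tail[of "1 / \<sigma>" \<eta>] \<sigma> by (auto simp: \<eta>_def)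
  obtain n1 where n1: "\<sigma> < real n1" using reals_Archimedean2 by blast
  have "real (card {x\<in>Sph n. f x > (b - \<epsilon>) * real n}) \<ge> exp (- 2 * K - 1) / 2 * N n"
    if n: "n \<ge> max n0 n1" for n
  proof -
    define s where "s = \<sigma> / real n"
    have npos: "real n > 0" and \<sigma>n: "\<sigma> \<le> real n" using n1 n \<sigma> by auto
    have s: "0 < s" "s \<le> 1" using \<sigma> \<sigma>n npos by (auto simp: s_def)
    have sn: "s * (c * real n) = \<sigma> * c" for c using npos by (simp add: s_def)
    let ?L = "{x\<in>Sph n. f x \<le> (b - \<epsilon>) * real n}"
    let ?M = "{x\<in>Sph n. f x > (b - \<epsilon>) * real n \<and> f x < (b + 1 / \<sigma>) * real n}"
    let ?H = "{x\<in>Sph n. f x \<ge> (b + 1 / \<sigma>) * real n}"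
    have part: "(\<Sum>x\<in>T. exp (s * f x)) \<le> real (card T) * exp (\<sigma> * c)"
      if "\<And>x. x \<in> T \<Longrightarrow> f x \<le> c * real n" for T c
    proof -
      have "(\<Sum>x\<in>T. exp (s * f x)) \<le> (\<Sum>x\<in>T. exp (\<sigma> * c))"
      proof (rule sum_mono)
        fix x assume "x \<in> T"
        then have "s * f x \<le> s * (c * real n)" using that s by (intro mult_left_mono) auto
        then show "exp (s * f x) \<le> exp (\<sigma> * c)" by (simp add: sn)
      qed
      then show ?thesis by simp
    qed
    have "exp (\<sigma> * b - 2 * K) \<le> exp (real n * \<Lambda> s - 2 * K)"
    proof -
      have "real n * (b * s) \<le> real n * \<Lambda> s" using b_le[OF s] by (intro mult_left_mono) auto
      moreover have "real n * (b * s) = \<sigma> * b" using sn[of b] by (simp add: mult_ac)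
      ultimately show ?thesis by simp
    qed
    then have "N n * exp (\<sigma> * b - 2 * K) \<le> N n * exp (real n * \<Lambda> s - 2 * K)"
      using N_pos[of n] by (intro mult_left_mono) auto
    also have "\<dots> \<le> U s n" using U_bounds(2)[of s n] s by simp
    also have "U s n \<le> (\<Sum>x\<in>?L. exp (s * f x)) + (\<Sum>x\<in>?M. exp (s * f x)) + (\<Sum>x\<in>?H. exp (s * f x))"
    proof -
      have "U s n = (\<Sum>x\<in>?L \<union> ?M \<union> ?H. exp (s * f x))"
        unfolding U_def by (rule sum.cong) auto
      also have "\<dots> \<le> (\<Sum>x\<in>?L \<union> ?M. exp (s * f x)) + (\<Sum>x\<in>?H. exp (s * f x))"
        by (simp add: sum_Un finite_Sph sum_nonneg)
      also have "(\<Sum>x\<in>?L \<union> ?M. exp (s * f x)) \<le> (\<Sum>x\<in>?L. exp (s * f x)) + (\<Sum>x\<in>?M. exp (s * f x))"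
        by (simp add: sum_Un finite_Sph sum_nonneg)
      finally show ?thesis by simp
    qed
    also have "(\<Sum>x\<in>?L. exp (s * f x)) \<le> N n * exp (\<sigma> * b - 2 * K) / 4"
    proof -
      have "(\<Sum>x\<in>?L. exp (s * f x)) \<le> real (card ?L) * exp (\<sigma> * (b - \<epsilon>))" by (rule part) auto
      also have "\<dots> \<le> N n * exp (\<sigma> * (b - \<epsilon>))"
        unfolding N_def by (intro mult_right_mono) (auto intro!: card_mono finite_Sph)
      also have "\<sigma> * (b - \<epsilon>) = (\<sigma> * b - 2 * K) + - 2" using assms by (simp add: \<sigma>_def field_simps)
      also have "exp ((\<sigma> * b - 2 * K) + - 2) \<le> exp (\<sigma> * b - 2 * K) * (1 / 4)"
      proof -
        have "(2::real) * 2 \<le> exp 1 * exp 1" using exp_ge_add_one_self[of 1] by (intro mult_mono) auto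
        then have "exp (- 2 :: real) \<le> 1 / 4" by (simp add: exp_minus field_simps flip: exp_add)
        then show ?thesis unfolding exp_add by (intro mult_left_mono) auto
      qed
      finally show ?thesis using N_pos[of n] by (simp add: mult_left_mono)
    qed
    also have "(\<Sum>x\<in>?H. exp (s * f x)) \<le> N n * exp (\<sigma> * b - 2 * K) / 4"
    proof -
      have "(\<Sum>x\<in>?H. exp (s * f x)) \<le> real (card ?H) * exp (\<sigma> * A)"
        by (rule part) (use f_bound in \<open>auto simp: abs_le_iff\<close>)
      also have "\<dots> \<le> \<eta> * N n * exp (\<sigma> * A)" using n0 n by (intro mult_right_mono) auto
      also have "\<dots> = N n * exp (\<sigma> * b - 2 * K) / 4" by (simp add: \<eta>_def exp_diff)
      finally show ?thesis .
    qed
    also have "(\<Sum>x\<in>?M. exp (s * f x)) \<le> real (card ?M) * exp (\<sigma> * b + 1)"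
      using part[of ?M "b + 1 / \<sigma>"] \<sigma> by (simp add: distrib_left)
    finally have "N n * exp (\<sigma> * b - 2 * K) / 2 \<le> real (card ?M) * exp (\<sigma> * b + 1)" by simp
    then have "N n * (exp (\<sigma> * b - 2 * K) / exp (\<sigma> * b + 1)) / 2 \<le> real (card ?M)"
      by (simp add: field_simps)
    also have "exp (\<sigma> * b - 2 * K) / exp (\<sigma> * b + 1) = exp (- 2 * K - 1)"
      by (simp flip: exp_diff)
    also have "real (card ?M) \<le> real (card {x\<in>Sph n. f x > (b - \<epsilon>) * real n})"
      by (intro of_nat_mono card_mono) (auto simp: finite_Sph)
    finally show ?thesis by (simp add: mult.commute)
  qed
  then show ?thesis by blast
qed

lemma N_add_le: "N (n + m) \<le> N n * N m"
  using split_sum_le[of "\<lambda>_. 1" n m "\<lambda>_. 1"] by (simp add: N_def card_cartesian_product)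

text \<open>The axioms do not see the sign of \<open>f\<close>. The drift of the negated instance is
  minus the left derivative of \<open>\<Lambda>\<close> at 0, and each upper estimate for it yields
  a lower one for \<open>f\<close>.\<close>

lemma near_additive_uminus: "near_additive_spheres Sph (\<lambda>x. - f x) C A"
proof
  have *: "\<bar>- a - - b - - c\<bar> = \<bar>a - b - c\<bar>" for a b c :: real by linarith
  fix n m
  show "\<exists>\<psi>. inj_on \<psi> (Sph (n + m)) \<and> (\<forall>x\<in>Sph (n + m). fst (\<psi> x) \<in> Sph n \<and>
      snd (\<psi> x) \<in> Sph m \<and> \<bar>- f x - - f (fst (\<psi> x)) - - f (snd (\<psi> x))\<bar> \<le> C)"
    unfolding * by (rule split)
  show "\<exists>\<phi>. (\<forall>p\<in>Sph n \<times> Sph m. \<phi> p \<in> Sph (n + m) \<and> \<bar>- f (\<phi> p) - - f (fst p) - - f (snd p)\<bar> \<le> C) \<and>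
      (\<forall>x\<in>Sph (n + m). real (card {p\<in>Sph n \<times> Sph m. \<phi> p = x}) \<le> C)"
    unfolding * by (rule join)
qed (use C_ge_1 finite_Sph Sph_nonempty f_bound in auto)

text \<open>Half of the mass in \<open>end_mass\<close>; the other half is given away to the
  elements above the band.\<close>

definition c0 :: real where "c0 = exp (- 2 * K - 1) / 4"

lemma c0_pos: "c0 > 0" by (simp add: c0_def)

lemma band_mass:
  assumes "\<epsilon> > 0"
  shows "\<exists>n0. \<forall>n\<ge>n0. real (card {x\<in>Sph n. \<bar>f x - b * real n\<bar> \<le> \<epsilon> * real n}) \<ge> c0 * N n"
proof -
  obtain n0 where n0: "\<forall>n\<ge>n0. real (card {x\<in>Sph n. f x > (b - \<epsilon>) * real n}) \<ge> exp (- 2 * K - 1) / 2 * N n"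
    using end_mass[OF assms] by blast
  obtain n1 where n1: "\<forall>n\<ge>n1. real (card {x\<in>Sph n. f x \<ge> (b + \<epsilon>) * real n}) \<le> c0 * N n"
    using upper_tail[OF assms c0_pos] by blast
  have "real (card {x\<in>Sph n. \<bar>f x - b * real n\<bar> \<le> \<epsilon> * real n}) \<ge> c0 * N n" if "n \<ge> max n0 n1" for n
  proof -
    have "card {x\<in>Sph n. f x > (b - \<epsilon>) * real n}
        \<le> card ({x\<in>Sph n. \<bar>f x - b * real n\<bar> \<le> \<epsilon> * real n} \<union> {x\<in>Sph n. f x \<ge> (b + \<epsilon>) * real n})"
      by (intro card_mono) (auto simp: finite_Sph algebra_simps)
    also have "\<dots> \<le> card {x\<in>Sph n. \<bar>f x - b * real n\<bar> \<le> \<epsilon> * real n} + card {x\<in>Sph n. f x \<ge> (b + \<epsilon>) * real n}"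
      by (rule card_Un_le)
    finally have "real (card {x\<in>Sph n. f x > (b - \<epsilon>) * real n})
        \<le> real (card {x\<in>Sph n. \<bar>f x - b * real n\<bar> \<le> \<epsilon> * real n}) + real (card {x\<in>Sph n. f x \<ge> (b + \<epsilon>) * real n})"
      by linarith
    moreover have "exp (- 2 * K - 1) / 2 * N n = c0 * N n + c0 * N n" by (simp add: c0_def)
    moreover have "exp (- 2 * K - 1) / 2 * N n \<le> real (card {x\<in>Sph n. f x > (b - \<epsilon>) * real n})"
      using n0 that by simp
    moreover have "real (card {x\<in>Sph n. f x \<ge> (b + \<epsilon>) * real n}) \<le> c0 * N n" using n1 that by simp
    ultimately show ?thesis by linarith
  qed
  then show ?thesis by blast
qed

interpretation neg: near_additive_spheres Sph "\<lambda>x. - f x" C A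
  by (rule near_additive_uminus)

text \<open>If the two extreme drifts differed, concatenating blocks of either kind in all proportions
  would produce more than \<open>C / c0\<^sup>2\<close> disjoint sets, each of mass at least \<open>c0\<^sup>2 / C\<close>.\<close>

lemma extreme_drifts_le: "b \<le> - neg.b"
proof (rule ccontr)
  define a where "a = - neg.b"
  assume "\<not> b \<le> - neg.b"
  then have ab: "a < b" by (simp add: a_def)
  obtain M where M: "C / c0\<^sup>2 + 1 < real M" using reals_Archimedean2 by blast
  have "C / c0\<^sup>2 \<ge> 0" using C_ge_1 by simp
  with M have M1: "real M > 1" by linarith
  \<comment> \<open>With this tolerance the half-width \<open>w\<close> of the target sets is a
    quarter of the spacing \<open>(b - a) * k\<close> of their centres.\<close>
  define \<epsilon> where "\<epsilon> = (b - a) / (8 * real M)"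
  have \<epsilon>: "\<epsilon> > 0" using ab M1 by (simp add: \<epsilon>_def)
  obtain n0 where n0: "\<forall>n\<ge>n0. real (card {x\<in>Sph n. \<bar>f x - b * real n\<bar> \<le> \<epsilon> * real n}) \<ge> c0 * N n"
    using band_mass[OF \<epsilon>] by blast
  obtain n1 where n1: "\<forall>n\<ge>n1. real (card {x\<in>Sph n. \<bar>- f x - neg.b * real n\<bar> \<le> \<epsilon> * real n}) \<ge> neg.c0 * neg.N n"
    using neg.band_mass[OF \<epsilon>] by blast
  have *: "\<bar>- f x - neg.b * real n\<bar> = \<bar>f x - a * real n\<bar>" for x n
    unfolding a_def by (simp add: abs_minus_commute)
  have n1': "\<forall>n\<ge>n1. real (card {x\<in>Sph n. \<bar>f x - a * real n\<bar> \<le> \<epsilon> * real n}) \<ge> c0 * N n"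
    using n1 unfolding * .
  obtain n2 where n2: "C / (\<epsilon> * real M) < real n2" using reals_Archimedean2 by blast
  define k where "k = max 1 (max n2 (max n0 n1))"
  have k: "k \<ge> 1" "k \<ge> n0" "k \<ge> n1" "k \<ge> n2" by (auto simp: k_def)
  define n where "n = M * k"
  define w where "w = 2 * \<epsilon> * real n"
  have Cn: "C \<le> \<epsilon> * real n"
  proof -
    have "C / (\<epsilon> * real M) < real k" using n2 k(4) by (meson less_le_trans of_nat_le_iff)
    then have "C < real k * (\<epsilon> * real M)" using \<epsilon> M1 by (simp add: pos_divide_less_eq)
    then show ?thesis by (simp add: n_def mult_ac)
  qed
  have wk: "w = (b - a) * real k / 4" using M1 by (simp add: w_def \<epsilon>_def n_def)
  \<comment> \<open>Value of \<open>f\<close> expected after joining a piece of length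
    \<open>(M - j) * k\<close> with drift \<open>a\<close> and one of length \<open>j * k\<close>
    with drift \<open>b\<close>. The pieces deviate by \<open>\<epsilon> * n\<close> together, and
    \<open>k\<close> is so large that joining costs at most as much again; hence
    \<open>w\<close>.\<close>
  define t where "t j = a * (real (M - j) * real k) + b * (real j * real k)" for j
  define T where "T j = {x\<in>Sph n. \<bar>f x - t j\<bar> \<le> w}" for j
  have mass: "c0\<^sup>2 * N n \<le> C * real (card (T j))" if j: "j \<in> {1..<M}" for j
  proof -
    have nj: "(M - j) * k + j * k = n" using j by (simp add: n_def flip: add_mult_distrib)
    have ge: "(M - j) * k \<ge> n1" "j * k \<ge> n0"
    proof -
      have "1 * k \<le> (M - j) * k" "1 * k \<le> j * k"
        using j mult_le_mono1[of 1 "M - j" k] mult_le_mono1[of 1 j k] by auto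
      then show "(M - j) * k \<ge> n1" "j * k \<ge> n0" using k by linarith+
    qed
    define GA where "GA = {x\<in>Sph ((M - j) * k). \<bar>f x - a * real ((M - j) * k)\<bar> \<le> \<epsilon> * real ((M - j) * k)}"
    define GB where "GB = {x\<in>Sph (j * k). \<bar>f x - b * real (j * k)\<bar> \<le> \<epsilon> * real (j * k)}"
    have "c0\<^sup>2 * N n \<le> c0\<^sup>2 * (N ((M - j) * k) * N (j * k))"
      using N_add_le[of "(M - j) * k" "j * k"] by (intro mult_left_mono) (auto simp: nj)
    also have "\<dots> = (c0 * N ((M - j) * k)) * (c0 * N (j * k))" by (simp add: power2_eq_square)
    also have "\<dots> \<le> real (card GA) * real (card GB)"
      using n1' n0 ge c0_pos N_pos unfolding GA_def GB_def
      by (intro mult_mono) (auto simp: less_imp_le)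
    also have "\<dots> = (\<Sum>p\<in>Sph ((M - j) * k) \<times> Sph (j * k). if fst p \<in> GA \<and> snd p \<in> GB then 1 else 0)"
    proof -
      have "(\<Sum>p\<in>Sph ((M - j) * k) \<times> Sph (j * k). if fst p \<in> GA \<and> snd p \<in> GB then 1 else (0::real))
          = real (card {p\<in>Sph ((M - j) * k) \<times> Sph (j * k). fst p \<in> GA \<and> snd p \<in> GB})"
        by (simp add: finite_Sph flip: sum.inter_filter)
      also have "{p\<in>Sph ((M - j) * k) \<times> Sph (j * k). fst p \<in> GA \<and> snd p \<in> GB} = GA \<times> GB"
        by (auto simp: GA_def GB_def)
      finally show ?thesis by (simp add: card_cartesian_product)
    qed
    also have "\<dots> \<le> C * (\<Sum>x\<in>Sph ((M - j) * k + j * k). if x \<in> T j then 1 else 0)"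
    proof (rule join_sum_le)
      fix x g h assume x: "x \<in> Sph ((M - j) * k + j * k)" and gh: "\<bar>f x - f g - f h\<bar> \<le> C"
      have "x \<in> T j" if "g \<in> GA" "h \<in> GB"
      proof -
        have "\<bar>f g - a * real ((M - j) * k)\<bar> \<le> \<epsilon> * real ((M - j) * k)"
          "\<bar>f h - b * real (j * k)\<bar> \<le> \<epsilon> * real (j * k)"
          using that by (auto simp: GA_def GB_def)
        moreover have "\<epsilon> * real ((M - j) * k) + \<epsilon> * real (j * k) = \<epsilon> * real n"
          unfolding nj[symmetric] by (simp add: distrib_left)
        moreover have "t j = a * real ((M - j) * k) + b * real (j * k)" by (simp add: t_def)
        moreover have "w = \<epsilon> * real n + \<epsilon> * real n" by (simp add: w_def)
        ultimately have "\<bar>f x - t j\<bar> \<le> w" using gh Cn by linarith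
        then show ?thesis using x by (simp add: T_def nj)
      qed
      then show "(if fst (g, h) \<in> GA \<and> snd (g, h) \<in> GB then 1 else 0) \<le> (if x \<in> T j then 1 else (0::real))"
        by simp
    qed auto
    also have "(\<Sum>x\<in>Sph ((M - j) * k + j * k). if x \<in> T j then 1 else 0) = real (card (T j))"
    proof -
      have "(\<Sum>x\<in>Sph n. if x \<in> T j then 1 else (0::real)) = real (card {x\<in>Sph n. x \<in> T j})"
        by (simp add: finite_Sph flip: sum.inter_filter)
      also have "{x\<in>Sph n. x \<in> T j} = T j" by (auto simp: T_def)
      finally show ?thesis unfolding nj .
    qed
    finally show ?thesis .
  qed
  have disj: "T i \<inter> T j = {}" if "i \<in> {1..<M}" "j \<in> {1..<M}" "i < j" for i j
  proof -
    have "t j - t i = (b - a) * real k * (real j - real i)"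
      using that by (simp add: t_def of_nat_diff algebra_simps)
    also have "\<dots> \<ge> (b - a) * real k * 1" using ab that by (intro mult_left_mono) auto
    finally have "t j - t i \<ge> 4 * w" by (simp add: wk)
    moreover have "w > 0" using ab k by (simp add: wk)
    ultimately show ?thesis by (auto simp: T_def)
  qed
  have "real (card {1..<M}) * (c0\<^sup>2 * N n) \<le> (\<Sum>j\<in>{1..<M}. C * real (card (T j)))"
    using sum_mono[of "{1..<M}" "\<lambda>_. c0\<^sup>2 * N n"] mass by simp
  also have "\<dots> = C * real (card (\<Union>j\<in>{1..<M}. T j))"
  proof -
    have "card (\<Union>j\<in>{1..<M}. T j) = (\<Sum>j\<in>{1..<M}. card (T j))"
    proof (rule card_UN_disjoint)
      show "\<forall>i\<in>{1..<M}. \<forall>j\<in>{1..<M}. i \<noteq> j \<longrightarrow> T i \<inter> T j = {}"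
        using disj by (metis inf_commute linorder_neqE_nat)
    qed (auto simp: T_def finite_Sph)
    then show ?thesis by (simp add: sum_distrib_left)
  qed
  also have "\<dots> \<le> C * N n"
    using C_ge_1 unfolding N_def by (intro mult_left_mono of_nat_mono card_mono) (auto simp: T_def finite_Sph)
  finally have "(real M - 1) * c0\<^sup>2 * N n \<le> C * N n" using M1 by (simp add: of_nat_diff)
  then have "(real M - 1) * c0\<^sup>2 \<le> C" using N_pos by simp
  then have "real M - 1 \<le> C / c0\<^sup>2" using c0_pos by (simp add: field_simps)
  then show False using M by linarith
qed

text \<open>By \<open>extreme_drifts_le\<close> the tail bound for \<open>- f\<close> can be read at
  the speed \<open>b\<close> too, so both one-sided bounds meet.\<close>

lemma concentration:
  assumes "\<epsilon> > 0" "\<eta> > 0"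
  shows "\<exists>n0. \<forall>n\<ge>n0. real (card {x\<in>Sph n. \<bar>f x - b * real n\<bar> \<ge> \<epsilon> * real n}) \<le> \<eta> * N n"
proof -
  have \<eta>: "\<eta> / 2 > 0" using assms by simp
  obtain n0 where n0: "\<forall>n\<ge>n0. real (card {x\<in>Sph n. f x \<ge> (b + \<epsilon>) * real n}) \<le> \<eta> / 2 * N n"
    using upper_tail[OF assms(1) \<eta>] by blast
  obtain n1 where n1: "\<forall>n\<ge>n1. real (card {x\<in>Sph n. - f x \<ge> (neg.b + \<epsilon>) * real n}) \<le> \<eta> / 2 * N n"
    using neg.upper_tail[OF assms(1) \<eta>] by blast
  have "real (card {x\<in>Sph n. \<bar>f x - b * real n\<bar> \<ge> \<epsilon> * real n}) \<le> \<eta> * N n" if n: "n \<ge> max n0 n1" for n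
  proof -
    have "{x\<in>Sph n. \<bar>f x - b * real n\<bar> \<ge> \<epsilon> * real n}
        \<subseteq> {x\<in>Sph n. f x \<ge> (b + \<epsilon>) * real n} \<union> {x\<in>Sph n. - f x \<ge> (neg.b + \<epsilon>) * real n}"
    proof
      fix x assume x: "x \<in> {x\<in>Sph n. \<bar>f x - b * real n\<bar> \<ge> \<epsilon> * real n}"
      have "b * real n \<le> - neg.b * real n" using extreme_drifts_le by (intro mult_right_mono) auto
      then show "x \<in> {x\<in>Sph n. f x \<ge> (b + \<epsilon>) * real n} \<union> {x\<in>Sph n. - f x \<ge> (neg.b + \<epsilon>) * real n}"
        using x by (auto simp: distrib_right)
    qed
    then have "card {x\<in>Sph n. \<bar>f x - b * real n\<bar> \<ge> \<epsilon> * real n}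
        \<le> card ({x\<in>Sph n. f x \<ge> (b + \<epsilon>) * real n} \<union> {x\<in>Sph n. - f x \<ge> (neg.b + \<epsilon>) * real n})"
      by (intro card_mono) (auto simp: finite_Sph)
    also have "\<dots> \<le> card {x\<in>Sph n. f x \<ge> (b + \<epsilon>) * real n} + card {x\<in>Sph n. - f x \<ge> (neg.b + \<epsilon>) * real n}"
      by (rule card_Un_le)
    finally have "real (card {x\<in>Sph n. \<bar>f x - b * real n\<bar> \<ge> \<epsilon> * real n})
        \<le> real (card {x\<in>Sph n. f x \<ge> (b + \<epsilon>) * real n}) + real (card {x\<in>Sph n. - f x \<ge> (neg.b + \<epsilon>) * real n})"
      by linarith
    also have "\<dots> \<le> \<eta> / 2 * N n + \<eta> / 2 * N n" using n0 n1 n by (intro add_mono) auto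
    finally show ?thesis by simp
  qed
  then show ?thesis by blast
qed

text \<open>Off a set of small proportion the deviation is at most \<open>e * n\<close>, and on that
  set it is still at most \<open>D * n\<close>; each part takes half of
  \<open>\<epsilon>\<close>.\<close>

lemma variance_small:
  assumes "\<epsilon> > 0"
  shows "\<exists>n0. \<forall>n\<ge>n0. (\<Sum>x\<in>Sph n. (f x - b * real n)\<^sup>2) \<le> \<epsilon> * (real n)\<^sup>2 * N n"
proof -
  define e where "e = sqrt (\<epsilon> / 2)"
  have e: "e > 0" "e\<^sup>2 = \<epsilon> / 2" using assms by (auto simp: e_def)
  define D where "D = \<bar>A\<bar> + \<bar>b\<bar> + 1"
  have D: "D > 0" by (simp add: D_def)
  define \<eta> where "\<eta> = \<epsilon> / 2 / D\<^sup>2"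
  have \<eta>: "\<eta> > 0" using assms D by (simp add: \<eta>_def)
  obtain n0 where n0: "\<forall>n\<ge>n0. real (card {x\<in>Sph n. \<bar>f x - b * real n\<bar> \<ge> e * real n}) \<le> \<eta> * N n"
    using concentration[OF e(1) \<eta>] by blast
  have "(\<Sum>x\<in>Sph n. (f x - b * real n)\<^sup>2) \<le> \<epsilon> * (real n)\<^sup>2 * N n" if n: "n \<ge> n0" for n
  proof -
    let ?T = "{x\<in>Sph n. \<bar>f x - b * real n\<bar> \<ge> e * real n}"
    have "(\<Sum>x\<in>Sph n. (f x - b * real n)\<^sup>2)
        \<le> (\<Sum>x\<in>Sph n. (e * real n)\<^sup>2 + (if \<bar>f x - b * real n\<bar> \<ge> e * real n then (D * real n)\<^sup>2 else 0))"
    proof (rule sum_mono)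
      fix x assume x: "x \<in> Sph n"
      show "(f x - b * real n)\<^sup>2 \<le> (e * real n)\<^sup>2 + (if \<bar>f x - b * real n\<bar> \<ge> e * real n then (D * real n)\<^sup>2 else 0)"
      proof (cases "\<bar>f x - b * real n\<bar> \<ge> e * real n")
        case True
        have "\<bar>f x - b * real n\<bar> \<le> \<bar>f x\<bar> + \<bar>b\<bar> * real n" using abs_triangle_ineq4[of "f x" "b * real n"] by (simp add: abs_mult)
        also have "\<dots> \<le> \<bar>A\<bar> * real n + \<bar>b\<bar> * real n"
          using f_bound[OF x] mult_right_mono[of A "\<bar>A\<bar>" "real n"] by linarith
        also have "\<dots> \<le> D * real n" by (simp add: D_def distrib_right)
        finally have "\<bar>f x - b * real n\<bar>\<^sup>2 \<le> (D * real n)\<^sup>2" by (intro power_mono) auto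
        then show ?thesis using True by (simp add: add_increasing)
      next
        case False
        then have "\<bar>f x - b * real n\<bar>\<^sup>2 \<le> (e * real n)\<^sup>2" by (intro power_mono) auto
        then show ?thesis using False by simp
      qed
    qed
    also have "\<dots> = N n * (e * real n)\<^sup>2 + real (card ?T) * (D * real n)\<^sup>2"
      by (simp add: sum.distrib N_def finite_Sph flip: sum.inter_filter)
    also have "\<dots> \<le> N n * (e * real n)\<^sup>2 + \<eta> * N n * (D * real n)\<^sup>2"
      using n0 n by (intro add_left_mono mult_right_mono) auto
    also have "\<dots> = \<epsilon> * (real n)\<^sup>2 * N n"
      using D by (simp add: power_mult_distrib e(2) \<eta>_def field_simps)
    finally show ?thesis .
  qed
  then show ?thesis by blast
qed

end

section \<open>Square root fluctuations from finite-state recursion\<close>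

text \<open>A finite-state description of the spheres: every element of radius \<open>n + 1\<close>
  has exactly one parent, and the admissible letters, the next state and the change of
  \<open>f\<close> depend only on the state of the parent. Integrality of \<open>f\<close> serves
  algebraicity; \<open>f_lower\<close> makes the drift positive.\<close>

locale automatic_spheres = near_additive_spheres Sph f C A
  for Sph :: "nat \<Rightarrow> 'a set" and f :: "'a \<Rightarrow> real" and C A +
  fixes \<Theta> :: "'a \<Rightarrow> 'q" and Q :: "'q set" and out :: "'q \<Rightarrow> 's set" and step :: "'q \<Rightarrow> 's \<Rightarrow> 'q"
    and inc :: "'q \<Rightarrow> 's \<Rightarrow> int" and child :: "'a \<Rightarrow> 's \<Rightarrow> 'a" and c :: real
  assumes finite_Q: "finite Q" and \<Theta>_Q: "x \<in> Sph n \<Longrightarrow> \<Theta> x \<in> Q" and finite_out: "finite (out q)"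
    and child_bij: "bij_betw (\<lambda>(g, s). child g s) (SIGMA g:Sph n. out (\<Theta> g)) (Sph (Suc n))"
    and \<Theta>_child: "g \<in> Sph n \<Longrightarrow> s \<in> out (\<Theta> g) \<Longrightarrow> \<Theta> (child g s) = step (\<Theta> g) s"
    and f_child: "g \<in> Sph n \<Longrightarrow> s \<in> out (\<Theta> g) \<Longrightarrow> f (child g s) = f g + of_int (inc (\<Theta> g) s)"
    and f_int: "x \<in> Sph n \<Longrightarrow> f x \<in> \<int>"
    and c_pos: "c > 0" and f_lower: "x \<in> Sph n \<Longrightarrow> c * real n \<le> f x"
begin

text \<open>By the binomial theorem the power sums of degree at most two, taken separately over each
  state, are transformed linearly by one step, so \<open>linear_system_recurrence\<close> applies
  with index set \<open>Q \<times> {..2}\<close>. Letting \<open>u\<close> depend on the radius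
  admits the centred \<open>f x - b * real n\<close>; leaving the field open admits the
  rationals.\<close>

lemma moments_recurrence:
  fixes u :: "nat \<Rightarrow> 'a \<Rightarrow> 'k::field"
  assumes u: "\<And>n g s. g \<in> Sph n \<Longrightarrow> s \<in> out (\<Theta> g) \<Longrightarrow> u (Suc n) (child g s) = u n g + w (\<Theta> g) s"
  shows "\<exists>c d. (\<exists>k\<le>d. c k \<noteq> 0) \<and>
    (\<forall>e\<le>2. \<forall>n. (\<Sum>k\<le>d. c k * (\<Sum>x\<in>Sph (n + k). u (n + k) x ^ e)) = 0)"
proof -
  define v where "v n = (\<lambda>(q, e). \<Sum>x\<in>{x\<in>Sph n. \<Theta> x = q}. u n x ^ e)" for n
  \<comment> \<open>Transition matrix: over all letters leading from \<open>q\<close> to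
    \<open>q'\<close>, the coefficients of the \<open>i\<close>-th power in the binomial expansion
    of degree \<open>e\<close> are added up.\<close>
  define B where "B q' e q i = (\<Sum>s\<in>out q. if step q s = q' then of_nat (e choose i) * w q s ^ (e - i) else 0)"
    for q' and e i :: nat and q
  define M where "M = (\<lambda>(q', e) (q, i). B q' e q i)"
  have step_v: "v (Suc n) p = (\<Sum>p'\<in>Q \<times> {..2}. M p p' * v n p')" if p: "p \<in> Q \<times> {..2}" for n p
  proof -
    obtain q' e where p': "p = (q', e)" "e \<le> 2" using p by auto
    have "v (Suc n) p = (\<Sum>x\<in>Sph (Suc n). if \<Theta> x = q' then u (Suc n) x ^ e else 0)"
      by (simp add: v_def p' finite_Sph flip: sum.inter_filter)
    also have "\<dots> = (\<Sum>(g, s)\<in>(SIGMA g:Sph n. out (\<Theta> g)). if \<Theta> (child g s) = q' then u (Suc n) (child g s) ^ e else 0)"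
      unfolding case_prod_unfold
      by (rule sum.reindex_bij_betw[OF child_bij[unfolded case_prod_unfold], symmetric])
    also have "\<dots> = (\<Sum>g\<in>Sph n. \<Sum>s\<in>out (\<Theta> g). if \<Theta> (child g s) = q' then u (Suc n) (child g s) ^ e else 0)"
      by (subst sum.Sigma) (auto simp: finite_Sph finite_out)
    also have "\<dots> = (\<Sum>g\<in>Sph n. \<Sum>i\<le>2. B q' e (\<Theta> g) i * u n g ^ i)"
    proof (rule sum.cong[OF refl])
      fix g assume g: "g \<in> Sph n"
      have "(\<Sum>s\<in>out (\<Theta> g). if \<Theta> (child g s) = q' then u (Suc n) (child g s) ^ e else 0)
          = (\<Sum>s\<in>out (\<Theta> g). \<Sum>i\<le>2. (if step (\<Theta> g) s = q' then of_nat (e choose i) * w (\<Theta> g) s ^ (e - i) else 0) * u n g ^ i)"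
      proof (rule sum.cong[OF refl])
        fix s assume s: "s \<in> out (\<Theta> g)"
        have "(u n g + w (\<Theta> g) s) ^ e = (\<Sum>i\<le>e. of_nat (e choose i) * u n g ^ i * w (\<Theta> g) s ^ (e - i))"
          by (rule binomial_ring)
        also have "\<dots> = (\<Sum>i\<le>2. of_nat (e choose i) * u n g ^ i * w (\<Theta> g) s ^ (e - i))"
          using p' by (intro sum.mono_neutral_left) (auto simp: binomial_eq_0)
        finally show "(if \<Theta> (child g s) = q' then u (Suc n) (child g s) ^ e else 0)
            = (\<Sum>i\<le>2. (if step (\<Theta> g) s = q' then of_nat (e choose i) * w (\<Theta> g) s ^ (e - i) else 0) * u n g ^ i)"
          by (simp add: \<Theta>_child[OF g s] u[OF g s] mult_ac)
      qed
      also have "\<dots> = (\<Sum>i\<le>2. \<Sum>s\<in>out (\<Theta> g). (if step (\<Theta> g) s = q' then of_nat (e choose i) * w (\<Theta> g) s ^ (e - i) else 0) * u n g ^ i)"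
        by (rule sum.swap)
      also have "\<dots> = (\<Sum>i\<le>2. B q' e (\<Theta> g) i * u n g ^ i)"
        unfolding B_def sum_distrib_right ..
      finally show "(\<Sum>s\<in>out (\<Theta> g). if \<Theta> (child g s) = q' then u (Suc n) (child g s) ^ e else 0)
          = (\<Sum>i\<le>2. B q' e (\<Theta> g) i * u n g ^ i)" .
    qed
    also have "\<dots> = (\<Sum>q\<in>Q. \<Sum>g\<in>{g\<in>Sph n. \<Theta> g = q}. \<Sum>i\<le>2. B q' e (\<Theta> g) i * u n g ^ i)"
      by (rule sum.group[symmetric]) (auto simp: finite_Sph finite_Q \<Theta>_Q)
    also have "\<dots> = (\<Sum>q\<in>Q. \<Sum>i\<le>2. B q' e q i * v n (q, i))"
    proof (rule sum.cong[OF refl])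
      fix q
      have "(\<Sum>g\<in>{g\<in>Sph n. \<Theta> g = q}. \<Sum>i\<le>2. B q' e (\<Theta> g) i * u n g ^ i)
          = (\<Sum>i\<le>2. \<Sum>g\<in>{g\<in>Sph n. \<Theta> g = q}. B q' e (\<Theta> g) i * u n g ^ i)"
        by (rule sum.swap)
      also have "\<dots> = (\<Sum>i\<le>2. B q' e q i * v n (q, i))"
        unfolding v_def sum_distrib_left prod.case by (intro sum.cong refl) auto
      finally show "(\<Sum>g\<in>{g\<in>Sph n. \<Theta> g = q}. \<Sum>i\<le>2. B q' e (\<Theta> g) i * u n g ^ i)
          = (\<Sum>i\<le>2. B q' e q i * v n (q, i))" .
    qed
    also have "\<dots> = (\<Sum>p'\<in>Q \<times> {..2}. M p p' * v n p')"
      unfolding M_def p' prod.case by (simp add: sum.cartesian_product case_prod_unfold)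
    finally show ?thesis .
  qed
  have "\<exists>c d. (\<exists>k\<le>d. c k \<noteq> 0) \<and> (\<forall>n. \<forall>p\<in>Q \<times> {..2}. (\<Sum>k\<le>d. c k * v (n + k) p) = 0)"
    by (rule linear_system_recurrence[where A = M]) (use finite_Q in simp, rule step_v)
  then obtain c d where c0: "(\<exists>k\<le>d. c k \<noteq> 0) \<and> (\<forall>n. \<forall>p\<in>Q \<times> {..2}. (\<Sum>k\<le>d. c k * v (n + k) p) = 0)"
    by (elim exE)
  note c = conjunct1[OF c0] conjunct2[OF c0]
  have "(\<Sum>k\<le>d. c k * (\<Sum>x\<in>Sph (n + k). u (n + k) x ^ e)) = 0" if e: "e \<le> 2" for e n
  proof -
    have tot: "(\<Sum>x\<in>Sph m. u m x ^ e) = (\<Sum>q\<in>Q. v m (q, e))" for m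
      unfolding v_def prod.case
      by (rule sum.group[symmetric]) (auto simp: finite_Sph finite_Q \<Theta>_Q)
    have "(\<Sum>k\<le>d. c k * (\<Sum>x\<in>Sph (n + k). u (n + k) x ^ e)) = (\<Sum>q\<in>Q. \<Sum>k\<le>d. c k * v (n + k) (q, e))"
      unfolding tot sum_distrib_left by (rule sum.swap)
    also have "\<dots> = 0" using c(2) e by simp
    finally show ?thesis .
  qed
  then show ?thesis using c(1) by (intro exI[of _ c] exI[of _ d]) blast
qed

definition \<rho> :: real where "\<rho> = exp (P 0)"

lemma \<rho>_pos: "\<rho> > 0" by (simp add: \<rho>_def)

text \<open>Dividing by \<open>\<rho> ^ n\<close> turns the recurrence into one with coefficients
  \<open>c k * \<rho> ^ k\<close> and, by \<open>N_growth\<close>, the bound of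
  \<open>variance_small\<close> into \<open>o(n ^ 2)\<close>; this is the situation of
  \<open>recurrence_partial_sums_bound\<close>.\<close>

lemma variance_partial_sums:
  "\<exists>B n0. \<forall>n\<ge>n0. (\<Sum>k\<le>n. (\<Sum>x\<in>Sph k. (f x - b * real k)\<^sup>2) / \<rho> ^ k) \<le> B * (real n)\<^sup>2"
proof -
  define W where "W n = (\<Sum>x\<in>Sph n. (f x - b * real n)\<^sup>2)" for n
  have "\<exists>c d. (\<exists>k\<le>d. c k \<noteq> 0) \<and>
    (\<forall>e\<le>2. \<forall>n. (\<Sum>k\<le>d. c k * (\<Sum>x\<in>Sph (n + k). (f x - b * real (n + k)) ^ e)) = 0)"
    by (rule moments_recurrence[where u = "\<lambda>n x. f x - b * real n" and w = "\<lambda>q s. of_int (inc q s) - b"])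
      (simp add: f_child algebra_simps)
  then obtain c :: "nat \<Rightarrow> real" and d where c: "(\<exists>k\<le>d. c k \<noteq> 0) \<and>
    (\<forall>e\<le>2. \<forall>n. (\<Sum>k\<le>d. c k * (\<Sum>x\<in>Sph (n + k). (f x - b * real (n + k)) ^ e)) = 0)"
    by (elim exE)
  have rec: "(\<Sum>k\<le>d. c k * W (n + k)) = 0" for n
    unfolding W_def using conjunct2[OF c] by simp
  have "(\<Sum>k\<le>d. (c k * \<rho> ^ k) * (W (n + k) / \<rho> ^ (n + k))) = (\<Sum>k\<le>d. c k * W (n + k)) / \<rho> ^ n" for n
    unfolding sum_divide_distrib using \<rho>_pos by (intro sum.cong) (auto simp: power_add field_simps)
  then have rec': "(\<Sum>k\<le>d. (c k * \<rho> ^ k) * (W (n + k) / \<rho> ^ (n + k))) = 0" for n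
    by (simp add: rec)
  have "\<exists>B n0. \<forall>n\<ge>n0. (\<Sum>k\<le>n. W k / \<rho> ^ k) \<le> B * (real n)\<^sup>2"
  proof (rule recurrence_partial_sums_bound[OF rec'])
    show "\<exists>k\<le>d. c k * \<rho> ^ k \<noteq> 0" using conjunct1[OF c] \<rho>_pos by auto
    show "W n / \<rho> ^ n \<ge> 0" for n using \<rho>_pos by (auto simp: W_def intro!: divide_nonneg_nonneg sum_nonneg)
    fix \<epsilon> :: real assume \<epsilon>: "\<epsilon> > 0"
    then have "\<epsilon> / exp K > 0" by simp
    from variance_small[OF this] obtain n0 where n0: "\<forall>n\<ge>n0. W n \<le> \<epsilon> / exp K * (real n)\<^sup>2 * N n"
      unfolding W_def by blast
    have "W n / \<rho> ^ n \<le> \<epsilon> * (real n)\<^sup>2" if n: "n \<ge> n0" for n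
    proof -
      have "W n \<le> \<epsilon> / exp K * (real n)\<^sup>2 * N n" using n0 n by blast
      also have "\<dots> \<le> \<epsilon> / exp K * (real n)\<^sup>2 * (exp K * \<rho> ^ n)"
        unfolding \<rho>_def using N_growth(1)[of n] \<epsilon> by (intro mult_left_mono) auto
      finally show ?thesis using \<rho>_pos by (simp add: field_simps)
    qed
    then show "\<exists>n0. \<forall>n\<ge>n0. W n / \<rho> ^ n \<le> \<epsilon> * (real n)\<^sup>2" by blast
  qed
  then show ?thesis unfolding W_def .
qed

text \<open>Partial sums control the normalised variance only on average over radii. Averaging over
  the pairs \<open>a\<close>, \<open>n - a\<close> yields a cut where both pieces have normalised
  variance of order \<open>n\<close>; Chebyshev's inequality on each piece and
  \<open>split_sum_le\<close> transfer the bound to radius \<open>n\<close> itself.\<close>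

lemma square_root_concentration:
  assumes \<epsilon>: "\<epsilon> > 0"
  shows "\<exists>K' n0. \<forall>n\<ge>n0. real (card {x\<in>Sph n. \<bar>f x - b * real n\<bar> > K' * sqrt (real n)}) \<le> \<epsilon> * N n"
proof -
  define W where "W n = (\<Sum>x\<in>Sph n. (f x - b * real n)\<^sup>2)" for n
  define v where "v n = W n / \<rho> ^ n" for n
  have v0: "v n \<ge> 0" for n
    using \<rho>_pos by (auto simp: v_def W_def intro!: divide_nonneg_nonneg sum_nonneg)
  obtain B n0 where B: "\<forall>n\<ge>n0. (\<Sum>k\<le>n. v k) \<le> B * (real n)\<^sup>2"
    using variance_partial_sums unfolding v_def W_def by blast
  \<comment> \<open>Chebyshev's inequality with \<open>z ^ 2 = D * n / \<epsilon>\<close> has to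
    absorb the variance bound \<open>2 * |B| * n\<close> and two factors \<open>exp K\<close> from
    sphere growth; the summand 1 ensures positivity.\<close>
  define D where "D = 2 * \<bar>B\<bar> * exp K * exp K + 1"
  have D: "D > 0" by (simp add: D_def add_nonneg_pos)
  define y where "y = sqrt (D / \<epsilon>)"
  have y: "y > 0" "y\<^sup>2 = D / \<epsilon>" using D \<epsilon> by (auto simp: y_def)
  \<comment> \<open>One \<open>y\<close> for each piece and \<open>C\<close> for the additivity
    error, which \<open>sqrt (real n) \<ge> 1\<close> absorbs.\<close>
  define K' where "K' = 2 * y + C"
  have "real (card {x\<in>Sph n. \<bar>f x - b * real n\<bar> > K' * sqrt (real n)}) \<le> \<epsilon> * N n" if n: "n \<ge> max n0 1" for n
  proof -
    define z where "z = y * sqrt (real n)"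
    have n1: "real n \<ge> 1" using n by simp
    have z: "z > 0" "z\<^sup>2 = D / \<epsilon> * real n" using y n1 by (auto simp: z_def power_mult_distrib)
    have Kz: "K' * sqrt (real n) \<ge> 2 * z + C"
      using C_ge_1 n1 by (simp add: K'_def z_def distrib_right)
    \<comment> \<open>The \<open>n + 1\<close> sums add up to twice the partial sum, hence to at
      most \<open>2 * |B| * n ^ 2\<close>.\<close>
    have "\<exists>a\<le>n. v a + v (n - a) \<le> 2 * \<bar>B\<bar> * real n"
    proof (rule ccontr)
      assume "\<not> ?thesis"
      then have "2 * \<bar>B\<bar> * real n < v a + v (n - a)" if "a \<le> n" for a
        using that by (meson not_le)
      then have "(\<Sum>a\<le>n. 2 * \<bar>B\<bar> * real n) < (\<Sum>a\<le>n. v a + v (n - a))"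
        by (intro sum_strict_mono) auto
      then have "(real n + 1) * (2 * \<bar>B\<bar> * real n) < (\<Sum>a\<le>n. v a + v (n - a))"
        by (simp add: algebra_simps)
      also have "(\<Sum>a\<le>n. v a + v (n - a)) = 2 * (\<Sum>a\<le>n. v a)"
        using sum.atLeastAtMost_rev[of v 0 n] by (simp add: sum.distrib atMost_atLeast0)
      also have "\<dots> \<le> 2 * (\<bar>B\<bar> * (real n)\<^sup>2)"
      proof -
        have "(\<Sum>a\<le>n. v a) \<le> B * (real n)\<^sup>2" using B n by simp
        also have "\<dots> \<le> \<bar>B\<bar> * (real n)\<^sup>2" by (intro mult_right_mono) auto
        finally show ?thesis by simp
      qed
      also have "\<dots> \<le> (real n + 1) * (2 * \<bar>B\<bar> * real n)"
        by (simp add: algebra_simps power2_eq_square)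
      finally show False by simp
    qed
    then obtain a where a: "a \<le> n" "v a + v (n - a) \<le> 2 * \<bar>B\<bar> * real n" by blast
    define m where "m = n - a"
    have nam: "n = a + m" using a by (simp add: m_def)
    have cheb: "(\<Sum>x\<in>Sph k. if \<bar>f x - b * real k\<bar> > z then 1 else 0) \<le> v k * \<rho> ^ k / z\<^sup>2" for k
    proof -
      have "(\<Sum>x\<in>Sph k. if \<bar>f x - b * real k\<bar> > z then 1 else 0) \<le> (\<Sum>x\<in>Sph k. (f x - b * real k)\<^sup>2 / z\<^sup>2)"
      proof (rule sum_mono)
        fix x
        have "1 \<le> (f x - b * real k)\<^sup>2 / z\<^sup>2" if "\<bar>f x - b * real k\<bar> > z"
        proof -
          have "z\<^sup>2 \<le> \<bar>f x - b * real k\<bar>\<^sup>2" using that z by (intro power_mono) auto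
          then show ?thesis using z(1) by simp
        qed
        then show "(if \<bar>f x - b * real k\<bar> > z then 1 else 0) \<le> (f x - b * real k)\<^sup>2 / z\<^sup>2" by simp
      qed
      also have "\<dots> = W k / z\<^sup>2" by (simp add: W_def sum_divide_distrib)
      also have "\<dots> = v k * \<rho> ^ k / z\<^sup>2" using \<rho>_pos by (simp add: v_def)
      finally show ?thesis .
    qed
    have "real (card {x\<in>Sph n. \<bar>f x - b * real n\<bar> > K' * sqrt (real n)})
        = (\<Sum>x\<in>Sph (a + m). if \<bar>f x - b * real n\<bar> > K' * sqrt (real n) then 1 else 0)"
      by (simp add: nam finite_Sph flip: sum.inter_filter)
    also have "\<dots> \<le> (\<Sum>p\<in>Sph a \<times> Sph m. (if \<bar>f (fst p) - b * real a\<bar> > z then 1 else 0)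
        + (if \<bar>f (snd p) - b * real m\<bar> > z then 1 else 0))"
    proof (rule split_sum_le)
      fix x g h assume *: "\<bar>f x - f g - f h\<bar> \<le> C"
      have "b * real n = b * real a + b * real m" by (simp add: nam distrib_left)
      then have "\<bar>f g - b * real a\<bar> > z \<or> \<bar>f h - b * real m\<bar> > z" if "\<bar>f x - b * real n\<bar> > K' * sqrt (real n)"
        using that Kz * by linarith
      then show "(if \<bar>f x - b * real n\<bar> > K' * sqrt (real n) then 1 else 0)
          \<le> (if \<bar>f (fst (g, h)) - b * real a\<bar> > z then 1 else 0) + (if \<bar>f (snd (g, h)) - b * real m\<bar> > z then 1 else (0::real))"
        by auto
    qed auto
    also have "\<dots> = N m * (\<Sum>x\<in>Sph a. if \<bar>f x - b * real a\<bar> > z then 1 else 0)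
        + N a * (\<Sum>x\<in>Sph m. if \<bar>f x - b * real m\<bar> > z then 1 else 0)"
    proof -
      have "(\<Sum>p\<in>Sph a \<times> Sph m. F (fst p)) = N m * (\<Sum>x\<in>Sph a. F x)" for F :: "'a \<Rightarrow> real"
        using sum.cartesian_product[of "\<lambda>x _. F x" "Sph m" "Sph a"]
        by (simp add: case_prod_unfold N_def sum_distrib_left)
      moreover have "(\<Sum>p\<in>Sph a \<times> Sph m. F (snd p)) = N a * (\<Sum>x\<in>Sph m. F x)" for F :: "'a \<Rightarrow> real"
        using sum.cartesian_product[of "\<lambda>_ y. F y" "Sph m" "Sph a"]
        by (simp add: case_prod_unfold N_def)
      ultimately show ?thesis unfolding sum.distrib by (intro arg_cong2[where f = "(+)"])
    qed
    also have "\<dots> \<le> N m * (v a * \<rho> ^ a / z\<^sup>2) + N a * (v m * \<rho> ^ m / z\<^sup>2)"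
      using N_pos by (intro add_mono mult_left_mono cheb) (auto simp: less_imp_le)
    also have "\<dots> \<le> (exp K * \<rho> ^ m) * (v a * \<rho> ^ a / z\<^sup>2) + (exp K * \<rho> ^ a) * (v m * \<rho> ^ m / z\<^sup>2)"
      unfolding \<rho>_def by (intro add_mono mult_right_mono N_growth) (auto intro!: v0 mult_nonneg_nonneg divide_nonneg_nonneg)
    also have "\<dots> = exp K * \<rho> ^ n * (v a + v m) / z\<^sup>2"
      by (simp add: nam power_add add_divide_distrib algebra_simps)
    also have "\<dots> \<le> exp K * (exp K * N n) * (2 * \<bar>B\<bar> * real n) / z\<^sup>2"
      unfolding \<rho>_def using a v0
      by (intro divide_right_mono mult_mono N_growth) (auto simp: m_def N_pos less_imp_le intro!: mult_nonneg_nonneg)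
    also have "\<dots> \<le> (D * real n) * N n / z\<^sup>2"
      using N_pos[of n] n1 by (intro divide_right_mono) (auto simp: D_def algebra_simps)
    also have "\<dots> = \<epsilon> * N n" using D \<epsilon> n1 by (simp add: z(2) field_simps)
    finally show ?thesis .
  qed
  then show ?thesis by blast
qed

text \<open>Everywhere \<open>f \<ge> c * n\<close>, whereas by \<open>upper_tail\<close> at least
  half of a large sphere lies below \<open>(b + \<epsilon>) * n\<close>.\<close>

lemma drift_lower: "c \<le> b"
proof -
  have "real n * (c - (b + \<epsilon>)) \<le> 0" if \<epsilon>: "\<epsilon> > 0" and n: "\<forall>n\<ge>n0. real (card {x\<in>Sph n. f x \<ge> (b + \<epsilon>) * real n}) \<le> 1 / 2 * N n"
    and "n \<ge> n0" for n n0 \<epsilon>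
  proof -
    have "\<exists>x\<in>Sph n. f x < (b + \<epsilon>) * real n"
    proof (rule ccontr)
      assume "\<not> ?thesis"
      then have "{x\<in>Sph n. f x \<ge> (b + \<epsilon>) * real n} = Sph n" by force
      then have "N n \<le> 1 / 2 * N n" using n \<open>n \<ge> n0\<close> by (metis N_def)
      then show False using N_pos[of n] by simp
    qed
    then obtain x where x: "x \<in> Sph n" "f x < (b + \<epsilon>) * real n" by blast
    then show ?thesis using f_lower[OF x(1)] by (simp add: algebra_simps)
  qed
  note * = this
  have "c \<le> b + \<epsilon>" if \<epsilon>: "\<epsilon> > 0" for \<epsilon>
  proof -
    obtain n0 where n0: "\<forall>n\<ge>n0. real (card {x\<in>Sph n. f x \<ge> (b + \<epsilon>) * real n}) \<le> 1 / 2 * N n"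
      using upper_tail[OF \<epsilon>, of "1 / 2"] by auto
    have "real (Suc n0) * (c - (b + \<epsilon>)) \<le> 0" by (rule *[OF \<epsilon> n0]) simp
    then show ?thesis by (simp add: mult_le_0_iff del: of_nat_Suc)
  qed
  then show ?thesis by (rule field_le_epsilon)
qed

text \<open>Both power series have their singularity closest to the origin at \<open>1 / \<rho>\<close>, and \<open>b\<close> is the
  limit of their quotient there.\<close>

lemma algebraic_drift: "algebraic b"
proof -
  define V where "V n = (\<Sum>x\<in>Sph n. f x)" for n
  \<comment> \<open>The factor \<open>n\<close> makes \<open>V n\<close> comparable to
    \<open>b * Z n\<close>, so the quotient of the two series tends to \<open>b\<close>
    itself.\<close>
  define Z where "Z n = real n * N n" for n
  define \<alpha> where "\<alpha> = 1 / \<rho>"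
  have \<alpha>: "\<alpha> > 0" using \<rho>_pos by (simp add: \<alpha>_def)
  \<comment> \<open>Running the recurrence for first moments over the rationals gives numerator and
    denominator with rational coefficients.\<close>
  have rational: "\<exists>P Q. Q \<noteq> 0 \<and> (\<forall>x. summable (\<lambda>n. U n * x ^ n) \<longrightarrow> poly Q x * (\<Sum>n. U n * x ^ n) = poly P x)
      \<and> (\<forall>i. coeff P i \<in> \<rat>) \<and> (\<forall>i. coeff Q i \<in> \<rat>)"
    if U: "\<And>n. U n = of_rat (\<Sum>x\<in>Sph n. u n x)"
      and u: "\<And>n g s. g \<in> Sph n \<Longrightarrow> s \<in> out (\<Theta> g) \<Longrightarrow> u (Suc n) (child g s) = u n g + w (\<Theta> g) s"
    for U :: "nat \<Rightarrow> real" and u :: "nat \<Rightarrow> 'a \<Rightarrow> rat" and w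
  proof -
    obtain c d where c: "(\<exists>k\<le>d. c k \<noteq> 0) \<and> (\<forall>e\<le>2. \<forall>n. (\<Sum>k\<le>d. c k * (\<Sum>x\<in>Sph (n + k). u (n + k) x ^ e)) = 0)"
    proof -
      have "\<exists>c d. (\<exists>k\<le>d. c k \<noteq> 0) \<and> (\<forall>e\<le>2. \<forall>n. (\<Sum>k\<le>d. c k * (\<Sum>x\<in>Sph (n + k). u (n + k) x ^ e)) = 0)"
        by (rule moments_recurrence) (rule u)
      then show thesis by (elim exE) (rule that)
    qed
    have rec: "(\<Sum>k\<le>d. of_rat (c k) * U (n + k)) = 0" for n
    proof -
      have "(\<Sum>k\<le>d. of_rat (c k) * U (n + k)) = of_rat (\<Sum>k\<le>d. c k * (\<Sum>x\<in>Sph (n + k). u (n + k) x ^ 1))"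
        by (simp add: U of_rat_sum of_rat_mult)
      also have "\<dots> = 0" using conjunct2[OF c, rule_format, of 1 n] by simp
      finally show ?thesis .
    qed
    have nz: "\<exists>k\<le>d. (of_rat (c k) :: real) \<noteq> 0" using conjunct1[OF c] by simp
    have rats: "\<forall>k. (of_rat (c k) :: real) \<in> \<rat>" "\<forall>n. U n \<in> \<rat>" by (simp_all add: U)
    from recurrence_generating_function[OF rec nz] show ?thesis
      by (elim exE conjE, intro exI conjI) (use rats in auto)
  qed
  have "\<exists>r. f x = of_rat r" if "x \<in> Sph n" for x n
    using f_int[OF that] by (metis Ints_cases of_rat_of_int_eq)
  then obtain fr where fr: "\<And>x n. x \<in> Sph n \<Longrightarrow> f x = of_rat (fr x)" by metis
  have fr_child: "fr (child g s) = fr g + of_int (inc (\<Theta> g) s)" if "g \<in> Sph n" "s \<in> out (\<Theta> g)" for n g s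
  proof -
    have "child g s \<in> Sph (Suc n)"
      using child_bij[of n] that unfolding bij_betw_def by force
    then have "(of_rat (fr (child g s)) :: real) = of_rat (fr g + of_int (inc (\<Theta> g) s))"
      using f_child[OF that] fr fr[OF that(1)] by (simp add: of_rat_add)
    then show ?thesis by (simp only: of_rat_eq_iff)
  qed
  have "V n = of_rat (\<Sum>x\<in>Sph n. fr x)" for n
    unfolding V_def of_rat_sum by (rule sum.cong) (auto simp: fr)
  then have "\<exists>P Q. Q \<noteq> 0 \<and> (\<forall>x. summable (\<lambda>n. V n * x ^ n) \<longrightarrow> poly Q x * (\<Sum>n. V n * x ^ n) = poly P x)
      \<and> (\<forall>i. coeff P i \<in> \<rat>) \<and> (\<forall>i. coeff Q i \<in> \<rat>)"
    by (rule rational[where w = "\<lambda>q s. of_int (inc q s)"]) (rule fr_child)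
  then obtain PV QV where PQV: "QV \<noteq> 0 \<and> (\<forall>x. summable (\<lambda>n. V n * x ^ n) \<longrightarrow> poly QV x * (\<Sum>n. V n * x ^ n) = poly PV x)
      \<and> (\<forall>i. coeff PV i \<in> \<rat>) \<and> (\<forall>i. coeff QV i \<in> \<rat>)"
    by (elim exE)
  have "Z n = of_rat (\<Sum>x\<in>Sph n. of_nat n)" for n
    by (simp add: Z_def N_def of_rat_mult)
  then have "\<exists>P Q. Q \<noteq> 0 \<and> (\<forall>x. summable (\<lambda>n. Z n * x ^ n) \<longrightarrow> poly Q x * (\<Sum>n. Z n * x ^ n) = poly P x)
      \<and> (\<forall>i. coeff P i \<in> \<rat>) \<and> (\<forall>i. coeff Q i \<in> \<rat>)"
    by (rule rational[where w = "\<lambda>q s. 1"]) simp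
  then obtain PZ QZ where PQZ: "QZ \<noteq> 0 \<and> (\<forall>x. summable (\<lambda>n. Z n * x ^ n) \<longrightarrow> poly QZ x * (\<Sum>n. Z n * x ^ n) = poly PZ x)
      \<and> (\<forall>i. coeff PZ i \<in> \<rat>) \<and> (\<forall>i. coeff QZ i \<in> \<rat>)"
    by (elim exE)
  have Z0: "Z n \<ge> 0" for n using N_pos[of n] by (simp add: Z_def)
  have sumZ: "summable (\<lambda>n. Z n * x ^ n)" if x: "0 < x" "x < \<alpha>" for x
  proof -
    have y: "0 \<le> \<rho> * x" "\<rho> * x < 1" using x \<rho>_pos by (auto simp: \<alpha>_def field_simps)
    have "summable (\<lambda>n. real ((n + 2) * (n + 1)) * (\<rho> * x) ^ n)"
      by (rule summableI_nonneg_bounded[OF _ sum_rising_two_le[OF y]]) (use y in auto)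
    then have "summable (\<lambda>n. exp K * (real ((n + 2) * (n + 1)) * (\<rho> * x) ^ n))" by (rule summable_mult)
    then show ?thesis
    proof (rule summable_comparison_test')
      fix n
      have "Z n * x ^ n \<le> real ((n + 2) * (n + 1)) * (exp K * \<rho> ^ n) * x ^ n"
        unfolding Z_def \<rho>_def using x N_pos[of n] N_growth(1)[of n]
        by (intro mult_right_mono mult_mono) (auto simp: less_imp_le)
      then show "norm (Z n * x ^ n) \<le> exp K * (real ((n + 2) * (n + 1)) * (\<rho> * x) ^ n)"
        using Z0[of n] x by (simp add: power_mult_distrib mult_ac)
    qed
  qed
  define z where "z x = (\<Sum>n. Z n * x ^ n)" for x
  define s where "s x = (\<Sum>n. V n * x ^ n)" for x
  have dev: "\<exists>n0. \<forall>n\<ge>n0. \<bar>V n - b * Z n\<bar> \<le> \<epsilon> * Z n" if \<epsilon>: "\<epsilon> > 0" for \<epsilon>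
  proof -
    have "\<epsilon>\<^sup>2 > 0" using \<epsilon> by simp
    then obtain n0 where n0: "\<forall>n\<ge>n0. (\<Sum>x\<in>Sph n. (f x - b * real n)\<^sup>2) \<le> \<epsilon>\<^sup>2 * (real n)\<^sup>2 * N n"
      using variance_small by blast
    have "\<bar>V n - b * Z n\<bar> \<le> \<epsilon> * Z n" if n: "n \<ge> max n0 1" for n
    proof -
      have n1: "real n \<ge> 1" using n by simp
      \<comment> \<open>Minimises \<open>h / 4 + t ^ 2 / h\<close> at the deviation
        \<open>t = \<epsilon> * n\<close>: both terms then contribute
        \<open>\<epsilon> * n / 2\<close>.\<close>
      define h where "h = 2 * \<epsilon> * real n"
      have h: "h > 0" using \<epsilon> n1 by (simp add: h_def)
      have "V n - b * Z n = (\<Sum>x\<in>Sph n. f x - b * real n)"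
        by (simp add: V_def Z_def N_def sum_subtractf)
      also have "\<bar>\<dots>\<bar> \<le> (\<Sum>x\<in>Sph n. \<bar>f x - b * real n\<bar>)" by (rule sum_abs)
      also have "\<dots> \<le> (\<Sum>x\<in>Sph n. h / 4 + (f x - b * real n)\<^sup>2 / h)"
      proof (rule sum_mono)
        fix x
        define t where "t = \<bar>f x - b * real n\<bar>"
        have "0 \<le> (t - h / 2)\<^sup>2 / h" using h by simp
        also have "\<dots> = t\<^sup>2 / h + h / 4 - t" using h by (simp add: power2_eq_square field_simps)
        finally have "t \<le> h / 4 + t\<^sup>2 / h" by simp
        then show "\<bar>f x - b * real n\<bar> \<le> h / 4 + (f x - b * real n)\<^sup>2 / h" by (simp add: t_def)
      qed
      also have "\<dots> = h / 4 * N n + (\<Sum>x\<in>Sph n. (f x - b * real n)\<^sup>2) / h"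
        by (simp add: sum.distrib N_def sum_divide_distrib)
      also have "\<dots> \<le> h / 4 * N n + \<epsilon>\<^sup>2 * (real n)\<^sup>2 * N n / h"
        using n0 n h by (intro add_left_mono divide_right_mono) auto
      also have "\<dots> = \<epsilon> * Z n"
        using \<epsilon> n1 by (simp add: h_def Z_def field_simps power2_eq_square)
      finally show ?thesis .
    qed
    then show ?thesis by blast
  qed
  \<comment> \<open>The finitely many radii below \<open>n0\<close> contribute a constant that is
    uniform in \<open>x < \<alpha>\<close>; it becomes negligible as \<open>z x\<close>
    diverges.\<close>
  have bound: "\<exists>D\<ge>0. \<forall>x. 0 < x \<longrightarrow> x < \<alpha> \<longrightarrow> summable (\<lambda>n. V n * x ^ n) \<and> \<bar>s x - b * z x\<bar> \<le> \<epsilon> * z x + D"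
    if \<epsilon>: "\<epsilon> > 0" for \<epsilon>
  proof -
    obtain n0 where n0: "\<forall>n\<ge>n0. \<bar>V n - b * Z n\<bar> \<le> \<epsilon> * Z n" using dev[OF \<epsilon>] by blast
    define D where "D = (\<Sum>n<n0. \<bar>V n - b * Z n\<bar> * \<alpha> ^ n)"
    have D0: "D \<ge> 0" using \<alpha> unfolding D_def by (intro sum_nonneg) auto
    have "summable (\<lambda>n. V n * x ^ n) \<and> \<bar>s x - b * z x\<bar> \<le> \<epsilon> * z x + D" if x: "0 < x" "x < \<alpha>" for x
    proof -
      define e where "e n = (if n < n0 then \<bar>V n - b * Z n\<bar> * x ^ n else 0)" for n
      have e_sums: "e sums (\<Sum>n<n0. \<bar>V n - b * Z n\<bar> * x ^ n)"
        unfolding e_def using sums_If_finite[of "\<lambda>n. n < n0"] by (simp add: lessThan_def)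
      have le: "\<bar>(V n - b * Z n) * x ^ n\<bar> \<le> \<epsilon> * (Z n * x ^ n) + e n" for n
      proof (cases "n < n0")
        case False
        then show ?thesis using n0 x mult_right_mono[of "\<bar>V n - b * Z n\<bar>" "\<epsilon> * Z n" "x ^ n"]
          by (simp add: e_def abs_mult mult.assoc)
      qed (use \<epsilon> Z0 x in \<open>simp add: e_def abs_mult\<close>)
      have sum_r: "summable (\<lambda>n. \<epsilon> * (Z n * x ^ n) + e n)"
        by (intro summable_add summable_mult sumZ x sums_summable[OF e_sums])
      have sum_d: "summable (\<lambda>n. \<bar>(V n - b * Z n) * x ^ n\<bar>)"
        by (rule summable_comparison_test'[OF sum_r]) (use le in simp)
      have sum_d': "summable (\<lambda>n. (V n - b * Z n) * x ^ n)"
        by (rule summable_rabs_cancel[OF sum_d])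
      have bz: "summable (\<lambda>n. b * (Z n * x ^ n))" by (intro summable_mult sumZ x)
      have "summable (\<lambda>n. (V n - b * Z n) * x ^ n + b * (Z n * x ^ n))"
        by (intro summable_add sum_d' bz)
      then have sV: "summable (\<lambda>n. V n * x ^ n)" by (simp add: algebra_simps)
      have "s x - b * z x = (\<Sum>n. (V n - b * Z n) * x ^ n)"
      proof -
        have "b * z x = (\<Sum>n. b * (Z n * x ^ n))" unfolding z_def by (rule suminf_mult[OF sumZ[OF x], symmetric])
        then have "s x - b * z x = (\<Sum>n. V n * x ^ n - b * (Z n * x ^ n))"
          unfolding s_def using suminf_diff[OF sV bz] by simp
        then show ?thesis by (simp add: algebra_simps)
      qed
      also have "\<bar>\<dots>\<bar> \<le> (\<Sum>n. \<bar>(V n - b * Z n) * x ^ n\<bar>)" by (rule summable_rabs[OF sum_d])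
      also have "\<dots> \<le> (\<Sum>n. \<epsilon> * (Z n * x ^ n) + e n)" by (rule suminf_le[OF le sum_d sum_r])
      also have "\<dots> = \<epsilon> * z x + (\<Sum>n<n0. \<bar>V n - b * Z n\<bar> * x ^ n)"
        using suminf_add[OF summable_mult[OF sumZ[OF x], of \<epsilon>] sums_summable[OF e_sums]]
          suminf_mult[OF sumZ[OF x], of \<epsilon>] sums_unique[OF e_sums] by (simp add: z_def)
      also have "(\<Sum>n<n0. \<bar>V n - b * Z n\<bar> * x ^ n) \<le> D"
        unfolding D_def using x by (intro sum_mono mult_left_mono power_mono) auto
      finally show ?thesis using sV by simp
    qed
    then show ?thesis using D0 by blast
  qed
  have inside: "\<forall>\<^sub>F x in at_left \<alpha>. 0 < x \<and> x < \<alpha>"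
    using eventually_at_left_field[of "\<lambda>x. 0 < x \<and> x < \<alpha>" \<alpha>] \<alpha> by blast
  \<comment> \<open>A single term bounds the series from below, and
    \<open>Z m * \<alpha> ^ m \<ge> m / exp K\<close> is unbounded in \<open>m\<close>.\<close>
  have z_large: "\<forall>\<^sub>F x in at_left \<alpha>. z x > M" for M
  proof -
    obtain m where m: "M * exp K < real m" using reals_Archimedean2 by blast
    have "M < Z m * \<alpha> ^ m"
    proof -
      have "real m * \<rho> ^ m \<le> real m * (exp K * N m)"
        unfolding \<rho>_def by (intro mult_left_mono N_growth) auto
      then have "real m \<le> exp K * (Z m * \<alpha> ^ m)"
        using \<rho>_pos by (simp add: Z_def \<alpha>_def power_divide field_simps)
      from less_le_trans[OF m this] have "exp K * M < exp K * (Z m * \<alpha> ^ m)"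
        by (simp only: mult.commute[of M])
      then show ?thesis by simp
    qed
    moreover have "((\<lambda>x. Z m * x ^ m) \<longlongrightarrow> Z m * \<alpha> ^ m) (at_left \<alpha>)"
      by (intro tendsto_intros)
    ultimately have "\<forall>\<^sub>F x in at_left \<alpha>. M < Z m * x ^ m" by (rule order_tendstoD(1)[rotated])
    then show ?thesis using inside
    proof eventually_elim
      case (elim x)
      have "Z m * x ^ m \<le> z x"
        unfolding z_def using sum_le_suminf[OF sumZ, of x "{m}"] elim Z0 by simp
      then show ?case using elim by simp
    qed
  qed
  have ratio: "((\<lambda>x. s x / z x) \<longlongrightarrow> b) (at_left \<alpha>)"
  proof (rule tendstoI)
    fix \<epsilon> :: real assume \<epsilon>: "\<epsilon> > 0"
    then have "\<epsilon> / 2 > 0" by simp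
    from bound[OF this] obtain D
      where D0: "D \<ge> 0 \<and> (\<forall>x. 0 < x \<longrightarrow> x < \<alpha> \<longrightarrow> summable (\<lambda>n. V n * x ^ n) \<and> \<bar>s x - b * z x\<bar> \<le> \<epsilon> / 2 * z x + D)" ..
    note D = conjunct1[OF D0] conjunct2[OF D0]
    show "\<forall>\<^sub>F x in at_left \<alpha>. dist (s x / z x) b < \<epsilon>"
      using inside z_large[of "2 * D / \<epsilon>"]
    proof eventually_elim
      case (elim x)
      have zp: "z x > 0" using elim D \<epsilon> by (smt (verit) divide_nonneg_pos)
      have "D < \<epsilon> / 2 * z x" using elim \<epsilon> by (simp add: field_simps)
      then have "\<bar>s x - b * z x\<bar> < \<epsilon> * z x" using D(2) elim by fastforce
      then have "\<bar>s x - b * z x\<bar> / z x < \<epsilon>" using zp by (simp add: field_simps)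
      moreover have "s x / z x - b = (s x - b * z x) / z x" using zp by (simp add: field_simps)
      ultimately show ?case using zp by (simp add: dist_real_def)
    qed
  qed
  have nonzero: "\<forall>\<^sub>F x in at_left \<alpha>. poly p x \<noteq> 0" if p: "p \<noteq> 0" for p :: "real poly"
  proof -
    obtain k p1 where p1: "p = [:- \<alpha>, 1:] ^ k * p1" "poly p1 \<alpha> \<noteq> 0"
      using poly_split_order[OF p] by metis
    show ?thesis using inside tendsto_imp_eventually_ne[OF tendsto_poly_at_left p1(2)]
      by eventually_elim (simp add: p1(1) poly_power)
  qed
  have eqs: "\<forall>\<^sub>F x in at_left \<alpha>. poly QZ x \<noteq> 0 \<and> poly QV x \<noteq> 0 \<and> z x > 0 \<and>
      poly PZ x = poly QZ x * z x \<and> poly PV x = poly QV x * s x"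
    using inside nonzero[OF conjunct1[OF PQZ]] nonzero[OF conjunct1[OF PQV]] z_large[of 0]
  proof eventually_elim
    case (elim x)
    have "summable (\<lambda>n. V n * x ^ n)" using bound[of 1] elim by auto
    then show ?case using elim PQZ PQV sumZ[of x] by (simp add: z_def s_def)
  qed
  \<comment> \<open>The divergence of \<open>z\<close> at \<open>\<alpha>\<close> can only come from
    a zero of its denominator; this is what makes \<open>\<alpha>\<close> algebraic.\<close>
  have "poly QZ \<alpha> = 0"
  proof (rule ccontr)
    assume nz: "poly QZ \<alpha> \<noteq> 0"
    have "((\<lambda>x. poly PZ x / poly QZ x) \<longlongrightarrow> poly PZ \<alpha> / poly QZ \<alpha>) (at_left \<alpha>)"
      using nz by (intro tendsto_divide tendsto_poly_at_left)
    then have "\<forall>\<^sub>F x in at_left \<alpha>. poly PZ x / poly QZ x < poly PZ \<alpha> / poly QZ \<alpha> + 1"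
      by (rule order_tendstoD) simp
    then have "\<forall>\<^sub>F x in at_left \<alpha>. False"
      using eqs z_large[of "poly PZ \<alpha> / poly QZ \<alpha> + 1"] by eventually_elim auto
    then show False by simp
  qed
  then have alg: "algebraic \<alpha>" using PQZ by (intro algebraicI'[of QZ]) auto
  have "QV * PZ \<noteq> 0"
  proof
    assume 0: "QV * PZ = 0"
    have "\<forall>\<^sub>F x in at_left \<alpha>. False"
      using eqs
    proof eventually_elim
      case (elim x)
      have "poly (QV * PZ) x \<noteq> 0" using elim by simp
      then show ?case using 0 by simp
    qed
    then show False by simp
  qed
  moreover have "((\<lambda>x. poly (PV * QZ) x / poly (QV * PZ) x) \<longlongrightarrow> b) (at_left \<alpha>)"
  proof (rule Lim_transform_eventually[OF ratio])
    show "\<forall>\<^sub>F x in at_left \<alpha>. s x / z x = poly (PV * QZ) x / poly (QV * PZ) x"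
      using eqs by eventually_elim (simp add: field_simps)
  qed
  moreover have "\<forall>i. coeff (PV * QZ) i \<in> \<rat>" "\<forall>i. coeff (QV * PZ) i \<in> \<rat>"
    using PQV PQZ by (auto simp: coeff_mult intro!: Rats_sum Rats_mult)
  ultimately show ?thesis using algebraic_limit_rational_function[OF alg] by blast
qed

text \<open>Since \<open>f g\<close> concentrates at \<open>b * n\<close>, the multiplier is the
  inverse of the drift, and the constant of \<open>square_root_concentration\<close> is divided by
  \<open>b\<close>.\<close>

theorem typical_ratio:
  "\<exists>lam::real. algebraic lam \<and> (\<forall>\<epsilon>>0. \<exists>K' n0. \<forall>n\<ge>n0. \<exists>G' \<subseteq> Sph n.
     real (card G') / real (card (Sph n)) \<ge> 1 - \<epsilon> \<and> (\<forall>g\<in>G'. \<bar>real n - lam * f g\<bar> \<le> K' * sqrt (real n)))"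
proof (rule exI[of _ "inverse b"], intro conjI allI impI)
  have b: "b > 0" using drift_lower c_pos by linarith
  show "algebraic (inverse b)" by (rule algebraic_inverse) (rule algebraic_drift)
  fix \<epsilon> :: real assume "\<epsilon> > 0"
  then obtain K' n0 where Kn: "\<forall>n\<ge>n0. real (card {x\<in>Sph n. \<bar>f x - b * real n\<bar> > K' * sqrt (real n)}) \<le> \<epsilon> * N n"
    using square_root_concentration by blast
  have "\<exists>G' \<subseteq> Sph n. real (card G') / real (card (Sph n)) \<ge> 1 - \<epsilon> \<and> (\<forall>g\<in>G'. \<bar>real n - inverse b * f g\<bar> \<le> K' / b * sqrt (real n))"
    if n: "n \<ge> n0" for n
  proof (intro exI conjI)
    let ?bad = "{x\<in>Sph n. \<bar>f x - b * real n\<bar> > K' * sqrt (real n)}"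
    show "Sph n - ?bad \<subseteq> Sph n" by blast
    have "real (card (Sph n - ?bad)) = N n - real (card ?bad)"
      unfolding N_def by (subst card_Diff_subset) (auto simp: finite_Sph of_nat_diff card_mono)
    also have "\<dots> \<ge> (1 - \<epsilon>) * N n" using Kn n by (simp add: algebra_simps)
    finally show "real (card (Sph n - ?bad)) / real (card (Sph n)) \<ge> 1 - \<epsilon>"
      using N_pos[of n] by (simp add: N_def pos_le_divide_eq)
    show "\<forall>g\<in>Sph n - ?bad. \<bar>real n - inverse b * f g\<bar> \<le> K' / b * sqrt (real n)"
    proof
      fix g assume "g \<in> Sph n - ?bad"
      then have "\<bar>f g - b * real n\<bar> \<le> K' * sqrt (real n)" by auto
      moreover have "\<bar>real n - inverse b * f g\<bar> = \<bar>f g - b * real n\<bar> / b"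
      proof -
        have "real n - inverse b * f g = - ((f g - b * real n) / b)" using b by (simp add: field_simps)
        then show ?thesis using b by simp
      qed
      ultimately show "\<bar>real n - inverse b * f g\<bar> \<le> K' / b * sqrt (real n)"
        using b by (simp add: divide_right_mono)
    qed
  qed
  then show "\<exists>K' n0. \<forall>n\<ge>n0. \<exists>G' \<subseteq> Sph n. real (card G') / real (card (Sph n)) \<ge> 1 - \<epsilon> \<and>
      (\<forall>g\<in>G'. \<bar>real n - inverse b * f g\<bar> \<le> K' * sqrt (real n))" by blast
qed

end

section \<open>Word metrics\<close>

context group
begin

abbreviation word_value :: "'a list \<Rightarrow> 'a" where "word_value w \<equiv> foldr (\<otimes>) w \<one>"

lemma word_value_closed: "set w \<subseteq> carrier G \<Longrightarrow> word_value w \<in> carrier G"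
  by (induction w) auto

lemma word_value_append:
  "set v \<subseteq> carrier G \<Longrightarrow> set w \<subseteq> carrier G \<Longrightarrow> word_value (v @ w) = word_value v \<otimes> word_value w"
  by (induction v) (auto simp: m_assoc word_value_closed)

lemma inv_mult_left_cancel:
  "a \<in> carrier G \<Longrightarrow> x \<in> carrier G \<Longrightarrow> y \<in> carrier G \<Longrightarrow> inv (a \<otimes> x) \<otimes> (a \<otimes> y) = inv x \<otimes> y"
  by (simp add: inv_mult_group m_assoc) (metis inv_closed inv_solve_left m_closed)

lemma inv_mult_chain:
  "x \<in> carrier G \<Longrightarrow> y \<in> carrier G \<Longrightarrow> z \<in> carrier G \<Longrightarrow> (inv x \<otimes> y) \<otimes> (inv y \<otimes> z) = inv x \<otimes> z"
  by (metis inv_closed inv_solve_left m_assoc m_closed)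

end

text \<open>\<open>T\<close> may lack inverses, so \<open>dst\<close> is left invariant and
  satisfies the triangle inequality but can fail to be symmetric; the order of its arguments matters
  below.\<close>

locale word_metric = group G for G :: "('a, 'b) monoid_scheme" (structure) +
  fixes T :: "'a set"
  assumes finite_T: "finite T" and generates: "semigroup_generates G T"
begin

abbreviation len :: "'a \<Rightarrow> nat" where "len \<equiv> word_length G T"
abbreviation dst :: "'a \<Rightarrow> 'a \<Rightarrow> nat" where "dst \<equiv> word_dist G T"

lemma T_carrier: "T \<subseteq> carrier G"
  using generates by (simp add: semigroup_generates_def)

lemma word_of_len:
  assumes "g \<in> carrier G"
  obtains w where "set w \<subseteq> T" "length w = len g" "word_value w = g"
proof -
  have "\<exists>n w. set w \<subseteq> T \<and> length w = n \<and> word_value w = g"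
    using assms generates unfolding semigroup_generates_def by blast
  then have "\<exists>w. set w \<subseteq> T \<and> length w = len g \<and> word_value w = g"
    unfolding word_length_def by (rule LeastI_ex)
  then show thesis using that by blast
qed

lemma len_word_value_le: "set w \<subseteq> T \<Longrightarrow> len (word_value w) \<le> length w"
  unfolding word_length_def by (rule Least_le) blast

lemma len_one [simp]: "len \<one> = 0"
  using len_word_value_le[of "[]"] by simp

lemma len_letter: "s \<in> T \<Longrightarrow> len s \<le> 1"
  using len_word_value_le[of "[s]"] T_carrier by auto

lemma len_mult:
  assumes "g \<in> carrier G" "h \<in> carrier G"
  shows "len (g \<otimes> h) \<le> len g + len h"
proof -
  obtain v where v: "set v \<subseteq> T" "length v = len g" "word_value v = g" using word_of_len assms by blast
  obtain w where w: "set w \<subseteq> T" "length w = len h" "word_value w = h" using word_of_len assms by blast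
  have "word_value (v @ w) = g \<otimes> h"
    using v w T_carrier by (subst word_value_append) auto
  then show ?thesis using len_word_value_le[of "v @ w"] v w by simp
qed

lemma len_eq_0: "g \<in> carrier G \<Longrightarrow> len g = 0 \<Longrightarrow> g = \<one>"
  using word_of_len[of g] by auto

lemma finite_ball: "finite {g \<in> carrier G. len g \<le> n}"
proof (rule finite_subset)
  show "{g \<in> carrier G. len g \<le> n} \<subseteq> word_value ` {w. set w \<subseteq> T \<and> length w \<le> n}"
  proof
    fix g assume "g \<in> {g \<in> carrier G. len g \<le> n}"
    then obtain w where "set w \<subseteq> T" "length w = len g" "word_value w = g" "len g \<le> n"
      using word_of_len[of g] by blast
    then show "g \<in> word_value ` {w. set w \<subseteq> T \<and> length w \<le> n}" by force
  qed
  show "finite (word_value ` {w. set w \<subseteq> T \<and> length w \<le> n})"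
    using finite_lists_length_le[OF finite_T, of n] by (rule finite_imageI)
qed

lemma dst_def: "dst x y = len (inv x \<otimes> y)"
  by (simp add: word_dist_def)

lemma dst_self [simp]: "x \<in> carrier G \<Longrightarrow> dst x x = 0"
  by (simp add: dst_def)

lemma dst_eq_0: "x \<in> carrier G \<Longrightarrow> y \<in> carrier G \<Longrightarrow> dst x y = 0 \<Longrightarrow> x = y"
  using len_eq_0[of "inv x \<otimes> y"] by (metis dst_def inv_closed inv_equality inv_inv m_closed)

lemma dst_triangle:
  "x \<in> carrier G \<Longrightarrow> y \<in> carrier G \<Longrightarrow> z \<in> carrier G \<Longrightarrow> dst x z \<le> dst x y + dst y z"
  unfolding dst_def by (metis inv_closed inv_mult_chain len_mult m_closed)

lemma dst_left_mult:
  "a \<in> carrier G \<Longrightarrow> x \<in> carrier G \<Longrightarrow> y \<in> carrier G \<Longrightarrow> dst (a \<otimes> x) (a \<otimes> y) = dst x y"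
  by (simp add: dst_def inv_mult_left_cancel)

lemma dst_one_left: "x \<in> carrier G \<Longrightarrow> dst \<one> x = len x"
  by (simp add: dst_def)

lemma dst_right_mult: "g \<in> carrier G \<Longrightarrow> h \<in> carrier G \<Longrightarrow> dst g (g \<otimes> h) = len h"
  by (metis dst_left_mult dst_one_left one_closed r_one)

text \<open>Only the values of \<open>p\<close> on \<open>{0..dst x y}\<close> matter.\<close>

definition geodesic :: "(nat \<Rightarrow> 'a) \<Rightarrow> 'a \<Rightarrow> 'a \<Rightarrow> bool" where
  "geodesic p x y \<longleftrightarrow> p 0 = x \<and> p (dst x y) = y \<and> (\<forall>i\<le>dst x y. p i \<in> carrier G) \<and>
     (\<forall>i j. i \<le> j \<longrightarrow> j \<le> dst x y \<longrightarrow> dst (p i) (p j) = j - i)"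

lemma geodesic_exists:
  assumes x: "x \<in> carrier G" and y: "y \<in> carrier G"
  shows "\<exists>p. geodesic p x y"
proof -
  define n where "n = dst x y"
  have "inv x \<otimes> y \<in> carrier G" using x y by simp
  then obtain w where w: "set w \<subseteq> T" "length w = n" "word_value w = inv x \<otimes> y"
    using word_of_len unfolding n_def dst_def by blast
  define p where "p i = x \<otimes> word_value (take i w)" for i
  have wc: "set (take i w) \<subseteq> carrier G" "set (drop i (take j w)) \<subseteq> carrier G" for i j
    using w(1) T_carrier by (meson order_trans set_take_subset set_drop_subset)+
  have pc: "p i \<in> carrier G" for i
    unfolding p_def using x word_value_closed[OF wc(1)] by simp
  have p0: "p 0 = x" using x by (simp add: p_def)
  have pn: "p n = y" using w x y by (simp add: p_def m_assoc[symmetric])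
  have up: "dst (p i) (p j) \<le> j - i" if "i \<le> j" "j \<le> n" for i j
  proof -
    have "take j w = take i w @ drop i (take j w)"
      using that by (metis append_take_drop_id min.absorb1 take_take)
    then have "word_value (take j w) = word_value (take i w) \<otimes> word_value (drop i (take j w))"
      using word_value_append[OF wc(1)[of i] wc(2)[of i j]] by simp
    then have "p j = p i \<otimes> word_value (drop i (take j w))"
      unfolding p_def using x word_value_closed[OF wc(1)[of i]] word_value_closed[OF wc(2)[of i j]]
      by (simp add: m_assoc)
    then have "dst (p i) (p j) = len (word_value (drop i (take j w)))"
      using dst_right_mult pc word_value_closed[OF wc(2)] by simp
    also have "\<dots> \<le> length (drop i (take j w))"
      using w(1) by (intro len_word_value_le) (meson order_trans set_take_subset set_drop_subset)
    also have "\<dots> = j - i" using that w by simp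
    finally show ?thesis .
  qed
  \<comment> \<open>The upper bounds for three consecutive pieces add up to the full distance, so
    none of them can be strict.\<close>
  have "dst (p i) (p j) = j - i" if ij: "i \<le> j" "j \<le> n" for i j
  proof -
    have "n \<le> dst (p 0) (p i) + (dst (p i) (p j) + dst (p j) (p n))"
      using dst_triangle[of "p 0" "p i" "p n"] dst_triangle[of "p i" "p j" "p n"] pc x y
      unfolding p0 pn n_def[symmetric] by simp
    then show ?thesis using up[of 0 i] up[of i j] up[of j n] ij by linarith
  qed
  then have "geodesic p x y" unfolding geodesic_def using p0 pn pc by (simp add: n_def)
  then show ?thesis by (intro exI[of _ p])
qed

lemma geodesicD:
  assumes "geodesic p x y"
  shows "p 0 = x" "p (dst x y) = y" "i \<le> dst x y \<Longrightarrow> p i \<in> carrier G"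
    "i \<le> j \<Longrightarrow> j \<le> dst x y \<Longrightarrow> dst (p i) (p j) = j - i"
    "i \<le> dst x y \<Longrightarrow> dst x (p i) = i" "i \<le> dst x y \<Longrightarrow> dst (p i) y = dst x y - i"
  using assms unfolding geodesic_def by fastforce+

text \<open>Two geodesics are concatenated at \<open>z\<close>; the equation between distances rules
  out a shortcut, by the same count as in \<open>geodesic_exists\<close>.\<close>

lemma geodesic_through:
  assumes x: "x \<in> carrier G" and y: "y \<in> carrier G" and z: "z \<in> carrier G"
    and between: "dst x z + dst z y = dst x y"
  shows "\<exists>p. geodesic p x y \<and> p (dst x z) = z"
proof -
  obtain p1 where p1: "geodesic p1 x z" using geodesic_exists x z by blast
  obtain p2 where p2: "geodesic p2 z y" using geodesic_exists z y by blast
  define a where "a = dst x z"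
  define n where "n = dst x y"
  have n: "n = a + dst z y" using between by (simp add: a_def n_def)
  define p where "p i = (if i \<le> a then p1 i else p2 (i - a))" for i
  note g1 = geodesicD[OF p1, folded a_def] and g2 = geodesicD[OF p2]
  have pc: "p i \<in> carrier G" if "i \<le> n" for i
    using that g1(3)[of i] g2(3)[of "i - a"] by (auto simp: p_def n)
  have p0: "p 0 = x" and pn: "p n = y" and pa: "p a = z"
    using g1 g2 dst_eq_0[OF z y] by (auto simp: p_def n)
  have up: "dst (p i) (p j) \<le> j - i" if "i \<le> j" "j \<le> n" for i j
  proof -
    consider "j \<le> a" | "i \<le> a" "a < j" | "a < i" by linarith
    then show ?thesis
    proof cases
      case 1
      then show ?thesis using g1(4)[of i j] that by (simp add: p_def)
    next
      case 2
      have "dst (p i) (p j) \<le> dst (p i) z + dst z (p j)"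
        using dst_triangle pc that z by (meson order_trans)
      moreover have "dst (p i) z = a - i" using g1(4)[of i a] g1(2) 2 by (simp add: p_def)
      moreover have "dst z (p j) = j - a" using g2(4)[of 0 "j - a"] g2(1) 2 that by (simp add: p_def n)
      ultimately show ?thesis using 2 by simp
    next
      case 3
      then show ?thesis using g2(4)[of "i - a" "j - a"] that by (simp add: p_def n)
    qed
  qed
  have "dst (p i) (p j) = j - i" if ij: "i \<le> j" "j \<le> n" for i j
  proof -
    have "n \<le> dst (p 0) (p i) + (dst (p i) (p j) + dst (p j) (p n))"
      using dst_triangle[of "p 0" "p i" "p n"] dst_triangle[of "p i" "p j" "p n"] pc[of i] pc[of j] ij x y
      unfolding p0 pn n_def[symmetric] by simp
    then show ?thesis using up[of 0 i] up[of i j] up[of j n] ij by linarith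
  qed
  then have "geodesic p x y" unfolding geodesic_def using p0 pn pc by (simp add: n_def)
  moreover have "p (dst x z) = z" using pa by (simp add: a_def)
  ultimately show ?thesis by (intro exI[of _ p] conjI)
qed

lemma len_split:
  assumes g: "g \<in> carrier G" and k: "k \<le> len g"
  shows "\<exists>a\<in>carrier G. \<exists>b\<in>carrier G. g = a \<otimes> b \<and> len a = k \<and> len b = len g - k"
proof -
  obtain p where p: "geodesic p \<one> g" using geodesic_exists g by blast
  have n: "dst \<one> g = len g" by (simp add: dst_one_left g)
  have "p k \<in> carrier G" "dst \<one> (p k) = k" "dst (p k) g = len g - k"
    using geodesicD[OF p] k by (auto simp: n)
  then show ?thesis using g
    by (intro bexI[of _ "p k"] bexI[of _ "inv (p k) \<otimes> g"]) (auto simp: dst_def inv_mult_chain m_assoc[symmetric])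
qed

lemma card_dst_ball:
  assumes v: "v \<in> carrier G"
  shows "{x \<in> carrier G. dst v x \<le> r} = (\<lambda>h. v \<otimes> h) ` {h \<in> carrier G. len h \<le> r}"
    and "finite {x \<in> carrier G. dst v x \<le> r}"
    and "card {x \<in> carrier G. dst v x \<le> r} \<le> card {h \<in> carrier G. len h \<le> r}"
proof -
  show *: "{x \<in> carrier G. dst v x \<le> r} = (\<lambda>h. v \<otimes> h) ` {h \<in> carrier G. len h \<le> r}"
  proof (intro equalityI subsetI)
    fix x assume x: "x \<in> {x \<in> carrier G. dst v x \<le> r}"
    then have "x = v \<otimes> (inv v \<otimes> x)" using v by (simp add: m_assoc[symmetric])
    then show "x \<in> (\<lambda>h. v \<otimes> h) ` {h \<in> carrier G. len h \<le> r}" using x v by (auto simp: dst_def)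
  qed (use v dst_right_mult in auto)
  show "finite {x \<in> carrier G. dst v x \<le> r}" unfolding * using finite_ball by simp
  show "card {x \<in> carrier G. dst v x \<le> r} \<le> card {h \<in> carrier G. len h \<le> r}"
    unfolding * by (rule card_image_le[OF finite_ball])
qed

lemma infinite_imp_sphere_nonempty:
  assumes "infinite (carrier G)"
  shows "word_sphere G T n \<noteq> {}"
proof -
  have "\<not> carrier G \<subseteq> {g \<in> carrier G. len g \<le> n}"
    using finite_ball assms finite_subset by blast
  then obtain g where g: "g \<in> carrier G" "n \<le> len g" by force
  then obtain a where "a \<in> carrier G" "len a = n" using len_split by blast
  then show ?thesis by (auto simp: word_sphere_def)
qed

lemma finite_sphere: "finite (word_sphere G T n)"
  using finite_ball[of n] by (rule finite_subset[rotated]) (auto simp: word_sphere_def)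

end

lemma word_length_comparable:
  assumes "word_metric G S" "word_metric G T"
  shows "\<exists>A\<ge>1. \<forall>g\<in>carrier G. word_length G T g \<le> A * word_length G S g"
proof -
  interpret S: word_metric G S by fact
  interpret T: word_metric G T by fact
  define A where "A = Suc (\<Sum>s\<in>S. T.len s)"
  have A: "T.len s \<le> A" if "s \<in> S" for s
    using member_le_sum[OF that, of T.len] S.finite_T by (simp add: A_def)
  have "set w \<subseteq> S \<Longrightarrow> T.len (S.word_value w) \<le> A * length w" for w
  proof (induction w)
    case (Cons s w)
    have "T.len (s \<otimes>\<^bsub>G\<^esub> S.word_value w) \<le> T.len s + T.len (S.word_value w)"
      using Cons.prems S.T_carrier by (intro T.len_mult S.word_value_closed) auto
    also have "\<dots> \<le> A + A * length w" using Cons A by (intro add_mono) auto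
    finally show ?case by simp
  qed simp
  then have "T.len g \<le> A * S.len g" if "g \<in> carrier G" for g
    using S.word_of_len[OF that] by metis
  then show ?thesis by (intro exI[of _ A]) (simp add: A_def)
qed

section \<open>Hyperbolicity and quasigeodesics\<close>

text \<open>For the stability of geodesics: a detour of length linear in \<open>k\<close> fits into
  \<open>2 ^ k\<close> chain links, which cost only \<open>k\<close> four-point errors. Halving
  \<open>k\<close> turns two linear lower bounds for powers of two into a quadratic one.\<close>

lemma exists_pow2_ge_affine: "\<exists>k0. \<forall>k\<ge>k0. c * (k + 1) + 2 \<le> (2::nat) ^ k"
proof (intro exI allI impI)
  fix k :: nat assume k: "8 * c + 8 \<le> k"
  obtain e f where ef: "k = e + f" "e \<le> f" "f \<le> e + 1"
  proof (cases "even k")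
    case True
    then obtain e where "k = 2 * e" ..
    then show thesis by (intro that[of e e]) auto
  next
    case False
    then obtain e where "k = 2 * e + 1" by (rule oddE)
    then show thesis by (intro that[of e "e + 1"]) auto
  qed
  have "e + 1 \<le> 2 ^ e" "f + 1 \<le> 2 ^ f" using less_exp[of e] less_exp[of f] by linarith+
  then have "(e + 1) * (f + 1) \<le> 2 ^ e * 2 ^ f" by (rule mult_le_mono)
  then have 1: "(e + 1) * (f + 1) \<le> 2 ^ k" by (simp add: ef(1) power_add)
  have "(k + 1) * (4 * c + 4) \<le> (2 * (e + 1)) * (f + 1)"
    using k ef(2,3) unfolding ef(1) by (intro mult_le_mono) auto
  moreover have "(k + 1) * (4 * c + 4) = 2 * ((k + 1) * (2 * c + 2))" by (simp add: algebra_simps)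
  moreover have "(2 * (e + 1)) * (f + 1) = 2 * ((e + 1) * (f + 1))" by (rule mult.assoc)
  ultimately have "(k + 1) * (2 * c + 2) \<le> (e + 1) * (f + 1)" by linarith
  moreover have "c * (k + 1) + 2 \<le> (k + 1) * (2 * c + 2)" by (simp add: algebra_simps)
  ultimately show "c * (k + 1) + 2 \<le> 2 ^ k" using 1 by linarith
qed

locale symmetric_word_metric = word_metric G S for G :: "('a, 'b) monoid_scheme" (structure) and S +
  assumes symmetric: "s \<in> S \<Longrightarrow> inv s \<in> S"
begin

abbreviation d :: "'a \<Rightarrow> 'a \<Rightarrow> real" where "d x y \<equiv> real (dst x y)"

lemma len_inv:
  assumes "g \<in> carrier G"
  shows "len (inv g) = len g"
proof -
  have le: "len (inv g) \<le> len g" if g: "g \<in> carrier G" for g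
  proof -
    have "set w \<subseteq> S \<Longrightarrow> len (inv (word_value w)) \<le> length w" for w
    proof (induction w)
      case (Cons s w)
      have c: "s \<in> carrier G" "word_value w \<in> carrier G"
        using Cons.prems T_carrier by (auto intro: word_value_closed)
      have "len (inv (s \<otimes> word_value w)) \<le> len (inv (word_value w)) + len (inv s)"
        using c by (simp add: inv_mult_group len_mult)
      also have "len (inv s) \<le> 1" using Cons.prems symmetric by (intro len_letter) auto
      finally show ?case using Cons by simp
    qed simp
    then show ?thesis using word_of_len[OF g] by metis
  qed
  from le[of "inv g"] le[of g] assms show ?thesis by simp
qed

lemma dst_commute: "x \<in> carrier G \<Longrightarrow> y \<in> carrier G \<Longrightarrow> dst x y = dst y x"
  using len_inv[of "inv x \<otimes> y"] by (simp add: dst_def inv_mult_group)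

lemma d_triangle: "x \<in> carrier G \<Longrightarrow> y \<in> carrier G \<Longrightarrow> z \<in> carrier G \<Longrightarrow> d x z \<le> d x y + d y z"
  using dst_triangle[of x y z] by linarith

lemma geodesic_list:
  assumes "geodesic p x y"
  shows "cayley_geodesic G S x y (map p [0..<Suc (dst x y)])"
proof -
  have nth: "map p [0..<Suc (dst x y)] ! i = p i" if "i \<le> dst x y" for i
    using that by (subst nth_map) (auto simp del: upt_Suc)
  show ?thesis
    unfolding cayley_geodesic_def
  proof (intro conjI allI impI)
    show "hd (map p [0..<Suc (dst x y)]) = x"
      using geodesicD(1)[OF assms] by (simp add: upt_rec del: upt_Suc)
    show "last (map p [0..<Suc (dst x y)]) = y" using geodesicD(2)[OF assms] by simp
    fix i j assume "i \<le> j \<and> j < length (map p [0..<Suc (dst x y)])"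
    then show "dst (map p [0..<Suc (dst x y)] ! i) (map p [0..<Suc (dst x y)] ! j) = j - i"
      using geodesicD(4)[OF assms, of i j] by (simp add: nth del: upt_Suc)
  qed (use geodesicD(3)[OF assms] in auto)
qed

lemma slim_triangle:
  assumes slim: "cayley_slim_triangles G S \<delta>"
    and p: "geodesic p x y" and q: "geodesic q y z" and r: "geodesic r z x"
    and "x \<in> carrier G" "y \<in> carrier G" "z \<in> carrier G" and i: "i \<le> dst x y"
  shows "(\<exists>j\<le>dst y z. d (p i) (q j) \<le> \<delta>) \<or> (\<exists>j\<le>dst z x. d (p i) (r j) \<le> \<delta>)"
proof -
  have "\<forall>u\<in>set (map p [0..<Suc (dst x y)]). \<exists>v\<in>set (map q [0..<Suc (dst y z)]) \<union> set (map r [0..<Suc (dst z x)]).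
      d u v \<le> \<delta>"
    using slim assms(5-7) geodesic_list[OF p] geodesic_list[OF q] geodesic_list[OF r]
    unfolding cayley_slim_triangles_def by blast
  moreover have "p i \<in> set (map p [0..<Suc (dst x y)])" using i by (auto simp del: upt_Suc)
  ultimately obtain v where "v \<in> set (map q [0..<Suc (dst y z)]) \<union> set (map r [0..<Suc (dst z x)])" "d (p i) v \<le> \<delta>"
    by blast
  then show ?thesis by (auto simp del: upt_Suc simp: less_Suc_eq_le)
qed

text \<open>Walking from \<open>x\<close> to \<open>z\<close>, one starts close to the side from
  \<open>w\<close> to \<open>x\<close> and ends close to the side from \<open>z\<close> to
  \<open>w\<close>. At the switch both are close, and the two resulting estimates of
  \<open>d (p i) w\<close> add up to twice the Gromov product of \<open>x\<close> and
  \<open>z\<close> seen from \<open>w\<close>.\<close>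

lemma slim_imp_near_side:
  assumes slim: "cayley_slim_triangles G S \<delta>" and \<delta>: "0 \<le> \<delta>" and p: "geodesic p x z"
    and c: "x \<in> carrier G" "z \<in> carrier G" "w \<in> carrier G"
  shows "\<exists>i\<le>dst x z. 2 * d (p i) w \<le> d x w + d z w - d x z + 4 * \<delta> + 2"
proof -
  obtain q where q: "geodesic q z w" using geodesic_exists c by blast
  obtain r where r: "geodesic r w x" using geodesic_exists c by blast
  note gp = geodesicD[OF p] and gq = geodesicD[OF q] and gr = geodesicD[OF r]
  define Q where "Q i \<longleftrightarrow> (\<exists>j\<le>dst z w. d (p i) (q j) \<le> \<delta>)" for i
  define R where "R i \<longleftrightarrow> (\<exists>j\<le>dst w x. d (p i) (r j) \<le> \<delta>)" for i
  have QR: "Q i \<or> R i" if "i \<le> dst x z" for i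
    unfolding Q_def R_def by (rule slim_triangle[OF slim p q r]) (use c that in auto)
  have Qn: "Q (dst x z)" unfolding Q_def
    using gp gq c \<delta> by (intro exI[of _ 0]) simp
  have R0: "R 0" unfolding R_def
    using gp gr c \<delta> by (intro exI[of _ "dst w x"]) simp
  \<comment> \<open>Unless this index is 0, its predecessor is close to the other side and one unit
    away; hence \<open>\<delta> + 1\<close> below and the summand 2 in the conclusion.\<close>
  define i where "i = (LEAST i. Q i)"
  have Qi: "Q i" unfolding i_def by (rule LeastI[of Q]) (rule Qn)
  have i: "i \<le> dst x z" unfolding i_def by (rule Least_le) (rule Qn)
  note pc = gp(3)[OF i]
  have "\<exists>j\<le>dst w x. d (p i) (r j) \<le> \<delta> + 1"
  proof (cases i)
    case 0
    then show ?thesis using R0 unfolding R_def by fastforce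
  next
    case (Suc k)
    then have "\<not> Q k" unfolding i_def using not_less_Least[of k Q] by simp
    then obtain j where j: "j \<le> dst w x" "d (p k) (r j) \<le> \<delta>" using QR[of k] i Suc unfolding R_def by auto
    have k: "k \<le> dst x z" using i Suc by simp
    have "d (p i) (r j) \<le> d (p i) (p k) + d (p k) (r j)"
      using pc gp(3)[OF k] gr(3)[OF j(1)] by (intro d_triangle)
    moreover have "dst (p i) (p k) = 1"
      using gp(4)[of k i] dst_commute[OF pc gp(3)[OF k]] i Suc by simp
    ultimately show ?thesis using j by (intro exI[of _ j]) simp
  qed
  then obtain j where j: "j \<le> dst w x" "d (p i) (r j) \<le> \<delta> + 1" by blast
  obtain k where k: "k \<le> dst z w" "d (p i) (q k) \<le> \<delta>" using Qi unfolding Q_def by blast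
  note rc = gr(3)[OF j(1)] and qc = gq(3)[OF k(1)]
  have 1: "d x w = d x (r j) + d (r j) w"
    using gr(5)[OF j(1)] gr(6)[OF j(1)] j(1) dst_commute[OF c(3) rc] dst_commute[OF rc c(1)] dst_commute[OF c(3) c(1)] by simp
  have 2: "d z w = d z (q k) + d (q k) w"
    using gq(5)[OF k(1)] gq(6)[OF k(1)] k(1) by simp
  have 3: "d x z = d x (p i) + d (p i) z" using gp(5)[OF i] gp(6)[OF i] i by simp
  have "d x (p i) \<le> d x (r j) + d (r j) (p i)" "d (p i) w \<le> d (p i) (r j) + d (r j) w"
    "d z (p i) \<le> d z (q k) + d (q k) (p i)" "d (p i) w \<le> d (p i) (q k) + d (q k) w"
    using c pc rc qc by (auto intro: d_triangle)
  moreover have "d (r j) (p i) = d (p i) (r j)" "d (q k) (p i) = d (p i) (q k)" "d z (p i) = d (p i) z"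
    using dst_commute c pc rc qc by simp_all
  ultimately have "2 * d (p i) w \<le> d x w + d z w - d x z + 4 * \<delta> + 2"
    using 1 2 3 j(2) k(2) by linarith
  then show ?thesis using i by blast
qed

text \<open>Take a point of the side from \<open>x\<close> to \<open>z\<close> as in
  \<open>slim_imp_near_side\<close>. By slimness it is within \<open>\<delta>\<close> of one of the
  two sides at \<open>y\<close>, and which one decides the term of the maximum. The errors are
  \<open>4 * \<delta> + 2\<close> from that point and \<open>2 * \<delta>\<close> from
  slimness.\<close>

lemma slim_imp_four_point:
  assumes slim: "cayley_slim_triangles G S \<delta>" and \<delta>: "0 \<le> \<delta>"
    and c: "x \<in> carrier G" "y \<in> carrier G" "z \<in> carrier G" "w \<in> carrier G"
  shows "d x z + d y w \<le> max (d x y + d z w) (d x w + d y z) + (6 * \<delta> + 2)"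
proof -
  obtain p where p: "geodesic p x z" using geodesic_exists c by blast
  obtain q where q: "geodesic q z y" using geodesic_exists c by blast
  obtain r where r: "geodesic r y x" using geodesic_exists c by blast
  note gp = geodesicD[OF p] and gq = geodesicD[OF q] and gr = geodesicD[OF r]
  obtain i where i: "i \<le> dst x z" "2 * d (p i) w \<le> d x w + d z w - d x z + 4 * \<delta> + 2"
    using slim_imp_near_side[OF slim \<delta> p c(1) c(3) c(4)] by blast
  note pc = gp(3)[OF i(1)]
  have key: "d a w + d b w - d a b \<le> 2 * (d (p i) v + d (p i) w)"
    if "v \<in> carrier G" "a \<in> carrier G" "b \<in> carrier G" "d a v + d v b = d a b" for v a b
  proof -
    have "d a w \<le> d a v + d v w" "d b w \<le> d v b + d v w" "d v w \<le> d (p i) v + d (p i) w"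
      using d_triangle[of a v w] d_triangle[of b v w] d_triangle[of v "p i" w] that c pc
        dst_commute[of b v] dst_commute[of v "p i"] by auto
    then show ?thesis unfolding that(4)[symmetric] by argo
  qed
  have sw: "d y x = d x y" "d z y = d y z" using c dst_commute by simp_all
  from slim_triangle[OF slim p q r c(1) c(3) c(2) i(1)] show ?thesis
  proof
    assume "\<exists>j\<le>dst z y. d (p i) (q j) \<le> \<delta>"
    then obtain j where j: "j \<le> dst z y" "d (p i) (q j) \<le> \<delta>" by blast
    have "d z (q j) + d (q j) y = d z y" using gq(5)[OF j(1)] gq(6)[OF j(1)] j(1) by simp
    from key[OF gq(3)[OF j(1)] c(3) c(2) this]
    have "d x z + d y w \<le> (d x w + d y z) + (6 * \<delta> + 2)" using i(2) j(2) sw by argo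
    then show ?thesis by (simp add: max_def)
  next
    assume "\<exists>j\<le>dst y x. d (p i) (r j) \<le> \<delta>"
    then obtain j where j: "j \<le> dst y x" "d (p i) (r j) \<le> \<delta>" by blast
    have "d y (r j) + d (r j) x = d y x" using gr(5)[OF j(1)] gr(6)[OF j(1)] j(1) by simp
    from key[OF gr(3)[OF j(1)] c(2) c(1) this]
    have "d x z + d y w \<le> (d x y + d z w) + (6 * \<delta> + 2)" using i(2) j(2) sw by argo
    then show ?thesis by (simp add: max_def)
  qed
qed

end

text \<open>Gromov's four-point form of hyperbolicity speaks of distances only, which turns the
  later estimates into linear arithmetic.\<close>

locale hyperbolic_group = symmetric_word_metric G S for G :: "('a, 'b) monoid_scheme" (structure) and S +
  fixes \<Delta> :: real
  assumes \<Delta>_nonneg: "0 \<le> \<Delta>"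
    and four_point: "x \<in> carrier G \<Longrightarrow> y \<in> carrier G \<Longrightarrow> z \<in> carrier G \<Longrightarrow> w \<in> carrier G \<Longrightarrow>
      d x z + d y w \<le> max (d x y + d z w) (d x w + d y z) + \<Delta>"
begin

text \<open>Twice the Gromov product of \<open>x\<close> and \<open>y\<close> seen from \<open>w\<close>.\<close>

definition gp2 :: "'a \<Rightarrow> 'a \<Rightarrow> 'a \<Rightarrow> real" where "gp2 x y w = d x w + d y w - d x y"

lemma gp2_commute: "x \<in> carrier G \<Longrightarrow> y \<in> carrier G \<Longrightarrow> gp2 x y w = gp2 y x w"
  by (simp add: gp2_def dst_commute)

lemma gp2_min:
  "x \<in> carrier G \<Longrightarrow> y \<in> carrier G \<Longrightarrow> z \<in> carrier G \<Longrightarrow> w \<in> carrier G \<Longrightarrow>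
    min (gp2 x y w) (gp2 y z w) - \<Delta> \<le> gp2 x z w"
  using four_point[of x y z w] by (auto simp: gp2_def)

text \<open>Bisection applies \<open>gp2_min\<close> along a binary tree of depth \<open>k\<close>,
  so the loss is logarithmic in the number of links.\<close>

lemma gp2_chain:
  fixes c :: real
  assumes w: "w \<in> carrier G"
    and cp: "\<And>i. i \<le> m \<Longrightarrow> p i \<in> carrier G" and "1 \<le> m" "m \<le> 2 ^ k"
    and c: "\<And>i. i < m \<Longrightarrow> c \<le> gp2 (p i) (p (Suc i)) w"
  shows "c - real k * \<Delta> \<le> gp2 (p 0) (p m) w"
  using assms(2-)
proof (induction k arbitrary: p m)
  case 0
  then show ?case by (cases m) auto
next
  case (Suc k)
  show ?case
  proof (cases "m \<le> 2 ^ k")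
    case True
    have "c - real k * \<Delta> \<le> gp2 (p 0) (p m) w" by (rule Suc.IH) (use Suc.prems True in auto)
    then show ?thesis using \<Delta>_nonneg by (simp add: algebra_simps)
  next
    case False
    define n where "n = (2::nat) ^ k"
    have n: "n < m" "m - n \<le> 2 ^ k" "1 \<le> n" using False Suc.prems by (auto simp: n_def)
    have 1: "c - real k * \<Delta> \<le> gp2 (p 0) (p n) w"
      by (rule Suc.IH) (use Suc.prems n in \<open>auto simp: n_def\<close>)
    have "c - real k * \<Delta> \<le> gp2 (p (n + 0)) (p (n + (m - n))) w"
      by (rule Suc.IH[of "m - n" "\<lambda>i. p (n + i)"]) (use Suc.prems n in auto)
    then have 2: "c - real k * \<Delta> \<le> gp2 (p n) (p m) w" using n by simp
    have "min (gp2 (p 0) (p n) w) (gp2 (p n) (p m) w) - \<Delta> \<le> gp2 (p 0) (p m) w"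
      using Suc.prems(1)[of 0] Suc.prems(1)[of n] Suc.prems(1)[of m] n w by (intro gp2_min) auto
    then show ?thesis using 1 2 by (simp add: algebra_simps)
  qed
qed

text \<open>One instance of the four-point condition, for \<open>z\<close>, \<open>x\<close>,
  \<open>v\<close>, \<open>y\<close>; it is the form that fellow travelling takes when only
  distances are used.\<close>

lemma almost_between_close:
  assumes c: "x \<in> carrier G" "y \<in> carrier G" "z \<in> carrier G" "v \<in> carrier G"
    and z: "d x z + d z y \<le> d x y + D" and v: "d x v + d v y \<le> d x y + D'"
    and close: "\<bar>d x z - d x v\<bar> \<le> e"
  shows "d z v \<le> max D D' + e + \<Delta>"
proof -
  have "d z v + d x y \<le> max (d z x + d v y) (d z y + d x v) + \<Delta>"
    using four_point[of z x v y] c by simp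
  moreover have "d z x = d x z" using c dst_commute by simp
  ultimately show ?thesis using z v close by linarith
qed

section \<open>Stability of geodesics of another generating set\<close>

context
  fixes T :: "'a set" and A :: nat
  assumes T: "word_metric G T"
    and ST: "\<And>g. g \<in> carrier G \<Longrightarrow> word_length G S g \<le> A * word_length G T g"
    and TS: "\<And>g. g \<in> carrier G \<Longrightarrow> word_length G T g \<le> A * word_length G S g"
begin

interpretation T: word_metric G T by (rule T)

lemma dst_le_T: "x \<in> carrier G \<Longrightarrow> y \<in> carrier G \<Longrightarrow> dst x y \<le> A * T.dst x y"
  unfolding dst_def T.dst_def by (rule ST) simp

lemma T_le_dst: "x \<in> carrier G \<Longrightarrow> y \<in> carrier G \<Longrightarrow> T.dst x y \<le> A * dst x y"
  unfolding dst_def T.dst_def by (rule TS) simp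

text \<open>Consecutive points of the \<open>T\<close>-geodesic are at distance at most
  \<open>A\<close> and both at least \<open>D\<close> away from \<open>z\<close>, so each link has
  \<open>gp2\<close> at least \<open>2 * D - A\<close>; \<open>gp2_chain\<close> does the
  rest.\<close>

lemma gp2_along_T_geodesic:
  assumes p: "T.geodesic p x y" and ab: "a \<le> b" "b \<le> T.dst x y" and k: "b - a + 2 \<le> 2 ^ k"
    and c: "u \<in> carrier G" "v \<in> carrier G" "z \<in> carrier G"
    and far: "\<And>i. i \<le> T.dst x y \<Longrightarrow> D \<le> dst z (p i)"
    and ua: "2 * real D \<le> gp2 u (p a) z" and bv: "2 * real D \<le> gp2 (p b) v z"
  shows "2 * real D - real A - real k * \<Delta> \<le> gp2 u v z"
proof -
  note gp = T.geodesicD[OF p]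
  \<comment> \<open>Number of links of the chain \<open>u\<close>, \<open>p a\<close>, ...,
    \<open>p b\<close>, \<open>v\<close>.\<close>
  define m where "m = b - a + 2"
  define q where "q i = (if i = 0 then u else if i = m then v else p (a + i - 1))" for i
  have "2 * real D - real A - real k * \<Delta> \<le> gp2 (q 0) (q m) z"
  proof (rule gp2_chain[OF c(3)])
    show "q i \<in> carrier G" if "i \<le> m" for i
      using that gp(3)[of "a + i - 1"] ab c by (auto simp: q_def m_def)
    fix i assume i: "i < m"
    consider "i = 0" | "0 < i" "Suc i < m" | "Suc i = m" using i by linarith
    then show "2 * real D - real A \<le> gp2 (q i) (q (Suc i)) z"
    proof cases
      case 1
      then show ?thesis using ua by (simp add: q_def m_def)
    next
      case 2
      define j where "j = a + i - 1"
      have j: "Suc j \<le> T.dst x y" "q i = p j" "q (Suc i) = p (Suc j)"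
        using 2 ab by (auto simp: q_def m_def j_def)
      have jc: "p j \<in> carrier G" "p (Suc j) \<in> carrier G" using gp(3) j(1) by auto
      have "T.dst (p j) (p (Suc j)) = 1" using gp(4)[of j "Suc j"] j(1) by simp
      then have "dst (p j) (p (Suc j)) \<le> A" using dst_le_T[OF jc] by simp
      moreover have "D \<le> dst z (p j)" "D \<le> dst z (p (Suc j))" using far j(1) by auto
      moreover have "dst z (p j) = dst (p j) z" "dst z (p (Suc j)) = dst (p (Suc j)) z"
        using dst_commute c jc by auto
      ultimately show ?thesis unfolding j gp2_def by linarith
    next
      case 3
      then have "q i = p b" "q (Suc i) = v" using ab by (auto simp: q_def m_def)
      then show ?thesis using bv by simp
    qed
  qed (use k in \<open>auto simp: m_def\<close>)
  then show ?thesis by (simp add: q_def m_def)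
qed

text \<open>Morse lemma. From a point \<open>z\<close> of \<open>q\<close> farthest from
  \<open>p\<close>, at distance \<open>D\<close>, go \<open>2 * D\<close> along \<open>q\<close> in
  both directions and cross over to \<open>p\<close>. The path along \<open>p\<close> stays outside
  the \<open>D\<close>-ball around \<open>z\<close> and has length linear in \<open>D\<close>, so
  \<open>gp2\<close> of its ends seen from \<open>z\<close> is at least \<open>2 * D\<close> up to a
  logarithmic loss; but \<open>z\<close> lies between these ends, where \<open>gp2\<close> is
  0.\<close>

lemma geodesic_near_T_geodesic:
  "\<exists>H. \<forall>x\<in>carrier G. \<forall>y\<in>carrier G. \<forall>p q. T.geodesic p x y \<longrightarrow> geodesic q x y \<longrightarrow>
    (\<forall>i\<le>dst x y. \<exists>j\<le>T.dst x y. dst (q i) (p j) \<le> H)"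
proof -
  obtain M :: nat where M: "\<Delta> < real M" using reals_Archimedean2 by blast
  have M0: "M > 0" using M \<Delta>_nonneg by (cases M) auto
  obtain k0 where k0: "\<forall>k\<ge>k0. 6 * A * M * (k + 1) + 2 \<le> (2::nat) ^ k"
    using exists_pow2_ge_affine[of "6 * A * M"] by blast
  \<comment> \<open>Beyond this bound both \<open>A < D\<close> and \<open>k0 \<le> D div M\<close>
    hold, as the final contradiction requires.\<close>
  define H where "H = A + M * k0"
  have "\<exists>j\<le>T.dst x y. dst (q i) (p j) \<le> H"
    if c: "x \<in> carrier G" "y \<in> carrier G" and p: "T.geodesic p x y" and q: "geodesic q x y" and i: "i \<le> dst x y"
    for x y p q i
  proof -
    note gp = T.geodesicD[OF p] and gq = geodesicD[OF q]
    define n where "n = dst x y"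
    define m where "m = T.dst x y"
    define near where "near i = Min ((\<lambda>j. dst (q i) (p j)) ` {..m})" for i
    have near_ex: "\<exists>j\<le>m. dst (q i) (p j) = near i" for i
    proof -
      have "near i \<in> (\<lambda>j. dst (q i) (p j)) ` {..m}" unfolding near_def by (rule Min_in) auto
      then show ?thesis by auto
    qed
    have near_le: "near i \<le> dst (q i) (p j)" if "j \<le> m" for i j
      unfolding near_def by (rule Min_le) (use that in auto)
    define D where "D = Max (near ` {..n})"
    have "D \<in> near ` {..n}" unfolding D_def by (rule Max_in) auto
    then obtain i0 where i0: "i0 \<le> n" "near i0 = D" by auto
    have D_ge: "near i \<le> D" if "i \<le> n" for i unfolding D_def by (rule Max_ge) (use that in auto)
    define z where "z = q i0"
    have zc: "z \<in> carrier G" using gq(3) i0 by (simp add: z_def n_def)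
    have far: "D \<le> dst z (p j)" if "j \<le> m" for j using near_le[OF that, of i0] i0 by (simp add: z_def)
    have pc: "p j \<in> carrier G" if "j \<le> m" for j using gp(3) that by (simp add: m_def)
    have qc: "q j \<in> carrier G" if "j \<le> n" for j using gq(3) that by (simp add: n_def)
    have qd: "d (q a) (q b) = \<bar>real a - real b\<bar>" if "a \<le> n" "b \<le> n" for a b
    proof (cases "a \<le> b")
      case True
      then show ?thesis using gq(4)[of a b] that by (simp add: n_def)
    next
      case False
      then show ?thesis using gq(4)[of b a] that dst_commute[OF qc[of a] qc[of b]] by (simp add: n_def)
    qed
    have end_exists: "\<exists>j\<le>m. dst (q a) (p j) \<le> D \<and> 2 * real D \<le> gp2 (q a) (p j) z"
      if a: "a \<le> n" and alt: "\<bar>real a - real i0\<bar> = 2 * real D \<or> (\<exists>j\<le>m. q a = p j)" for a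
      using alt
    proof
      assume 2: "\<bar>real a - real i0\<bar> = 2 * real D"
      obtain j where j: "j \<le> m" "dst (q a) (p j) = near a" using near_ex by blast
      have "dst (q a) (p j) \<le> D" using j D_ge[OF a] by simp
      moreover have "d (q a) z = 2 * real D" using qd[OF a i0(1)] 2 by (simp add: z_def)
      moreover have "D \<le> dst (p j) z" using far[OF j(1)] dst_commute[OF zc pc[OF j(1)]] by simp
      ultimately show ?thesis using j(1) by (intro exI[of _ j]) (simp add: gp2_def)
    next
      assume "\<exists>j\<le>m. q a = p j"
      then obtain j where j: "j \<le> m" "q a = p j" by blast
      have "D \<le> dst (p j) z" using far[OF j(1)] dst_commute[OF zc pc[OF j(1)]] by simp
      then show ?thesis using j pc[OF j(1)] by (intro exI[of _ j]) (simp add: gp2_def)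
    qed
    \<comment> \<open>Truncated subtraction here and \<open>min\<close> below: near an end of
      \<open>q\<close> the walk stops at the end point, which lies on \<open>p\<close>
      itself.\<close>
    define a where "a = i0 - 2 * D"
    define b where "b = min n (i0 + 2 * D)"
    have ab: "a \<le> n" "b \<le> n" "a \<le> i0" "i0 \<le> b" "b - a \<le> 4 * D" using i0 by (auto simp: a_def b_def)
    have alt_a: "\<bar>real a - real i0\<bar> = 2 * real D \<or> (\<exists>j\<le>m. q a = p j)"
    proof (cases "2 * D \<le> i0")
      case False
      then have "q a = p 0" using gp(1) gq(1) by (simp add: a_def)
      then show ?thesis by blast
    qed (simp add: a_def of_nat_diff)
    have alt_b: "\<bar>real b - real i0\<bar> = 2 * real D \<or> (\<exists>j\<le>m. q b = p j)"
    proof (cases "i0 + 2 * D \<le> n")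
      case False
      then have "q b = p m" using gp(2) gq(2) by (simp add: b_def n_def m_def)
      then show ?thesis by blast
    qed (simp add: b_def)
    obtain j1 where j1: "j1 \<le> m" "dst (q a) (p j1) \<le> D" "2 * real D \<le> gp2 (q a) (p j1) z"
      using end_exists[OF ab(1) alt_a] by blast
    obtain j2 where j2: "j2 \<le> m" "dst (q b) (p j2) \<le> D" "2 * real D \<le> gp2 (q b) (p j2) z"
      using end_exists[OF ab(2) alt_b] by blast
    have between: "gp2 (q a) (q b) z = 0"
      using qd[OF ab(1) i0(1)] qd[OF ab(2) i0(1)] qd[OF ab(1,2)] ab by (simp add: gp2_def z_def)
    \<comment> \<open>At most \<open>D + 4 * D + D\<close> in the metric of \<open>S\<close>, hence
      \<open>6 * A * D\<close> for \<open>T\<close>. Both orders are covered since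
      \<open>j1 \<le> j2\<close> is not known and \<open>T.dst\<close> may be asymmetric.\<close>
    have gap: "T.dst (p i) (p j) \<le> 6 * A * D" if "i = j1 \<and> j = j2 \<or> i = j2 \<and> j = j1" for i j
    proof -
      have "dst (p j1) (p j2) \<le> dst (p j1) (q a) + (dst (q a) (q b) + dst (q b) (p j2))"
        using dst_triangle[of "p j1" "q a" "p j2"] dst_triangle[of "q a" "q b" "p j2"]
          pc[OF j1(1)] pc[OF j2(1)] qc[OF ab(1)] qc[OF ab(2)] by linarith
      moreover have "dst (p j1) (q a) = dst (q a) (p j1)" using dst_commute pc[OF j1(1)] qc[OF ab(1)] by simp
      moreover have "dst (q a) (q b) = b - a" using gq(4)[of a b] ab by (simp add: n_def)
      ultimately have "dst (p j1) (p j2) \<le> 6 * D" using j1(2) j2(2) ab(5) by linarith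
      then have "dst (p i) (p j) \<le> 6 * D" using that dst_commute[OF pc[OF j1(1)] pc[OF j2(1)]] by auto
      then have "A * dst (p i) (p j) \<le> A * (6 * D)" by (rule mult_le_mono2)
      moreover have "T.dst (p i) (p j) \<le> A * dst (p i) (p j)"
        using that pc j1(1) j2(1) by (intro T_le_dst) auto
      moreover have "A * (6 * D) = 6 * A * D" by simp
      ultimately show ?thesis by linarith
    qed
    have bound: "2 * real D - real A - real k * \<Delta> \<le> 0" if k: "6 * A * D + 2 \<le> 2 ^ k" for k
    proof (cases "j1 \<le> j2")
      case True
      have "T.dst (p j1) (p j2) = j2 - j1" using gp(4)[of j1 j2] True j2(1) by (simp add: m_def)
      then have "j2 - j1 + 2 \<le> 2 ^ k" using gap[of j1 j2] k by simp
      then have "2 * real D - real A - real k * \<Delta> \<le> gp2 (q a) (q b) z"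
        using True j1 j2 far qc ab zc gp2_commute[OF qc[OF ab(2)] pc[OF j2(1)], of z]
        by (intro gp2_along_T_geodesic[OF p, of j1 j2]) (auto simp: m_def)
      then show ?thesis by (simp add: between)
    next
      case False
      have "T.dst (p j2) (p j1) = j1 - j2" using gp(4)[of j2 j1] False j1(1) by (simp add: m_def)
      then have "j1 - j2 + 2 \<le> 2 ^ k" using gap[of j2 j1] k by simp
      then have "2 * real D - real A - real k * \<Delta> \<le> gp2 (q b) (q a) z"
        using False j1 j2 far qc ab zc gp2_commute[OF qc[OF ab(1)] pc[OF j1(1)], of z]
        by (intro gp2_along_T_geodesic[OF p, of j2 j1]) (auto simp: m_def)
      then show ?thesis using between gp2_commute[OF qc[OF ab(1)] qc[OF ab(2)], of z] by simp
    qed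
    have "D \<le> H"
    proof (rule ccontr)
      assume "\<not> D \<le> H"
      then have D: "A < D" "M * k0 < D" by (auto simp: H_def)
      \<comment> \<open>Then \<open>k * \<Delta> \<le> k * M \<le> D\<close>, while
        \<open>2 ^ k\<close> still covers the detour of length \<open>6 * A * D + 2\<close>; with
        \<open>A < D\<close> this contradicts \<open>2 * D \<le> A + k * \<Delta>\<close>.\<close>
      define k where "k = D div M"
      have k: "k0 \<le> k" using D(2) M0 by (simp add: k_def less_eq_div_iff_mult_less_eq mult.commute)
      have "D < M * (k + 1)" using M0 by (simp add: k_def dividend_less_times_div)
      then have "6 * A * D \<le> 6 * A * (M * (k + 1))" by (intro mult_le_mono2) simp
      moreover have "6 * A * (M * (k + 1)) = 6 * A * M * (k + 1)" by (simp add: algebra_simps)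
      ultimately have "6 * A * D + 2 \<le> 2 ^ k" using k0[rule_format, OF k] by linarith
      from bound[OF this] have b: "2 * real D \<le> real A + real k * \<Delta>" by simp
      have "real k * \<Delta> \<le> real k * real M" using M by (intro mult_left_mono) auto
      also have "\<dots> \<le> real D"
        using div_times_less_eq_dividend[of D M] by (simp add: k_def flip: of_nat_mult)
      finally show False using b D(1) by linarith
    qed
    then have "near i \<le> H" using D_ge[of i] i by (simp add: n_def)
    then show ?thesis using near_ex[of i] unfolding m_def by metis
  qed
  then show ?thesis by blast
qed

text \<open>The Morse lemma only keeps \<open>q\<close> near \<open>p\<close>. Conversely, moving
  along \<open>q\<close> one passes from the part of \<open>p\<close> before \<open>l\<close> to the
  part after \<open>l\<close>; at the switch \<open>p l\<close> is enclosed between two points of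
  \<open>p\<close> that are close to each other.\<close>

lemma T_geodesic_almost_between:
  "\<exists>\<kappa>. \<forall>x\<in>carrier G. \<forall>y\<in>carrier G. \<forall>p. T.geodesic p x y \<longrightarrow>
    (\<forall>l\<le>T.dst x y. d x (p l) + d (p l) y \<le> d x y + \<kappa>)"
proof -
  obtain H where H: "\<forall>x\<in>carrier G. \<forall>y\<in>carrier G. \<forall>p q. T.geodesic p x y \<longrightarrow> geodesic q x y \<longrightarrow>
    (\<forall>i\<le>dst x y. \<exists>j\<le>T.dst x y. dst (q i) (p j) \<le> H)"
    using geodesic_near_T_geodesic by (elim exE)
  \<comment> \<open>\<open>H + 1\<close> to reach a point of \<open>p\<close> before
    \<open>l\<close>, from which \<open>p l\<close> is at most \<open>A * (2 * H + 1)\<close> steps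
    of \<open>T\<close> away, each of length at most \<open>A\<close>.\<close>
  define e where "e = H + 1 + A * (A * (2 * H + 1))"
  have "d x (p l) + d (p l) y \<le> d x y + 2 * real e"
    if c: "x \<in> carrier G" "y \<in> carrier G" and p: "T.geodesic p x y" and l: "l \<le> T.dst x y" for x y p l
  proof -
    obtain q where q: "geodesic q x y" using geodesic_exists c by blast
    note gp = T.geodesicD[OF p] and gq = geodesicD[OF q]
    define n where "n = dst x y"
    define m where "m = T.dst x y"
    have near: "\<exists>j\<le>m. dst (q i) (p j) \<le> H" if "i \<le> n" for i
      using H c p q that unfolding n_def m_def by blast
    have pc: "p j \<in> carrier G" if "j \<le> m" for j using gp(3) that by (simp add: m_def)
    have qc: "q j \<in> carrier G" if "j \<le> n" for j using gq(3) that by (simp add: n_def)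
    define Hi where "Hi i \<longleftrightarrow> (\<exists>j. l \<le> j \<and> j \<le> m \<and> dst (q i) (p j) \<le> H)" for i
    define Lo where "Lo i \<longleftrightarrow> (\<exists>j\<le>l. dst (q i) (p j) \<le> H)" for i
    have HiLo: "Hi i \<or> Lo i" if "i \<le> n" for i
      using near[OF that] unfolding Hi_def Lo_def by (meson nat_le_linear)
    have Hn: "Hi n" unfolding Hi_def
      using gp(2) gq(2) c l by (intro exI[of _ m]) (simp add: n_def m_def)
    have L0: "Lo 0" unfolding Lo_def
      using gp(1) gq(1) c by (intro exI[of _ 0]) simp
    define i where "i = (LEAST i. Hi i)"
    have Hi: "Hi i" unfolding i_def by (rule LeastI[of Hi]) (rule Hn)
    have i: "i \<le> n" unfolding i_def by (rule Least_le) (rule Hn)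
    have lm: "l \<le> m" using l by (simp add: m_def)
    have "\<exists>j\<le>l. dst (q i) (p j) \<le> H + 1"
    proof (cases i)
      case 0
      then show ?thesis using L0 unfolding Lo_def by fastforce
    next
      case (Suc k)
      then have "\<not> Hi k" unfolding i_def using not_less_Least[of k Hi] by simp
      then obtain j where j: "j \<le> l" "dst (q k) (p j) \<le> H" using HiLo[of k] i Suc unfolding Lo_def by auto
      have k: "k \<le> n" using i Suc by simp
      have "dst (q i) (p j) \<le> dst (q i) (q k) + dst (q k) (p j)"
        using qc[OF i] qc[OF k] pc[of j] j(1) lm by (intro dst_triangle) auto
      moreover have "dst (q i) (q k) = 1"
        using gq(4)[of k i] dst_commute[OF qc[OF i] qc[OF k]] i Suc by (simp add: n_def)
      ultimately show ?thesis using j by (intro exI[of _ j]) simp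
    qed
    then obtain j where j: "j \<le> l" "dst (q i) (p j) \<le> H + 1" by blast
    obtain j' where j': "l \<le> j'" "j' \<le> m" "dst (q i) (p j') \<le> H" using Hi unfolding Hi_def by blast
    have jm: "j \<le> m" using j lm by simp
    note cs = pc[OF jm] pc[OF j'(2)] pc[OF lm] qc[OF i]
    have "dst (p j) (p j') \<le> dst (p j) (q i) + dst (q i) (p j')" using cs by (intro dst_triangle)
    then have "dst (p j) (p j') \<le> 2 * H + 1" using j j' dst_commute[OF cs(1) cs(4)] by simp
    then have "A * dst (p j) (p j') \<le> A * (2 * H + 1)" by (rule mult_le_mono2)
    moreover have "T.dst (p j) (p j') \<le> A * dst (p j) (p j')" using cs by (intro T_le_dst)
    moreover have "T.dst (p j) (p j') = j' - j" using gp(4)[of j j'] j j' by (simp add: m_def)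
    moreover have "T.dst (p j) (p l) = l - j" using gp(4)[of j l] j lm by (simp add: m_def)
    ultimately have "T.dst (p j) (p l) \<le> A * (2 * H + 1)" using j'(1) by linarith
    then have "A * T.dst (p j) (p l) \<le> A * (A * (2 * H + 1))" by (rule mult_le_mono2)
    moreover have "dst (p j) (p l) \<le> A * T.dst (p j) (p l)" using cs by (intro dst_le_T)
    moreover have "dst (q i) (p l) \<le> dst (q i) (p j) + dst (p j) (p l)" using cs by (intro dst_triangle)
    ultimately have "dst (q i) (p l) \<le> e" using j(2) unfolding e_def by linarith
    moreover have "dst x (p l) \<le> dst x (q i) + dst (q i) (p l)" using cs c by (intro dst_triangle)
    moreover have "dst (p l) y \<le> dst (p l) (q i) + dst (q i) y" using cs c by (intro dst_triangle)
    moreover have "dst (p l) (q i) = dst (q i) (p l)" using cs dst_commute by simp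
    moreover have "dst x (q i) + dst (q i) y = dst x y" using gq(5)[of i] gq(6)[of i] i by (simp add: n_def)
    ultimately have "dst x (p l) + dst (p l) y \<le> dst x y + 2 * e" by linarith
    then show ?thesis by linarith
  qed
  then show ?thesis by blast
qed

lemma between_imp_almost_between:
  "\<exists>\<kappa>. \<forall>x\<in>carrier G. \<forall>y\<in>carrier G. \<forall>z\<in>carrier G. T.dst x z + T.dst z y = T.dst x y \<longrightarrow>
    d x z + d z y \<le> d x y + \<kappa>"
proof -
  obtain \<kappa> where \<kappa>: "\<forall>x\<in>carrier G. \<forall>y\<in>carrier G. \<forall>p. T.geodesic p x y \<longrightarrow>
    (\<forall>l\<le>T.dst x y. d x (p l) + d (p l) y \<le> d x y + \<kappa>)"
    using T_geodesic_almost_between by (elim exE)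
  have "d x z + d z y \<le> d x y + \<kappa>"
    if c: "x \<in> carrier G" "y \<in> carrier G" "z \<in> carrier G" and b: "T.dst x z + T.dst z y = T.dst x y" for x y z
  proof -
    obtain p where p: "T.geodesic p x y" "p (T.dst x z) = z"
      using T.geodesic_through[OF c b] by (elim exE conjE)
    have "d x (p (T.dst x z)) + d (p (T.dst x z)) y \<le> d x y + \<kappa>"
      using \<kappa> c p(1) b by (metis le_add1)
    then show ?thesis using p(2) by simp
  qed
  then show ?thesis by (intro exI[of _ \<kappa>]) simp
qed

text \<open>Distances from \<open>x\<close> grow by at most \<open>A\<close> per step, so the
  geodesic has a point about as far from \<open>x\<close> as \<open>z\<close>;
  \<open>almost_between_close\<close> puts it near \<open>z\<close>.\<close>

lemma T_geodesic_passes_near: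
  "\<exists>N. \<forall>x\<in>carrier G. \<forall>y\<in>carrier G. \<forall>z\<in>carrier G. d x z + d z y \<le> d x y + D \<longrightarrow>
    (\<forall>p. T.geodesic p x y \<longrightarrow> (\<exists>l\<le>T.dst x y. dst z (p l) \<le> N))"
proof -
  obtain \<kappa> where \<kappa>: "\<forall>x\<in>carrier G. \<forall>y\<in>carrier G. \<forall>p. T.geodesic p x y \<longrightarrow>
    (\<forall>l\<le>T.dst x y. d x (p l) + d (p l) y \<le> d x y + \<kappa>)"
    using T_geodesic_almost_between by (elim exE)
  define N where "N = nat \<lceil>max D \<kappa> + (real A + \<bar>D\<bar>) + \<Delta>\<rceil>"
  have "\<exists>l\<le>T.dst x y. dst z (p l) \<le> N"
    if c: "x \<in> carrier G" "y \<in> carrier G" "z \<in> carrier G" and b: "d x z + d z y \<le> d x y + D"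
      and p: "T.geodesic p x y" for x y z p
  proof -
    note gp = T.geodesicD[OF p]
    define m where "m = T.dst x y"
    have pc: "p j \<in> carrier G" if "j \<le> m" for j using gp(3) that by (simp add: m_def)
    \<comment> \<open>The minimum guards against \<open>z\<close> being farther from
      \<open>x\<close> than \<open>y\<close>, a distance the geodesic need not reach; the
      discrepancy is at most \<open>|D|\<close>.\<close>
    define t where "t = min (dst x z) (dst x y)"
    define l where "l = (LEAST l. t \<le> dst x (p l))"
    have end_t: "t \<le> dst x (p m)" using gp(2) by (simp add: t_def m_def)
    have l: "t \<le> dst x (p l)" unfolding l_def by (rule LeastI[where P = "\<lambda>l. t \<le> dst x (p l)", OF end_t])
    have lm: "l \<le> m" unfolding l_def by (rule Least_le) (rule end_t)
    have upper: "dst x (p l) \<le> t + A"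
    proof (cases l)
      case 0
      then show ?thesis using gp(1) c by simp
    next
      case (Suc k)
      have "dst x (p k) < t" using not_less_Least[of k "\<lambda>l. t \<le> dst x (p l)"] Suc by (simp add: l_def)
      moreover have k: "k \<le> m" "p k \<in> carrier G" using Suc lm pc by auto
      moreover have "T.dst (p k) (p l) = 1" using gp(4)[of k l] Suc lm by (simp add: m_def)
      ultimately have "dst (p k) (p l) \<le> A" using dst_le_T[of "p k" "p l"] pc[OF lm] by simp
      moreover have "dst x (p l) \<le> dst x (p k) + dst (p k) (p l)" using c k pc[OF lm] by (intro dst_triangle)
      ultimately show ?thesis using \<open>dst x (p k) < t\<close> by linarith
    qed
    have tz: "\<bar>d x z - real t\<bar> \<le> \<bar>D\<bar>"
      unfolding t_def using b by (cases "dst x z \<le> dst x y") (simp_all add: min_def)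
    have "d z (p l) \<le> max D \<kappa> + (real A + \<bar>D\<bar>) + \<Delta>"
    proof (rule almost_between_close[OF c pc[OF lm] b])
      show "d x (p l) + d (p l) y \<le> d x y + \<kappa>" using \<kappa> c p lm unfolding m_def by blast
      show "\<bar>d x z - d x (p l)\<bar> \<le> real A + \<bar>D\<bar>" using tz l upper by linarith
    qed
    then have "dst z (p l) \<le> N" unfolding N_def by linarith
    then show ?thesis using lm unfolding m_def by blast
  qed
  then show ?thesis by (intro exI[of _ N]) simp
qed

end

end

section \<open>Concatenation in non-elementary groups\<close>

lemma (in group) elementary_group_if_finite_index_cyclic:
  assumes "a \<in> carrier G" "finite (rcosets generate G {a})"
  shows "elementary_group G"
  unfolding elementary_group_def
proof (intro exI conjI)
  show "subgroup (generate G {a}) G" using assms by (intro generate_is_subgroup) simp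
  have "subgroup_generated G {a} = G\<lparr>carrier := generate G {a}\<rparr>"
    using assms(1) by (simp add: subgroup_generated_def)
  then show "cyclic_group (G\<lparr>carrier := generate G {a}\<rparr>)"
    using cyclic_group_generated[of a] by simp
qed (rule assms(2))

lemma (in group) finite_imp_elementary_group:
  assumes "finite (carrier G)"
  shows "elementary_group G"
proof (rule elementary_group_if_finite_index_cyclic[OF one_closed])
  have "rcosets generate G {\<one>} \<subseteq> Pow (carrier G)"
    using rcosets_subset_PowG[OF generate_is_subgroup[of "{\<one>}"]] by simp
  then show "finite (rcosets generate G {\<one>})" using assms by (simp add: finite_subset)
qed

text \<open>The lower step bound makes the sequence reach \<open>s\<close> within \<open>m\<close>
  steps, the upper one limits the overshoot. It will select a power with prescribed approximate
  translation.\<close>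

lemma discrete_intermediate_value:
  fixes x :: "nat \<Rightarrow> real"
  assumes "x 0 = 0" "0 \<le> B" and step: "\<And>k. k < m \<Longrightarrow> x k + 1 \<le> x (Suc k) \<and> x (Suc k) \<le> x k + B"
    and s: "0 \<le> s" "s \<le> real m"
  shows "\<exists>k\<le>m. \<bar>x k - s\<bar> \<le> B"
proof -
  have ge: "k \<le> m \<Longrightarrow> real k \<le> x k" for k
  proof (induction k)
    case (Suc k)
    then show ?case using step[of k] by simp
  qed (simp add: assms(1))
  define k where "k = (LEAST k. s \<le> x k)"
  have m: "s \<le> x m" using ge[of m] s by simp
  have k: "s \<le> x k" unfolding k_def by (rule LeastI[where P = "\<lambda>k. s \<le> x k", OF m])
  have km: "k \<le> m" unfolding k_def by (rule Least_le) (rule m)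
  have "x k \<le> s + B"
  proof (cases k)
    case 0
    then show ?thesis using assms by simp
  next
    case (Suc j)
    have "x j < s" using not_less_Least[of j "\<lambda>k. s \<le> x k"] Suc by (simp add: k_def)
    then show ?thesis using step[of j] km Suc by simp
  qed
  then show ?thesis using k km by (intro exI[of _ k]) simp
qed

context hyperbolic_group
begin

lemma len_nat_pow_le: "c \<in> carrier G \<Longrightarrow> len (c [^] (k::nat)) \<le> k * len c"
proof (induction k)
  case (Suc k)
  have "len (c [^] Suc k) \<le> len (c [^] k) + len c" using Suc.prems len_mult by simp
  then show ?case using Suc by simp
qed simp

section \<open>Short elements that all nearly preserve one direction\<close>

context
  fixes h :: 'a and R t :: nat and D :: real
  assumes h: "h \<in> carrier G"
    and bad: "\<forall>a\<in>carrier G. len a \<le> R \<longrightarrow> D \<le> gp2 h (a \<otimes> h) \<one>"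
    and t: "2 * real R + \<Delta> < 2 * real t" and D: "2 * (real t + real R) + \<Delta> < D"
begin

text \<open>The common direction \<open>h\<close> makes the Busemann function \<open>\<tau>\<close> a quasimorphism on the ball of
  radius \<open>R\<close>; elements of this ball act on \<open>h\<close> almost as translations along a common axis.\<close>

definition \<tau> :: "'a \<Rightarrow> real" where "\<tau> a = real (len (a \<otimes> h)) - real (len h)"

lemma d_one: "x \<in> carrier G \<Longrightarrow> d \<one> x = real (len x)"
  by (simp add: dst_one_left)

lemma d_inv_left:
  assumes "a \<in> carrier G" "x \<in> carrier G"
  shows "d (inv a) x = real (len (a \<otimes> x))"
  using assms by (simp add: dst_def)

lemma d_translate:
  assumes "a \<in> carrier G" "len a \<le> R"
  shows "d h (a \<otimes> h) \<le> real (len h) + real (len (a \<otimes> h)) - D"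
  using bad[rule_format, OF assms] assms h dst_commute[of h \<one>] dst_commute[of "a \<otimes> h" \<one>]
  by (simp add: gp2_def d_one)

lemma \<tau>_one: "\<tau> \<one> = 0" using h by (simp add: \<tau>_def)

lemma \<tau>_abs_le: "a \<in> carrier G \<Longrightarrow> \<bar>\<tau> a\<bar> \<le> real (len a)"
  using len_mult[of a h] len_mult[of "inv a" "a \<otimes> h"] len_inv[of a] h
  by (simp add: \<tau>_def m_assoc[symmetric])

text \<open>In both four-point instances for \<open>inv a\<close>, \<open>\<one>\<close>,
  \<open>h\<close> and \<open>b \<otimes> h\<close> the term containing the distance of
  \<open>h\<close> and \<open>b \<otimes> h\<close> cannot be the maximum: these two points share a
  long initial segment, which lowers it by \<open>D\<close>, and the triangle inequality makes up
  for at most \<open>2 * R\<close>.\<close>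

lemma \<tau>_mult:
  assumes a: "a \<in> carrier G" "len a \<le> R" and b: "b \<in> carrier G" "len b \<le> R"
  shows "\<bar>\<tau> (a \<otimes> b) - \<tau> a - \<tau> b\<bar> \<le> \<Delta>"
proof -
  have c: "inv a \<in> carrier G" "b \<otimes> h \<in> carrier G" using a b h by auto
  have 1: "d (inv a) (b \<otimes> h) = real (len (a \<otimes> b \<otimes> h))" using a b h by (simp add: d_inv_left m_assoc)
  have 2: "d (inv a) h = real (len (a \<otimes> h))" using a h by (simp add: d_inv_left)
  have 3: "d (inv a) \<one> = real (len a)" using a by (simp add: d_inv_left)
  have 4: "d h \<one> = real (len h)" "d (b \<otimes> h) \<one> = real (len (b \<otimes> h))" "d \<one> h = real (len h)"
    "d \<one> (b \<otimes> h) = real (len (b \<otimes> h))"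
    using dst_commute[of h \<one>] dst_commute[of "b \<otimes> h" \<one>] c h by (auto simp: d_one)
  note 5 = d_translate[OF b]
  have 6: "d (b \<otimes> h) h = d h (b \<otimes> h)" using dst_commute c h by simp
  have fp1: "d (inv a) (b \<otimes> h) + d \<one> h \<le> max (d (inv a) \<one> + d (b \<otimes> h) h) (d (inv a) h + d \<one> (b \<otimes> h)) + \<Delta>"
    using four_point[of "inv a" \<one> "b \<otimes> h" h] c h by simp
  have fp2: "d (inv a) h + d \<one> (b \<otimes> h) \<le> max (d (inv a) \<one> + d h (b \<otimes> h)) (d (inv a) (b \<otimes> h) + d \<one> h) + \<Delta>"
    using four_point[of "inv a" \<one> h "b \<otimes> h"] c h by simp
  have tri: "real (len (b \<otimes> h)) \<le> real (len a) + real (len (a \<otimes> b \<otimes> h))" "real (len h) \<le> real (len a) + real (len (a \<otimes> h))"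
    using d_triangle[of \<one> "inv a" "b \<otimes> h"] d_triangle[of \<one> "inv a" h] c h a 1 2 4 len_inv[of a] by (auto simp: d_one)
  have RD: "real (len a) \<le> real R" "2 * real R + \<Delta> < D"
    using a t D \<Delta>_nonneg of_nat_0_le_iff[of t, where ?'a = real] of_nat_0_le_iff[of R, where ?'a = real] by auto
  have "real (len (a \<otimes> b \<otimes> h)) + real (len h) \<le> real (len (a \<otimes> h)) + real (len (b \<otimes> h)) + \<Delta>"
    using fp1 tri(1) RD 5 unfolding 1 2 3 4 6 by linarith
  moreover have "real (len (a \<otimes> h)) + real (len (b \<otimes> h)) \<le> real (len (a \<otimes> b \<otimes> h)) + real (len h) + \<Delta>"
    using fp2 tri(2) RD 5 unfolding 1 2 3 4 by linarith
  ultimately show ?thesis unfolding \<tau>_def by linarith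
qed

text \<open>Let \<open>p\<close> be the point at height \<open>t\<close> on the way to
  \<open>h\<close>. If \<open>\<tau> a\<close> is small, \<open>a \<otimes> p\<close> is again
  almost between \<open>\<one>\<close> and \<open>h\<close> at almost the same height, hence within
  \<open>e + 4 * \<Delta>\<close> of \<open>p\<close>. It matters that the resulting bound is
  independent of \<open>R\<close>.\<close>

lemma few_small_translations:
  "card {a \<in> carrier G. len a \<le> R \<and> \<bar>\<tau> a\<bar> \<le> e} \<le> card {g \<in> carrier G. len g \<le> nat \<lfloor>e + 4 * \<Delta>\<rfloor>}"
proof -
  have "D \<le> 2 * real (len h)"
    using bad[rule_format, of \<one>] h dst_commute[of h \<one>] by (simp add: gp2_def d_one)
  then have "real t \<le> real (len h)" using D \<Delta>_nonneg of_nat_0_le_iff[of R, where ?'a = real] by argo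
  then have th: "t \<le> len h" by simp
  obtain p b where p: "p \<in> carrier G" "b \<in> carrier G" "h = p \<otimes> b" "len p = t" "len b = len h - t"
    using len_split[OF h th] by blast
  have dph: "d p h = real (len h) - real t" using p th by (simp add: dst_right_mult of_nat_diff)
  have close: "dst p (a \<otimes> p) \<le> nat \<lfloor>e + 4 * \<Delta>\<rfloor>" if a: "a \<in> carrier G" "len a \<le> R" "\<bar>\<tau> a\<bar> \<le> e" for a
  proof -
    have c: "inv a \<in> carrier G" "a \<otimes> p \<in> carrier G" "a \<otimes> h \<in> carrier G" using a p h by auto
    have 1: "d (inv a) p = real (len (a \<otimes> p))" "d (inv a) h = real (len (a \<otimes> h))" "d (inv a) \<one> = real (len a)"
      using a p(1) h by (auto simp: d_inv_left)
    have 2: "d \<one> p = real t" "d \<one> h = real (len h)" "d \<one> (a \<otimes> p) = real (len (a \<otimes> p))" "d \<one> (a \<otimes> h) = real (len (a \<otimes> h))"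
      using p(1,4) h c by (auto simp: d_one)
    have 3: "d (a \<otimes> p) (a \<otimes> h) = d p h" using dst_left_mult a p(1) h by simp
    have fp1: "d \<one> h + d (inv a) p \<le> max (d \<one> (inv a) + d h p) (d \<one> p + d (inv a) h) + \<Delta>"
      using four_point[of \<one> "inv a" h p] c h p(1) by simp
    have sw: "d \<one> (inv a) = d (inv a) \<one>" "d h p = d p h" "d (a \<otimes> h) h = d h (a \<otimes> h)" "d (a \<otimes> p) \<one> = d \<one> (a \<otimes> p)"
      using dst_commute c p(1) h by auto
    have tri1: "d \<one> p \<le> d \<one> (inv a) + d (inv a) p" "d (inv a) h \<le> d (inv a) p + d p h"
      "d \<one> (a \<otimes> p) \<le> real (len a) + real t"
      using d_triangle[of \<one> "inv a" p] d_triangle[of "inv a" p h] len_mult[of a p] c h p(1,4) a(1) 2(3) by auto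
    have aR: "real (len a) \<le> real R" using a by simp
    have up: "real (len (a \<otimes> p)) \<le> real t + \<tau> a + \<Delta>"
      using fp1 tri1(1) aR t unfolding \<tau>_def sw 1 2 dph by linarith
    have lo: "real t + \<tau> a \<le> real (len (a \<otimes> p))"
      using tri1(2) unfolding \<tau>_def 1 dph by linarith
    have fp2: "d (a \<otimes> p) h + d \<one> (a \<otimes> h) \<le> max (d (a \<otimes> p) \<one> + d h (a \<otimes> h)) (d (a \<otimes> p) (a \<otimes> h) + d \<one> h) + \<Delta>"
      using four_point[of "a \<otimes> p" \<one> h "a \<otimes> h"] c h by simp
    have tri2: "d \<one> h \<le> d \<one> (a \<otimes> p) + d (a \<otimes> p) h" using d_triangle c h by simp
    have "d (a \<otimes> p) h \<le> real (len h) - real t - \<tau> a + \<Delta>"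
    proof -
      have "d (a \<otimes> p) h + d \<one> (a \<otimes> h) \<le> d (a \<otimes> p) \<one> + d h (a \<otimes> h) + \<Delta> \<or>
          d (a \<otimes> p) h + d \<one> (a \<otimes> h) \<le> d (a \<otimes> p) (a \<otimes> h) + d \<one> h + \<Delta>"
        using fp2 by (auto simp: max_def split: if_splits)
      then show ?thesis
        using tri2 tri1(3) aR D d_translate[OF a(1,2)] unfolding \<tau>_def 3 sw 2 dph by argo
    qed
    then have between: "d \<one> (a \<otimes> p) + d (a \<otimes> p) h \<le> d \<one> h + 2 * \<Delta>" using up unfolding 2 by linarith
    have "d p (a \<otimes> p) \<le> max 0 (2 * \<Delta>) + (e + \<Delta>) + \<Delta>"
    proof (rule almost_between_close[OF one_closed h p(1) c(2) _ between])
      show "d \<one> p + d p h \<le> d \<one> h + 0" unfolding 2 dph by simp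
      show "\<bar>d \<one> p - d \<one> (a \<otimes> p)\<bar> \<le> e + \<Delta>" using up lo a(3) \<Delta>_nonneg unfolding 2 by linarith
    qed
    then have "d p (a \<otimes> p) \<le> e + 4 * \<Delta>" using \<Delta>_nonneg by simp
    then show ?thesis by linarith
  qed
  have "card {a \<in> carrier G. len a \<le> R \<and> \<bar>\<tau> a\<bar> \<le> e} \<le> card {x \<in> carrier G. dst p x \<le> nat \<lfloor>e + 4 * \<Delta>\<rfloor>}"
  proof (rule card_inj_on_le)
    show "inj_on (\<lambda>a. a \<otimes> p) {a \<in> carrier G. len a \<le> R \<and> \<bar>\<tau> a\<bar> \<le> e}"
      using p(1) by (intro inj_onI) simp
    show "(\<lambda>a. a \<otimes> p) ` {a \<in> carrier G. len a \<le> R \<and> \<bar>\<tau> a\<bar> \<le> e} \<subseteq> {x \<in> carrier G. dst p x \<le> nat \<lfloor>e + 4 * \<Delta>\<rfloor>}"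
      using close p(1) by auto
  qed (rule card_dst_ball(2)[OF p(1)])
  also have "\<dots> \<le> card {g \<in> carrier G. len g \<le> nat \<lfloor>e + 4 * \<Delta>\<rfloor>}" by (rule card_dst_ball(3)[OF p(1)])
  finally show ?thesis .
qed

text \<open>Powers of \<open>a\<close> or of its inverse change \<open>\<tau>\<close> in steps that
  are bounded and bounded away from 0, so one of them cancels \<open>\<tau> (inv g)\<close> up to a
  constant. The condition on \<open>R\<close> keeps all elements inside the ball where
  \<open>\<tau>\<close> is nearly additive.\<close>

lemma translate_back:
  assumes a: "a \<in> carrier G" "len a \<le> r" "4 * \<Delta> + 1 < \<bar>\<tau> a\<bar>"
    and g: "g \<in> carrier G" "len g \<le> m" and R: "r * Suc m + m \<le> R"
  shows "\<exists>z\<in>generate G {a}. inv g \<otimes> z \<in> carrier G \<and> len (inv g \<otimes> z) \<le> R \<and> \<bar>\<tau> (inv g \<otimes> z)\<bar> \<le> real r + 3 * \<Delta>"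
proof -
  have sub: "subgroup (generate G {a}) G" using a by (intro generate_is_subgroup) simp
  have rR: "r \<le> R" "m \<le> R" "r * m + m \<le> R" using R by auto
  have ai: "inv a \<in> carrier G" "len (inv a) \<le> r" using a len_inv by auto
  have "\<bar>\<tau> (a \<otimes> inv a) - \<tau> a - \<tau> (inv a)\<bar> \<le> \<Delta>" using a ai rR by (intro \<tau>_mult) auto
  then have opp: "\<bar>\<tau> a + \<tau> (inv a)\<bar> \<le> \<Delta>" using a \<tau>_one by simp
  define s where "s = \<tau> (inv g)"
  have s: "\<bar>s\<bar> \<le> real m" using \<tau>_abs_le[of "inv g"] g len_inv[of g] by (simp add: s_def)
  \<comment> \<open>The direction in which \<open>\<tau>\<close> has to move to cancel
    \<open>s\<close>; \<open>a\<close> and \<open>inv a\<close> have nearly opposite values, so one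
    of them moves that way by more than \<open>3 * \<Delta> + 1\<close>.\<close>
  define \<sigma> :: real where "\<sigma> = (if s \<le> 0 then 1 else - 1)"
  have \<sigma>: "\<bar>\<sigma>\<bar> = 1" "\<sigma> * \<sigma> = 1" "\<sigma> * s = - \<bar>s\<bar>" by (auto simp: \<sigma>_def)
  have "\<exists>c\<in>{a, inv a}. 3 * \<Delta> + 1 < \<sigma> * \<tau> c"
    using opp a(3) unfolding \<sigma>_def by (cases "\<tau> a \<ge> 0") (auto split: if_splits)
  then obtain c where c: "c \<in> {a, inv a}" "3 * \<Delta> + 1 < \<sigma> * \<tau> c" by blast
  have cc: "c \<in> carrier G" "len c \<le> r" "c \<in> generate G {a}"
    using c a ai by (auto intro: generate.incl generate.inv)
  have pow_gen: "c [^] k \<in> generate G {a}" for k :: nat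
    by (induction k) (auto intro: subgroup.one_closed[OF sub] subgroup.m_closed[OF sub] cc(3))
  have pow_len: "len (c [^] k) \<le> r * k" for k :: nat
    using order_trans[OF len_nat_pow_le[OF cc(1), of k] mult_le_mono2[OF cc(2), of k]] by (simp add: mult.commute)
  have pow_R: "len (c [^] k) \<le> r * m" if "k \<le> m" for k :: nat
    using pow_len[of k] mult_le_mono2[OF that, of r] by linarith
  have c\<tau>: "\<bar>\<tau> c\<bar> \<le> real r" using \<tau>_abs_le[OF cc(1)] cc(2) by linarith
  have "\<exists>k\<le>m. \<bar>\<sigma> * \<tau> (c [^] k) - \<bar>s\<bar>\<bar> \<le> real r + \<Delta>"
  proof (rule discrete_intermediate_value)
    show "\<sigma> * \<tau> (c [^] (0::nat)) = 0" using \<tau>_one by simp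
    fix k assume k: "k < m"
    have "\<bar>\<tau> (c [^] k \<otimes> c) - \<tau> (c [^] k) - \<tau> c\<bar> \<le> \<Delta>"
      using pow_R[of k] k rR cc by (intro \<tau>_mult) auto
    then have "\<bar>\<sigma> * (\<tau> (c [^] Suc k) - \<tau> (c [^] k) - \<tau> c)\<bar> \<le> \<Delta>" using \<sigma>(1) by (simp add: abs_mult)
    then have "\<bar>\<sigma> * \<tau> (c [^] Suc k) - \<sigma> * \<tau> (c [^] k) - \<sigma> * \<tau> c\<bar> \<le> \<Delta>" by (simp only: right_diff_distrib)
    moreover have "\<sigma> * \<tau> c \<le> real r" using c\<tau> \<sigma>(1) abs_ge_self[of "\<sigma> * \<tau> c"] by (simp add: abs_mult)
    ultimately show "\<sigma> * \<tau> (c [^] k) + 1 \<le> \<sigma> * \<tau> (c [^] Suc k) \<and> \<sigma> * \<tau> (c [^] Suc k) \<le> \<sigma> * \<tau> (c [^] k) + (real r + \<Delta>)"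
      using c(2) \<Delta>_nonneg by linarith
  qed (use s \<Delta>_nonneg in auto)
  then obtain k where k: "k \<le> m" "\<bar>\<sigma> * \<tau> (c [^] k) - \<bar>s\<bar>\<bar> \<le> real r + \<Delta>" by blast
  have "\<bar>\<sigma> * (\<tau> (c [^] k) + s)\<bar> \<le> real r + \<Delta>" using k(2) \<sigma>(3) by (simp add: distrib_left)
  then have 1: "\<bar>\<tau> (c [^] k) + s\<bar> \<le> real r + \<Delta>" using \<sigma>(1) by (simp add: abs_mult)
  have "\<bar>\<tau> (inv g \<otimes> c [^] k) - \<tau> (inv g) - \<tau> (c [^] k)\<bar> \<le> \<Delta>"
    using g len_inv[OF g(1)] pow_R[OF k(1)] rR cc(1) by (intro \<tau>_mult) auto
  then have "\<bar>\<tau> (inv g \<otimes> c [^] k)\<bar> \<le> real r + 3 * \<Delta>" using 1 \<Delta>_nonneg unfolding s_def by linarith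
  moreover have "len (inv g \<otimes> c [^] k) \<le> R"
    using len_mult[of "inv g" "c [^] k"] len_inv[OF g(1)] g pow_R[OF k(1)] rR(3) cc(1) by simp
  ultimately show ?thesis using pow_gen cc(1) g(1) by (intro bexI[of _ "c [^] k"]) auto
qed

end

text \<open>Otherwise arbitrarily large balls nearly preserve some direction \<open>h\<close>. A
  ball of radius \<open>r\<close> with more elements than can have small translation contains some
  \<open>a\<close> with large \<open>\<tau>\<close>. Its cyclic subgroup has infinitely many cosets,
  and \<open>translate_back\<close> moves more than \<open>M\<close> representatives injectively
  into the at most \<open>M\<close> elements of small translation. Since \<open>\<tau>\<close>
  depends on \<open>h\<close>, the constants and the representatives \<open>F\<close> are fixed for
  all candidates \<open>a\<close> before \<open>h\<close> is known.\<close>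

lemma exists_avoiding_translation_self:
  assumes ne: "\<not> elementary_group G"
  shows "\<exists>R D. \<forall>h\<in>carrier G. \<exists>a\<in>carrier G. len a \<le> R \<and> gp2 h (a \<otimes> h) \<one> < D"
proof (rule ccontr)
  assume "\<not> ?thesis"
  then have all_bad: "\<exists>h\<in>carrier G. \<forall>a\<in>carrier G. len a \<le> R \<longrightarrow> D \<le> gp2 h (a \<otimes> h) \<one>" for R D
    by (meson not_less)
  have inf: "infinite (carrier G)" using ne finite_imp_elementary_group by blast
  define \<beta> where "\<beta> n = card {g \<in> carrier G. len g \<le> n}" for n
  define E where "E = nat \<lfloor>4 * \<Delta> + 1 + 4 * \<Delta>\<rfloor>"
  have "\<exists>r. \<beta> E < \<beta> r"
  proof -
    obtain F where F: "F \<subseteq> carrier G" "finite F" "card F = Suc (\<beta> E)"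
      using infinite_arbitrarily_large[OF inf] by blast
    define r where "r = Max (insert 0 (len ` F))"
    have "F \<subseteq> {g \<in> carrier G. len g \<le> r}" using F by (auto simp: r_def)
    then have "card F \<le> \<beta> r" unfolding \<beta>_def by (rule card_mono[OF finite_ball])
    then show ?thesis using F by (intro exI[of _ r]) simp
  qed
  then obtain r where r: "\<beta> E < \<beta> r" by blast
  define M where "M = \<beta> (nat \<lfloor>real r + 3 * \<Delta> + 4 * \<Delta>\<rfloor>)"
  define B where "B = {a \<in> carrier G. len a \<le> r}"
  have finB: "finite B" unfolding B_def by (rule finite_ball)
  have "\<exists>F. F \<subseteq> carrier G \<and> finite F \<and> card F = Suc M \<and> (\<forall>x\<in>F. \<forall>y\<in>F. generate G {a} #> x = generate G {a} #> y \<longrightarrow> x = y)"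
    if a: "a \<in> B" for a
  proof -
    have "infinite (rcosets generate G {a})"
      using ne elementary_group_if_finite_index_cyclic[of a] a by (auto simp: B_def)
    then obtain C where C: "C \<subseteq> rcosets generate G {a}" "finite C" "card C = Suc M"
      using infinite_arbitrarily_large by blast
    have "\<forall>X\<in>C. \<exists>x\<in>carrier G. X = generate G {a} #> x" using C(1) by (auto simp: RCOSETS_def)
    then obtain f where f: "\<And>X. X \<in> C \<Longrightarrow> f X \<in> carrier G \<and> X = generate G {a} #> f X" by metis
    have "inj_on f C" using f by (metis inj_onI)
    then have "card (f ` C) = Suc M" using C by (simp add: card_image)
    moreover have "x = y" if "x \<in> f ` C" "y \<in> f ` C" "generate G {a} #> x = generate G {a} #> y" for x y
      using that f by auto
    ultimately show ?thesis using f C(2) by (intro exI[of _ "f ` C"]) blast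
  qed
  then obtain F where F: "\<And>a. a \<in> B \<Longrightarrow> F a \<subseteq> carrier G \<and> finite (F a) \<and> card (F a) = Suc M \<and>
      (\<forall>x\<in>F a. \<forall>y\<in>F a. generate G {a} #> x = generate G {a} #> y \<longrightarrow> x = y)"
    by metis
  define m where "m = Max (insert 0 (len ` (\<Union>a\<in>B. F a)))"
  have m: "len g \<le> m" if "a \<in> B" "g \<in> F a" for a g
    unfolding m_def using that finB F by (intro Max_ge) auto
  define R where "R = r * Suc m + m"
  define t where "t = R + nat \<lceil>\<Delta>\<rceil> + 1"
  define D where "D = 2 * (real t + real R) + \<Delta> + 1"
  obtain h where h: "h \<in> carrier G" and bad: "\<forall>a\<in>carrier G. len a \<le> R \<longrightarrow> D \<le> gp2 h (a \<otimes> h) \<one>"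
    using all_bad[of R D] by blast
  have tR: "2 * real R + \<Delta> < 2 * real t"
  proof -
    have "\<Delta> < 2 + 2 * real_of_int \<lceil>\<Delta>\<rceil>" using \<Delta>_nonneg le_of_int_ceiling[of \<Delta>] by argo
    then show ?thesis using \<Delta>_nonneg by (simp add: t_def)
  qed
  have DR: "2 * (real t + real R) + \<Delta> < D" by (simp add: D_def)
  note few = few_small_translations[OF h bad tR DR] and return = translate_back[OF h bad tR DR]
  let ?\<tau> = "\<tau> h"
  have "\<exists>a\<in>B. 4 * \<Delta> + 1 < \<bar>?\<tau> a\<bar>"
  proof (rule ccontr)
    assume "\<not> ?thesis"
    then have "B \<subseteq> {a \<in> carrier G. len a \<le> R \<and> \<bar>?\<tau> a\<bar> \<le> 4 * \<Delta> + 1}"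
      by (auto simp: B_def R_def not_less)
    then have "card B \<le> card {a \<in> carrier G. len a \<le> R \<and> \<bar>?\<tau> a\<bar> \<le> 4 * \<Delta> + 1}"
      by (rule card_mono[rotated]) (rule finite_subset[OF _ finite_ball[of R]], auto)
    also have "\<dots> \<le> \<beta> E" unfolding \<beta>_def E_def by (rule few)
    finally show False using r by (simp add: \<beta>_def B_def)
  qed
  then obtain a where a: "a \<in> B" "4 * \<Delta> + 1 < \<bar>?\<tau> a\<bar>" by blast
  have ac: "a \<in> carrier G" "len a \<le> r" using a by (auto simp: B_def)
  note Fa = F[OF a(1)]
  have "\<forall>g\<in>F a. \<exists>z\<in>generate G {a}. inv g \<otimes> z \<in> carrier G \<and> len (inv g \<otimes> z) \<le> R \<and> \<bar>?\<tau> (inv g \<otimes> z)\<bar> \<le> real r + 3 * \<Delta>"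
    using return[OF ac a(2)] Fa m[OF a(1)] unfolding R_def by blast
  then obtain z where z: "\<And>g. g \<in> F a \<Longrightarrow> z g \<in> generate G {a} \<and> inv g \<otimes> z g \<in> carrier G \<and>
      len (inv g \<otimes> z g) \<le> R \<and> \<bar>?\<tau> (inv g \<otimes> z g)\<bar> \<le> real r + 3 * \<Delta>"
    by metis
  have sub: "subgroup (generate G {a}) G" using ac by (intro generate_is_subgroup) simp
  \<comment> \<open>Equal images put \<open>x \<otimes> inv y\<close> into the cyclic subgroup, so
    \<open>x\<close> and \<open>y\<close> represent the same right coset.\<close>
  have "inj_on (\<lambda>g. inv g \<otimes> z g) (F a)"
  proof (rule inj_onI)
    fix x y assume xy: "x \<in> F a" "y \<in> F a" "inv x \<otimes> z x = inv y \<otimes> z y"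
    have c: "x \<in> carrier G" "y \<in> carrier G" using xy Fa by auto
    have zc: "z x \<in> carrier G" "z y \<in> carrier G" using z[OF xy(1)] z[OF xy(2)] subgroup.mem_carrier[OF sub] by auto
    have "z x = x \<otimes> (inv y \<otimes> z y)" using xy(3) c zc by (metis inv_closed inv_solve_left m_closed)
    then have "z x \<otimes> inv (z y) = x \<otimes> inv y" using c zc by (simp add: m_assoc)
    moreover have "z x \<otimes> inv (z y) \<in> generate G {a}"
      using z[OF xy(1)] z[OF xy(2)] by (intro subgroup.m_closed[OF sub] subgroup.m_inv_closed[OF sub]) auto
    ultimately have "x \<otimes> inv y \<in> generate G {a}" by simp
    moreover have "x = (x \<otimes> inv y) \<otimes> y" using c by (simp add: m_assoc)
    ultimately have "x \<in> generate G {a} #> y" unfolding r_coset_def by blast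
    then have "generate G {a} #> x = generate G {a} #> y"
      using repr_independence[OF _ c(2) sub] by simp
    then show "x = y" using Fa xy by blast
  qed
  then have "card (F a) \<le> card {x \<in> carrier G. len x \<le> R \<and> \<bar>?\<tau> x\<bar> \<le> real r + 3 * \<Delta>}"
  proof (rule card_inj_on_le)
    show "(\<lambda>g. inv g \<otimes> z g) ` F a \<subseteq> {x \<in> carrier G. len x \<le> R \<and> \<bar>?\<tau> x\<bar> \<le> real r + 3 * \<Delta>}"
      using z by auto
    show "finite {x \<in> carrier G. len x \<le> R \<and> \<bar>?\<tau> x\<bar> \<le> real r + 3 * \<Delta>}"
      by (rule finite_subset[OF _ finite_ball[of R]]) auto
  qed
  also have "\<dots> \<le> M" unfolding M_def \<beta>_def by (rule few)
  finally show False using Fa by simp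
qed

text \<open>If \<open>u\<close> and \<open>h\<close> already diverge, \<open>\<one>\<close> will do.
  Otherwise the \<open>a\<close> that moves \<open>h\<close> away from itself also moves it away
  from \<open>u\<close>, by \<open>gp2_min\<close>.\<close>

lemma exists_avoiding_translation:
  assumes ne: "\<not> elementary_group G"
  shows "\<exists>R D. \<forall>u\<in>carrier G. \<forall>h\<in>carrier G. \<exists>a\<in>carrier G. len a \<le> R \<and> gp2 u (a \<otimes> h) \<one> \<le> D"
proof -
  obtain R D where RD: "\<forall>h\<in>carrier G. \<exists>a\<in>carrier G. len a \<le> R \<and> gp2 h (a \<otimes> h) \<one> < D"
    using exists_avoiding_translation_self[OF ne] by blast
  have "\<exists>a\<in>carrier G. len a \<le> R \<and> gp2 u (a \<otimes> h) \<one> \<le> D + \<Delta>" if c: "u \<in> carrier G" "h \<in> carrier G" for u h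
  proof -
    obtain a where a: "a \<in> carrier G" "len a \<le> R" "gp2 h (a \<otimes> h) \<one> < D" using RD c by blast
    have "min (gp2 h u \<one>) (gp2 u (a \<otimes> h) \<one>) - \<Delta> \<le> gp2 h (a \<otimes> h) \<one>"
      using c a by (intro gp2_min) auto
    then consider "gp2 u h \<one> \<le> D + \<Delta>" | "gp2 u (a \<otimes> h) \<one> \<le> D + \<Delta>"
      using a(3) gp2_commute[of h u \<one>] c by linarith
    then show ?thesis
    proof cases
      case 1
      then show ?thesis using c by (intro bexI[of _ \<one>]) auto
    qed (use a in blast)
  qed
  then show ?thesis by blast
qed

lemma comparable:
  assumes "word_metric G T"
  shows "\<exists>A\<ge>1. (\<forall>g\<in>carrier G. len g \<le> A * word_length G T g) \<and> (\<forall>g\<in>carrier G. word_length G T g \<le> A * len g)"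
proof -
  obtain A1 where A1: "A1 \<ge> 1" "\<forall>g\<in>carrier G. len g \<le> A1 * word_length G T g"
    using word_length_comparable[OF assms word_metric_axioms] by blast
  obtain A2 where A2: "\<forall>g\<in>carrier G. word_length G T g \<le> A2 * len g"
    using word_length_comparable[OF word_metric_axioms assms] by blast
  have "len g \<le> max A1 A2 * word_length G T g" "word_length G T g \<le> max A1 A2 * len g" if "g \<in> carrier G" for g
    using that A1(2) A2 mult_le_mono1[of A1 "max A1 A2" "word_length G T g"] mult_le_mono1[of A2 "max A1 A2" "len g"]
    by (meson max.cobounded1 max.cobounded2 order_trans)+
  then show ?thesis using A1(1) by (intro exI[of _ "max A1 A2"]) auto
qed

section \<open>Coarse betweenness and near additivity of word lengths\<close>

text \<open>Betweenness in the auxiliary metric of \<open>S\<close> singles out neither generating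
  set and so carries information from one to the other.\<close>

definition almost_between :: "real \<Rightarrow> 'a \<Rightarrow> 'a \<Rightarrow> bool" where
  "almost_between D g x \<longleftrightarrow> real (len g) + d g x \<le> real (len x) + D"

lemma almost_between_shift:
  assumes c: "g \<in> carrier G" "x \<in> carrier G" "y \<in> carrier G" and b: "almost_between D g x"
    and e: "real (dst x y) \<le> e"
  shows "almost_between (D + 2 * e) g y"
proof -
  have "d g y \<le> d g x + d x y" using c by (intro d_triangle)
  moreover have "real (len x) \<le> real (len y) + d x y"
    using d_triangle[of \<one> y x] c dst_commute[of x y] by (simp add: dst_one_left)
  ultimately show ?thesis using b e unfolding almost_between_def by linarith
qed

context
  fixes T :: "'a set"
  assumes T: "word_metric G T"
begin

interpretation T: word_metric G T by (rule T)

lemma geodesic_passes_near: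
  "\<exists>N. \<forall>g\<in>carrier G. \<forall>x\<in>carrier G. almost_between D g x \<longrightarrow>
    (\<forall>p. T.geodesic p \<one> x \<longrightarrow> (\<exists>l\<le>T.len x. dst g (p l) \<le> N))"
proof -
  obtain A where A: "\<forall>g\<in>carrier G. len g \<le> A * T.len g" "\<forall>g\<in>carrier G. T.len g \<le> A * len g"
    using comparable[OF T] by blast
  have "\<exists>N. \<forall>x\<in>carrier G. \<forall>y\<in>carrier G. \<forall>z\<in>carrier G. d x z + d z y \<le> d x y + D \<longrightarrow>
    (\<forall>p. T.geodesic p x y \<longrightarrow> (\<exists>l\<le>T.dst x y. dst z (p l) \<le> N))"
    by (rule T_geodesic_passes_near[OF T, of A]) (simp_all only: A)
  then obtain N where N: "\<forall>x\<in>carrier G. \<forall>y\<in>carrier G. \<forall>z\<in>carrier G. d x z + d z y \<le> d x y + D \<longrightarrow>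
    (\<forall>p. T.geodesic p x y \<longrightarrow> (\<exists>l\<le>T.dst x y. dst z (p l) \<le> N))"
    by (elim exE)
  show ?thesis
    unfolding almost_between_def
    using N[rule_format, OF one_closed] by (intro exI[of _ N]) (auto simp: dst_one_left T.dst_one_left)
qed

lemma between_near:
  "\<exists>N. \<forall>g\<in>carrier G. \<forall>x\<in>carrier G. almost_between D g x \<longrightarrow>
    (\<exists>v\<in>carrier G. T.len v + T.dst v x = T.len x \<and> dst g v \<le> N)"
proof -
  obtain N where N: "\<forall>g\<in>carrier G. \<forall>x\<in>carrier G. almost_between D g x \<longrightarrow>
    (\<forall>p. T.geodesic p \<one> x \<longrightarrow> (\<exists>l\<le>T.len x. dst g (p l) \<le> N))"
    using geodesic_passes_near[of D] by (elim exE)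
  have "\<exists>v\<in>carrier G. T.len v + T.dst v x = T.len x \<and> dst g v \<le> N"
    if c: "g \<in> carrier G" "x \<in> carrier G" and b: "almost_between D g x" for g x
  proof -
    obtain p where p: "T.geodesic p \<one> x" using T.geodesic_exists c by blast
    obtain l where l: "l \<le> T.len x" "dst g (p l) \<le> N" using N c b p by blast
    have l': "l \<le> T.dst \<one> x" using l c by (simp add: T.dst_one_left)
    show ?thesis using T.geodesicD(3,5,6)[OF p l'] l l' c by (intro bexI[of _ "p l"]) (auto simp: T.dst_one_left)
  qed
  then show ?thesis by (intro exI[of _ N]) simp
qed

text \<open>An exact intermediate point \<open>v\<close> of a \<open>T\<close>-geodesic lies within
  \<open>N\<close> of \<open>g\<close>; replacing it by \<open>g\<close> costs \<open>A * N\<close>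
  in each of the two lengths.\<close>

lemma almost_between_nearly_additive:
  "\<exists>C. \<forall>g\<in>carrier G. \<forall>h\<in>carrier G. almost_between D g (g \<otimes> h) \<longrightarrow> T.len g + T.len h \<le> T.len (g \<otimes> h) + C"
proof -
  obtain A where A: "\<forall>g\<in>carrier G. T.len g \<le> A * len g"
    using comparable[OF T] by blast
  obtain N where N: "\<forall>g\<in>carrier G. \<forall>x\<in>carrier G. almost_between D g x \<longrightarrow>
    (\<exists>v\<in>carrier G. T.len v + T.dst v x = T.len x \<and> dst g v \<le> N)"
    using between_near[of D] by (elim exE)
  have "T.len g + T.len h \<le> T.len (g \<otimes> h) + 2 * (A * N)"
    if c: "g \<in> carrier G" "h \<in> carrier G" and b: "almost_between D g (g \<otimes> h)" for g h
  proof -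
    have gh: "g \<otimes> h \<in> carrier G" using c by simp
    obtain v where v: "v \<in> carrier G" "T.len v + T.dst v (g \<otimes> h) = T.len (g \<otimes> h)" "dst g v \<le> N"
      using N c gh b by blast
    have AN: "A * dst g v \<le> A * N" using v(3) by (rule mult_le_mono2)
    have le: "T.dst x y \<le> A * dst x y" if "x \<in> carrier G" "y \<in> carrier G" for x y
      unfolding dst_def T.dst_def using A that by simp
    have "T.dst v g \<le> A * dst g v" using le[of v g] dst_commute[of v g] v(1) c by simp
    then have "T.len g \<le> T.len v + A * dst g v"
      using T.dst_triangle[of \<one> v g] v(1) c by (simp add: T.dst_one_left)
    moreover have "T.len h \<le> A * dst g v + T.dst v (g \<otimes> h)"
      using T.dst_triangle[of g v "g \<otimes> h"] le[of g v] v(1) c gh by (simp add: T.dst_right_mult)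
    ultimately show ?thesis using v(2) AN by linarith
  qed
  then show ?thesis by (intro exI[of _ "2 * (A * N)"]) simp
qed

text \<open>Combined with \<open>almost_between_nearly_additive\<close> for another generating set:
  exact additivity of one word length implies near additivity of the other.\<close>

lemma product_almost_between:
  "\<exists>\<kappa>. \<forall>g\<in>carrier G. \<forall>h\<in>carrier G. T.len (g \<otimes> h) = T.len g + T.len h \<longrightarrow> almost_between \<kappa> g (g \<otimes> h)"
proof -
  obtain A where A: "\<forall>g\<in>carrier G. len g \<le> A * T.len g" "\<forall>g\<in>carrier G. T.len g \<le> A * len g"
    using comparable[OF T] by blast
  have "\<exists>\<kappa>. \<forall>x\<in>carrier G. \<forall>y\<in>carrier G. \<forall>z\<in>carrier G. T.dst x z + T.dst z y = T.dst x y \<longrightarrow>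
    d x z + d z y \<le> d x y + \<kappa>"
    by (rule between_imp_almost_between[OF T, of A]) (simp_all only: A)
  then obtain \<kappa> where \<kappa>: "\<forall>x\<in>carrier G. \<forall>y\<in>carrier G. \<forall>z\<in>carrier G. T.dst x z + T.dst z y = T.dst x y \<longrightarrow>
    d x z + d z y \<le> d x y + \<kappa>"
    by (elim exE)
  have "almost_between \<kappa> g (g \<otimes> h)"
    if "g \<in> carrier G" "h \<in> carrier G" "T.len (g \<otimes> h) = T.len g + T.len h" for g h
    using \<kappa>[rule_format, of \<one> "g \<otimes> h" g] that
    by (simp add: almost_between_def dst_one_left T.dst_one_left T.dst_right_mult)
  then show ?thesis by (intro exI[of _ \<kappa>]) simp
qed

end

end

locale two_generating_sets = hyperbolic_group G S \<Delta> + S1: word_metric G S1 + S2: word_metric G S2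
  for G :: "('a, 'b) monoid_scheme" (structure) and S \<Delta> S1 S2 +
  assumes non_elementary: "\<not> elementary_group G"
begin

lemma common_comparison_constant:
  "\<exists>A\<ge>1. \<forall>g\<in>carrier G. len g \<le> A * S1.len g \<and> S1.len g \<le> A * len g \<and> len g \<le> A * S2.len g \<and> S2.len g \<le> A * len g"
proof -
  obtain A1 where A1: "A1 \<ge> 1" "\<forall>g\<in>carrier G. len g \<le> A1 * S1.len g" "\<forall>g\<in>carrier G. S1.len g \<le> A1 * len g"
    using comparable[OF S1.word_metric_axioms] by blast
  obtain A2 where A2: "A2 \<ge> 1" "\<forall>g\<in>carrier G. len g \<le> A2 * S2.len g" "\<forall>g\<in>carrier G. S2.len g \<le> A2 * len g"
    using comparable[OF S2.word_metric_axioms] by blast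
  have mono: "x \<le> A1 * y \<Longrightarrow> x \<le> (A1 + A2) * y" "x \<le> A2 * y \<Longrightarrow> x \<le> (A1 + A2) * y" for x y
    by (simp_all add: distrib_right)
  show ?thesis using A1 A2 mono by (intro exI[of _ "A1 + A2"]) (simp add: add_increasing2)
qed

definition A :: nat where
  "A = (SOME A. A \<ge> 1 \<and> (\<forall>g\<in>carrier G. len g \<le> A * S1.len g \<and> S1.len g \<le> A * len g \<and> len g \<le> A * S2.len g \<and> S2.len g \<le> A * len g))"

lemma A:
  "A \<ge> 1" "g \<in> carrier G \<Longrightarrow> len g \<le> A * S1.len g" "g \<in> carrier G \<Longrightarrow> S1.len g \<le> A * len g"
  "g \<in> carrier G \<Longrightarrow> len g \<le> A * S2.len g" "g \<in> carrier G \<Longrightarrow> S2.len g \<le> A * len g"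
  using someI_ex[OF common_comparison_constant] unfolding A_def by blast+

lemma infinite_carrier: "infinite (carrier G)"
  using finite_imp_elementary_group non_elementary by blast

lemma dst_S1_le: "x \<in> carrier G \<Longrightarrow> y \<in> carrier G \<Longrightarrow> S1.dst x y \<le> A * dst x y"
  unfolding dst_def S1.dst_def by (rule A) simp

lemma dst_S2_le: "x \<in> carrier G \<Longrightarrow> y \<in> carrier G \<Longrightarrow> S2.dst x y \<le> A * dst x y"
  unfolding dst_def S2.dst_def by (rule A) simp

lemma len_S1_dist: "x \<in> carrier G \<Longrightarrow> y \<in> carrier G \<Longrightarrow> S1.len y \<le> S1.len x + A * dst x y"
  using S1.dst_triangle[of \<one> x y] dst_S1_le[of x y] by (simp add: S1.dst_one_left)

lemma len_S2_dist: "x \<in> carrier G \<Longrightarrow> y \<in> carrier G \<Longrightarrow> S2.len y \<le> S2.len x + A * dst x y"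
  using S2.dst_triangle[of \<one> x y] dst_S2_le[of x y] by (simp add: S2.dst_one_left)

lemma split_spheres:
  "\<exists>C. \<forall>n m. \<exists>\<psi>. inj_on \<psi> (word_sphere G S1 (n + m)) \<and> (\<forall>x\<in>word_sphere G S1 (n + m).
     fst (\<psi> x) \<in> word_sphere G S1 n \<and> snd (\<psi> x) \<in> word_sphere G S1 m \<and>
     \<bar>real (S2.len x) - real (S2.len (fst (\<psi> x))) - real (S2.len (snd (\<psi> x)))\<bar> \<le> real C)"
proof -
  obtain \<kappa> where \<kappa>: "\<forall>g\<in>carrier G. \<forall>h\<in>carrier G. S1.len (g \<otimes> h) = S1.len g + S1.len h \<longrightarrow> almost_between \<kappa> g (g \<otimes> h)"
    using product_almost_between[OF S1.word_metric_axioms] by (elim exE)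
  obtain C where C: "\<forall>g\<in>carrier G. \<forall>h\<in>carrier G. almost_between \<kappa> g (g \<otimes> h) \<longrightarrow> S2.len g + S2.len h \<le> S2.len (g \<otimes> h) + C"
    using almost_between_nearly_additive[OF S2.word_metric_axioms, of \<kappa>] by (elim exE)
  have "\<exists>\<psi>. inj_on \<psi> (word_sphere G S1 (n + m)) \<and> (\<forall>x\<in>word_sphere G S1 (n + m).
     fst (\<psi> x) \<in> word_sphere G S1 n \<and> snd (\<psi> x) \<in> word_sphere G S1 m \<and>
     \<bar>real (S2.len x) - real (S2.len (fst (\<psi> x))) - real (S2.len (snd (\<psi> x)))\<bar> \<le> real C)" for n m
  proof -
    have "\<exists>p. fst p \<in> carrier G \<and> snd p \<in> carrier G \<and> x = fst p \<otimes> snd p \<and> S1.len (fst p) = n \<and> S1.len (snd p) = m"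
      if x: "x \<in> word_sphere G S1 (n + m)" for x
    proof -
      have "x \<in> carrier G" "n \<le> S1.len x" "S1.len x - n = m" using x by (auto simp: word_sphere_def)
      then obtain a b where "a \<in> carrier G" "b \<in> carrier G" "x = a \<otimes> b" "S1.len a = n" "S1.len b = m"
        using S1.len_split[of x n] by auto
      then show ?thesis by (intro exI[of _ "(a, b)"]) simp
    qed
    then obtain \<psi> where \<psi>: "\<And>x. x \<in> word_sphere G S1 (n + m) \<Longrightarrow> fst (\<psi> x) \<in> carrier G \<and> snd (\<psi> x) \<in> carrier G \<and>
        x = fst (\<psi> x) \<otimes> snd (\<psi> x) \<and> S1.len (fst (\<psi> x)) = n \<and> S1.len (snd (\<psi> x)) = m"
      by metis
    have "inj_on \<psi> (word_sphere G S1 (n + m))" using \<psi> by (metis inj_onI)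
    moreover have "\<bar>real (S2.len x) - real (S2.len (fst (\<psi> x))) - real (S2.len (snd (\<psi> x)))\<bar> \<le> real C"
      if x: "x \<in> word_sphere G S1 (n + m)" for x
    proof -
      note px = \<psi>[OF x]
      have "S1.len (fst (\<psi> x) \<otimes> snd (\<psi> x)) = S1.len (fst (\<psi> x)) + S1.len (snd (\<psi> x))"
        using px x by (simp add: word_sphere_def)
      then have "S2.len (fst (\<psi> x)) + S2.len (snd (\<psi> x)) \<le> S2.len (fst (\<psi> x) \<otimes> snd (\<psi> x)) + C"
        using \<kappa> C px by blast
      moreover have "S2.len (fst (\<psi> x) \<otimes> snd (\<psi> x)) \<le> S2.len (fst (\<psi> x)) + S2.len (snd (\<psi> x))"
        using px by (intro S2.len_mult) auto
      ultimately show ?thesis using px by simp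
    qed
    ultimately show ?thesis using \<psi> by (intro exI[of _ \<psi>]) (auto simp: word_sphere_def)
  qed
  then show ?thesis by blast
qed

text \<open>Left translation by \<open>g\<close> carries \<open>inv g\<close>,
  \<open>\<one>\<close>, \<open>a \<otimes> h\<close> to \<open>\<one>\<close>, \<open>g\<close>,
  \<open>g \<otimes> (a \<otimes> h)\<close>; so a small \<open>gp2\<close> of \<open>inv g\<close>
  and \<open>a \<otimes> h\<close> seen from \<open>\<one>\<close> is exactly betweenness of
  \<open>g\<close>. One correction \<open>a\<close> then serves both word lengths.\<close>

lemma almost_geodesic_concatenation:
  "\<exists>R D C. \<forall>g\<in>carrier G. \<forall>h\<in>carrier G. \<exists>a\<in>carrier G. len a \<le> R \<and> almost_between D g (g \<otimes> (a \<otimes> h)) \<and>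
     \<bar>int (S1.len (g \<otimes> (a \<otimes> h))) - int (S1.len g) - int (S1.len h)\<bar> \<le> int C \<and>
     \<bar>int (S2.len (g \<otimes> (a \<otimes> h))) - int (S2.len g) - int (S2.len h)\<bar> \<le> int C"
proof -
  obtain R D where RD: "\<forall>u\<in>carrier G. \<forall>h\<in>carrier G. \<exists>a\<in>carrier G. len a \<le> R \<and> gp2 u (a \<otimes> h) \<one> \<le> D"
    using exists_avoiding_translation[OF non_elementary] by (elim exE)
  obtain C1 where C1: "\<forall>g\<in>carrier G. \<forall>h\<in>carrier G. almost_between D g (g \<otimes> h) \<longrightarrow> S1.len g + S1.len h \<le> S1.len (g \<otimes> h) + C1"
    using almost_between_nearly_additive[OF S1.word_metric_axioms, of D] by (elim exE)
  obtain C2 where C2: "\<forall>g\<in>carrier G. \<forall>h\<in>carrier G. almost_between D g (g \<otimes> h) \<longrightarrow> S2.len g + S2.len h \<le> S2.len (g \<otimes> h) + C2"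
    using almost_between_nearly_additive[OF S2.word_metric_axioms, of D] by (elim exE)
  define C where "C = C1 + C2"
  have "\<exists>a\<in>carrier G. len a \<le> R \<and> almost_between D g (g \<otimes> (a \<otimes> h)) \<and>
     \<bar>int (S1.len (g \<otimes> (a \<otimes> h))) - int (S1.len g) - int (S1.len h)\<bar> \<le> int (C + A * R) \<and>
     \<bar>int (S2.len (g \<otimes> (a \<otimes> h))) - int (S2.len g) - int (S2.len h)\<bar> \<le> int (C + A * R)"
    if c: "g \<in> carrier G" "h \<in> carrier G" for g h
  proof -
    obtain a where a: "a \<in> carrier G" "len a \<le> R" "gp2 (inv g) (a \<otimes> h) \<one> \<le> D"
      using RD c by (meson inv_closed)
    have ah: "a \<otimes> h \<in> carrier G" using a c by simp
    have "d (inv g) (a \<otimes> h) = real (len (g \<otimes> (a \<otimes> h)))" using c ah by (simp add: dst_def)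
    moreover have "d (inv g) \<one> = real (len g)" using c by (simp add: dst_def)
    moreover have "d (a \<otimes> h) \<one> = real (len (a \<otimes> h))" using ah len_inv[of "a \<otimes> h"] by (simp add: dst_def)
    moreover have "d g (g \<otimes> (a \<otimes> h)) = real (len (a \<otimes> h))" using c ah dst_right_mult by simp
    ultimately have b: "almost_between D g (g \<otimes> (a \<otimes> h))"
      using a(3) by (simp add: almost_between_def gp2_def)
    have AR: "A * len a \<le> A * R" using a(2) by (rule mult_le_mono2)
    have ia: "inv a \<otimes> (a \<otimes> h) = h" using a c by (simp add: m_assoc[symmetric])
    have i: "len (inv a) = len a" using a len_inv by simp
    have 1: "S1.len a \<le> A * R" "S1.len (inv a) \<le> A * R" "S2.len a \<le> A * R" "S2.len (inv a) \<le> A * R"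
      using A(3)[of a] A(3)[of "inv a"] A(5)[of a] A(5)[of "inv a"] a(1) i by (auto intro: order_trans[OF _ AR])
    have 2: "S1.len (g \<otimes> (a \<otimes> h)) \<le> S1.len g + S1.len (a \<otimes> h)" "S1.len (a \<otimes> h) \<le> S1.len a + S1.len h"
      "S1.len h \<le> S1.len (inv a) + S1.len (a \<otimes> h)"
      using S1.len_mult[of g "a \<otimes> h"] S1.len_mult[of a h] S1.len_mult[of "inv a" "a \<otimes> h"] a(1) c ah ia by auto
    have 3: "S2.len (g \<otimes> (a \<otimes> h)) \<le> S2.len g + S2.len (a \<otimes> h)" "S2.len (a \<otimes> h) \<le> S2.len a + S2.len h"
      "S2.len h \<le> S2.len (inv a) + S2.len (a \<otimes> h)"
      using S2.len_mult[of g "a \<otimes> h"] S2.len_mult[of a h] S2.len_mult[of "inv a" "a \<otimes> h"] a(1) c ah ia by auto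
    have 4: "S1.len g + S1.len (a \<otimes> h) \<le> S1.len (g \<otimes> (a \<otimes> h)) + C" "S2.len g + S2.len (a \<otimes> h) \<le> S2.len (g \<otimes> (a \<otimes> h)) + C"
      using C1[rule_format, OF c(1) ah b] C2[rule_format, OF c(1) ah b] unfolding C_def by linarith+
    have "\<bar>int (S1.len (g \<otimes> (a \<otimes> h))) - int (S1.len g) - int (S1.len h)\<bar> \<le> int (C + A * R)"
      using 1(1,2) 2 4(1) by linarith
    moreover have "\<bar>int (S2.len (g \<otimes> (a \<otimes> h))) - int (S2.len g) - int (S2.len h)\<bar> \<le> int (C + A * R)"
      using 1(3,4) 3 4(2) by linarith
    ultimately show ?thesis using a(1,2) b by blast
  qed
  then show ?thesis by (intro exI[of _ R] exI[of _ D] exI[of _ "C + A * R"]) simp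
qed

text \<open>The correction changes the length by a bounded but uncontrolled amount. Overshooting
  with a further factor and cutting back to a prefix makes it exact.\<close>

lemma concatenation_of_exact_length:
  "\<exists>R D E C. \<forall>g\<in>carrier G. \<forall>h\<in>carrier G. \<exists>x\<in>carrier G. S1.len x = S1.len g + S1.len h \<and>
     \<bar>real (S2.len x) - real (S2.len g) - real (S2.len h)\<bar> \<le> real C \<and>
     (\<exists>a\<in>carrier G. len a \<le> R \<and> almost_between D g (g \<otimes> (a \<otimes> h)) \<and> dst (g \<otimes> (a \<otimes> h)) x \<le> E)"
proof -
  obtain R D C where RDC: "\<forall>g\<in>carrier G. \<forall>h\<in>carrier G. \<exists>a\<in>carrier G. len a \<le> R \<and> almost_between D g (g \<otimes> (a \<otimes> h)) \<and>
     \<bar>int (S1.len (g \<otimes> (a \<otimes> h))) - int (S1.len g) - int (S1.len h)\<bar> \<le> int C \<and>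
     \<bar>int (S2.len (g \<otimes> (a \<otimes> h))) - int (S2.len g) - int (S2.len h)\<bar> \<le> int C"
    using almost_geodesic_concatenation by (elim exE)
  \<comment> \<open>Two concatenations lose at most \<open>C\<close> each, so length
    \<open>2 * C\<close> guarantees that the target is reached; the excess is then at most
    \<open>4 * C\<close>.\<close>
  obtain t where t: "t \<in> carrier G" "S1.len t = 2 * C"
    using S1.infinite_imp_sphere_nonempty[OF infinite_carrier, of "2 * C"] by (auto simp: word_sphere_def)
  define E where "E = R + len t + A * (4 * C)"
  have "\<exists>x\<in>carrier G. S1.len x = S1.len g + S1.len h \<and>
     \<bar>real (S2.len x) - real (S2.len g) - real (S2.len h)\<bar> \<le> real (C + A * E) \<and>
     (\<exists>a\<in>carrier G. len a \<le> R \<and> almost_between D g (g \<otimes> (a \<otimes> h)) \<and> dst (g \<otimes> (a \<otimes> h)) x \<le> E)"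
    if c: "g \<in> carrier G" "h \<in> carrier G" for g h
  proof -
    obtain a where a: "a \<in> carrier G" "len a \<le> R" "almost_between D g (g \<otimes> (a \<otimes> h))"
      "\<bar>int (S1.len (g \<otimes> (a \<otimes> h))) - int (S1.len g) - int (S1.len h)\<bar> \<le> int C"
      "\<bar>int (S2.len (g \<otimes> (a \<otimes> h))) - int (S2.len g) - int (S2.len h)\<bar> \<le> int C"
      using RDC c by blast
    define y where "y = g \<otimes> (a \<otimes> h)"
    have y: "y \<in> carrier G" using a c by (simp add: y_def)
    obtain b where b: "b \<in> carrier G" "len b \<le> R" "\<bar>int (S1.len (y \<otimes> (b \<otimes> t))) - int (S1.len y) - int (S1.len t)\<bar> \<le> int C"
      using RDC y t(1) by blast
    define y' where "y' = y \<otimes> (b \<otimes> t)"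
    have y': "y' \<in> carrier G" using b t y by (simp add: y'_def)
    have "int (S1.len g) + int (S1.len h) \<le> int (S1.len y')" and
      up: "int (S1.len y') \<le> int (S1.len g) + int (S1.len h) + 4 * int C"
      using a(4) b(3) t(2) unfolding y_def[symmetric] y'_def[symmetric] by linarith+
    then have "S1.len g + S1.len h \<le> S1.len y'" by linarith
    then obtain x r where x: "x \<in> carrier G" "r \<in> carrier G" "y' = x \<otimes> r" "S1.len x = S1.len g + S1.len h"
      "S1.len r = S1.len y' - (S1.len g + S1.len h)"
      using S1.len_split[OF y'] by blast
    have "S1.len r \<le> 4 * C" using x(5) up by linarith
    then have "A * S1.len r \<le> A * (4 * C)" by (rule mult_le_mono2)
    then have "len r \<le> A * (4 * C)" using A(2)[OF x(2)] by linarith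
    then have "dst y' x \<le> A * (4 * C)"
      using dst_commute[OF y' x(1)] dst_right_mult[OF x(1,2)] x(3) by simp
    moreover have "dst y y' \<le> R + len t"
      using dst_right_mult[of y "b \<otimes> t"] len_mult[OF b(1) t(1)] b t(1) y unfolding y'_def by simp
    moreover have "dst y x \<le> dst y y' + dst y' x" using y y' x by (intro dst_triangle)
    ultimately have yx: "dst y x \<le> E" unfolding E_def by linarith
    then have AE: "A * dst y x \<le> A * E" by (rule mult_le_mono2)
    have sw: "dst x y = dst y x" using dst_commute x(1) y by simp
    have "S2.len x \<le> S2.len y + A * E" "S2.len y \<le> S2.len x + A * E"
      using len_S2_dist[OF y x(1)] len_S2_dist[OF x(1) y] AE unfolding sw by linarith+
    moreover have "int (S2.len y) \<le> int (S2.len g) + int (S2.len h) + int C"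
      "int (S2.len g) + int (S2.len h) \<le> int (S2.len y) + int C"
      using a(5) unfolding y_def[symmetric] by linarith+
    ultimately have "S2.len x \<le> S2.len g + S2.len h + (C + A * E)" "S2.len g + S2.len h \<le> S2.len x + (C + A * E)"
      by linarith+
    then have "\<bar>real (S2.len x) - real (S2.len g) - real (S2.len h)\<bar> \<le> real (C + A * E)"
      by linarith
    then show ?thesis using x a(1-3) yx unfolding y_def by blast
  qed
  then show ?thesis by (intro exI[of _ R] exI[of _ D] exI[of _ E] exI[of _ "C + A * E"]) simp
qed

text \<open>Contains the fibre over \<open>x\<close> of any choice of concatenations, so it can be
  counted before a choice is made.\<close>

definition concatenations :: "nat \<Rightarrow> real \<Rightarrow> nat \<Rightarrow> nat \<Rightarrow> nat \<Rightarrow> 'a \<Rightarrow> ('a \<times> 'a) set" where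
  "concatenations R D E n m x = {(g, h). g \<in> word_sphere G S1 n \<and> h \<in> word_sphere G S1 m \<and>
       (\<exists>a\<in>carrier G. len a \<le> R \<and> almost_between D g (g \<otimes> (a \<otimes> h)) \<and> dst (g \<otimes> (a \<otimes> h)) x \<le> E)}"

text \<open>Fix one geodesic \<open>p\<close> from \<open>\<one>\<close> to \<open>x\<close>. Then
  \<open>g\<close> is within \<open>N\<close> of some \<open>p l\<close> with \<open>l\<close> close
  to \<open>n\<close>, and \<open>h\<close> is determined by \<open>g\<close>, the correction
  \<open>a\<close> and the displacement \<open>w\<close> of \<open>x\<close>; each of these data has
  boundedly many values.\<close>

lemma few_concatenations:
  "\<exists>C. \<forall>n m. \<forall>x\<in>carrier G.
     finite (concatenations R D E n m x) \<and> card (concatenations R D E n m x) \<le> C"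
proof -
  obtain N where N: "\<forall>g\<in>carrier G. \<forall>x\<in>carrier G. almost_between (D + 2 * real E) g x \<longrightarrow>
    (\<forall>p. S1.geodesic p \<one> x \<longrightarrow> (\<exists>l\<le>S1.len x. dst g (p l) \<le> N))"
    using geodesic_passes_near[OF S1.word_metric_axioms, of "D + 2 * real E"] by (elim exE)
  define Bl where "Bl r = {g \<in> carrier G. len g \<le> r}" for r
  have finB: "finite (Bl r)" for r unfolding Bl_def by (rule finite_ball)
  define C where "C = (2 * (A * N) + 1) * (card (Bl N) * (card (Bl R) * card (Bl E)))"
  have "finite (concatenations R D E n m x) \<and> card (concatenations R D E n m x) \<le> C"
    (is "finite ?P \<and> card ?P \<le> C") if x: "x \<in> carrier G" for n m x
  proof -
    obtain p where p: "S1.geodesic p \<one> x" using S1.geodesic_exists x by blast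
    define Dom where "Dom = {n - A * N..n + A * N} \<times> (Bl N \<times> (Bl R \<times> Bl E))"
    define F where "F = (\<lambda>(l, u, a, w). (p l \<otimes> u, inv (p l \<otimes> u \<otimes> a) \<otimes> (x \<otimes> w)))"
    have finD: "finite Dom" unfolding Dom_def using finB by simp
    have "card {n - A * N..n + A * N} \<le> 2 * (A * N) + 1" by simp
    then have cardD: "card Dom \<le> C"
      unfolding Dom_def C_def card_cartesian_product by (rule mult_le_mono1)
    have "?P \<subseteq> F ` Dom"
    proof
      fix q assume "q \<in> ?P"
      then obtain g h a where q: "q = (g, h)" and g: "g \<in> carrier G" "S1.len g = n" and h: "h \<in> carrier G"
        and a: "a \<in> carrier G" "len a \<le> R" "almost_between D g (g \<otimes> (a \<otimes> h))" "dst (g \<otimes> (a \<otimes> h)) x \<le> E"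
        by (auto simp: word_sphere_def concatenations_def)
      define y where "y = g \<otimes> (a \<otimes> h)"
      have y: "y \<in> carrier G" using g h a by (simp add: y_def)
      have "almost_between (D + 2 * real E) g x"
        using almost_between_shift[OF g(1) y x a(3)[folded y_def], of "real E"] a(4) by (simp add: y_def)
      then obtain l where l: "l \<le> S1.len x" "dst g (p l) \<le> N" using N g(1) x p by blast
      have l': "l \<le> S1.dst \<one> x" using l x by (simp add: S1.dst_one_left)
      have pl: "p l \<in> carrier G" "S1.len (p l) = l"
        using S1.geodesicD(3,5)[OF p l'] by (auto simp: S1.dst_one_left)
      have "A * dst g (p l) \<le> A * N" using l(2) by (rule mult_le_mono2)
      have sw: "dst (p l) g = dst g (p l)" using dst_commute pl(1) g(1) by simp
      have "l \<le> n + A * N" "n \<le> l + A * N"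
        using len_S1_dist[OF g(1) pl(1)] len_S1_dist[OF pl(1) g(1)] \<open>A * dst g (p l) \<le> A * N\<close>
        unfolding sw g(2) pl(2) by linarith+
      then have lr: "l \<in> {n - A * N..n + A * N}" by auto
      define u where "u = inv (p l) \<otimes> g"
      define w where "w = inv x \<otimes> y"
      have u: "u \<in> Bl N" "p l \<otimes> u = g"
        using l(2) pl(1) g(1) sw by (auto simp: Bl_def u_def dst_def m_assoc[symmetric])
      have w: "w \<in> Bl E" "x \<otimes> w = y"
        using a(4) x y dst_commute[OF x y] by (auto simp: Bl_def w_def dst_def y_def[symmetric] m_assoc[symmetric])
      have "inv (g \<otimes> a) \<otimes> y = h"
      proof -
        have "y = (g \<otimes> a) \<otimes> h" using g a h by (simp add: y_def m_assoc)
        moreover have "inv (g \<otimes> a) \<otimes> ((g \<otimes> a) \<otimes> h) = (inv (g \<otimes> a) \<otimes> (g \<otimes> a)) \<otimes> h"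
          using g a h by (intro m_assoc[symmetric]) auto
        ultimately show ?thesis using l_inv[of "g \<otimes> a"] g a h by simp
      qed
      then have "q = F (l, u, a, w)" by (simp add: F_def q u(2) w(2))
      moreover have "(l, u, a, w) \<in> Dom" using lr u w a by (simp add: Dom_def) (simp add: Bl_def)
      ultimately show "q \<in> F ` Dom" by blast
    qed
    from finite_subset[OF this finite_imageI[OF finD]] card_mono[OF finite_imageI[OF finD] this]
    have "finite ?P" "card ?P \<le> card (F ` Dom)" .
    moreover have "card (F ` Dom) \<le> card Dom" by (rule card_image_le[OF finD])
    ultimately show ?thesis using cardD by linarith
  qed
  then show ?thesis by blast
qed

lemma join_spheres:
  "\<exists>C. \<forall>n m. \<exists>\<phi>. (\<forall>p\<in>word_sphere G S1 n \<times> word_sphere G S1 m. \<phi> p \<in> word_sphere G S1 (n + m) \<and>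
       \<bar>real (S2.len (\<phi> p)) - real (S2.len (fst p)) - real (S2.len (snd p))\<bar> \<le> real C) \<and>
     (\<forall>x\<in>word_sphere G S1 (n + m). card {p\<in>word_sphere G S1 n \<times> word_sphere G S1 m. \<phi> p = x} \<le> C)"
proof -
  obtain R D E C1 where C1: "\<forall>g\<in>carrier G. \<forall>h\<in>carrier G. \<exists>x\<in>carrier G. S1.len x = S1.len g + S1.len h \<and>
     \<bar>real (S2.len x) - real (S2.len g) - real (S2.len h)\<bar> \<le> real C1 \<and>
     (\<exists>a\<in>carrier G. len a \<le> R \<and> almost_between D g (g \<otimes> (a \<otimes> h)) \<and> dst (g \<otimes> (a \<otimes> h)) x \<le> E)"
    using concatenation_of_exact_length by (elim exE)
  then obtain \<phi> where \<phi>: "\<And>g h. g \<in> carrier G \<Longrightarrow> h \<in> carrier G \<Longrightarrow> \<phi> g h \<in> carrier G \<and> S1.len (\<phi> g h) = S1.len g + S1.len h \<and>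
     \<bar>real (S2.len (\<phi> g h)) - real (S2.len g) - real (S2.len h)\<bar> \<le> real C1 \<and>
     (\<exists>a\<in>carrier G. len a \<le> R \<and> almost_between D g (g \<otimes> (a \<otimes> h)) \<and> dst (g \<otimes> (a \<otimes> h)) (\<phi> g h) \<le> E)"
    by metis
  obtain C2 where C2: "\<forall>n m. \<forall>x\<in>carrier G.
     finite (concatenations R D E n m x) \<and> card (concatenations R D E n m x) \<le> C2"
    using few_concatenations[of R D E] by (elim exE)
  have 1: "case_prod \<phi> p \<in> word_sphere G S1 (n + m) \<and>
       \<bar>real (S2.len (case_prod \<phi> p)) - real (S2.len (fst p)) - real (S2.len (snd p))\<bar> \<le> real (C1 + C2)"
    if "p \<in> word_sphere G S1 n \<times> word_sphere G S1 m" for p n m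
    using \<phi>[of "fst p" "snd p"] that by (auto simp: word_sphere_def case_prod_unfold)
  have 2: "card {p\<in>word_sphere G S1 n \<times> word_sphere G S1 m. case_prod \<phi> p = x} \<le> C1 + C2"
    if x: "x \<in> word_sphere G S1 (n + m)" for x n m
  proof -
    have xc: "x \<in> carrier G" using x by (simp add: word_sphere_def)
    note C2' = C2[rule_format, OF xc, of n m]
    have "{p\<in>word_sphere G S1 n \<times> word_sphere G S1 m. case_prod \<phi> p = x} \<subseteq> concatenations R D E n m x"
    proof
      fix p assume p: "p \<in> {p\<in>word_sphere G S1 n \<times> word_sphere G S1 m. case_prod \<phi> p = x}"
      obtain g h where gh: "p = (g, h)" by (cases p)
      have c: "g \<in> word_sphere G S1 n" "h \<in> word_sphere G S1 m" "x = \<phi> g h" using p gh by auto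
      then have "g \<in> carrier G" "h \<in> carrier G" by (auto simp: word_sphere_def)
      then show "p \<in> concatenations R D E n m x"
        using \<phi>[of g h] c gh by (simp add: concatenations_def)
    qed
    then have "card {p\<in>word_sphere G S1 n \<times> word_sphere G S1 m. case_prod \<phi> p = x} \<le> C2"
      using card_mono[OF conjunct1[OF C2']] conjunct2[OF C2'] order_trans by blast
    then show ?thesis by simp
  qed
  show ?thesis
  proof (intro exI[of _ "C1 + C2"] allI)
    fix n m
    show "\<exists>\<phi>. (\<forall>p\<in>word_sphere G S1 n \<times> word_sphere G S1 m. \<phi> p \<in> word_sphere G S1 (n + m) \<and>
       \<bar>real (S2.len (\<phi> p)) - real (S2.len (fst p)) - real (S2.len (snd p))\<bar> \<le> real (C1 + C2)) \<and>
     (\<forall>x\<in>word_sphere G S1 (n + m). card {p\<in>word_sphere G S1 n \<times> word_sphere G S1 m. \<phi> p = x} \<le> C1 + C2)"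
      using 1[of _ n m] 2[of _ n m] by (intro exI[of _ "case_prod \<phi>"]) blast
  qed
qed

section \<open>Cone types\<close>

definition cone :: "'a \<Rightarrow> 'a set" where
  "cone g = {w \<in> carrier G. S1.len (g \<otimes> w) = S1.len g + S1.len w}"

definition last_letters :: "'a \<Rightarrow> 'a set" where
  "last_letters x = {s \<in> S1. S1.len (x \<otimes> inv s) + 1 = S1.len x}"

text \<open>Cannon's N-type, for both word lengths at once; restricting it to the ball lets it range
  over a finite set.\<close>

definition profile :: "nat \<Rightarrow> 'a \<Rightarrow> 'a \<Rightarrow> int \<times> int" where
  "profile N g = (\<lambda>b\<in>{b \<in> carrier G. len b \<le> N}.
     (int (S1.len (g \<otimes> b)) - int (S1.len g), int (S2.len (g \<otimes> b)) - int (S2.len g)))"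

text \<open>The type of \<open>g\<close> records, for every continuation of a geodesic to \<open>g\<close>, the growth of the second word
  length and the letters that can end a geodesic word. By Cannon's argument it only depends on
  the two length functions in a ball of fixed radius around \<open>g\<close>.\<close>

definition type :: "'a \<Rightarrow> 'a \<Rightarrow> (int \<times> 'a set) option" where
  "type g = (\<lambda>w. if w \<in> cone g then Some (int (S2.len (g \<otimes> w)) - int (S2.len g), last_letters (g \<otimes> w)) else None)"

lemma finite_profiles: "finite (profile N ` carrier G)"
proof (rule finite_subset)
  let ?B = "{b \<in> carrier G. len b \<le> N}"
  let ?I = "{- int (A * N)..int (A * N)}"
  show "finite (PiE ?B (\<lambda>_. ?I \<times> ?I))" using finite_ball by (intro finite_PiE) auto
  show "profile N ` carrier G \<subseteq> PiE ?B (\<lambda>_. ?I \<times> ?I)"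
  proof
    fix t assume "t \<in> profile N ` carrier G"
    then obtain g where g: "g \<in> carrier G" "t = profile N g" by blast
    have "(int (S1.len (g \<otimes> b)) - int (S1.len g), int (S2.len (g \<otimes> b)) - int (S2.len g)) \<in> ?I \<times> ?I"
      if b: "b \<in> ?B" for b
    proof -
      have bc: "b \<in> carrier G" "g \<otimes> b \<in> carrier G" using b g by auto
      have AN: "A * len b \<le> A * N" using b by (intro mult_le_mono2) simp
      have dd: "dst g (g \<otimes> b) = len b" "dst (g \<otimes> b) g = len b"
        using dst_right_mult[OF g(1) bc(1)] dst_commute[OF g(1) bc(2)] by simp_all
      have "S1.len (g \<otimes> b) \<le> S1.len g + A * N" "S1.len g \<le> S1.len (g \<otimes> b) + A * N"
        using len_S1_dist[OF g(1) bc(2)] len_S1_dist[OF bc(2) g(1)] AN unfolding dd by linarith+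
      moreover have "S2.len (g \<otimes> b) \<le> S2.len g + A * N" "S2.len g \<le> S2.len (g \<otimes> b) + A * N"
        using len_S2_dist[OF g(1) bc(2)] len_S2_dist[OF bc(2) g(1)] AN unfolding dd by linarith+
      ultimately show ?thesis unfolding mem_Times_iff fst_conv snd_conv atLeastAtMost_iff by linarith
    qed
    then show "t \<in> PiE ?B (\<lambda>_. ?I \<times> ?I)" unfolding g(2) profile_def by (intro restrict_PiE_iff[THEN iffD2] ballI)
  qed
qed

lemma profile_eqD:
  assumes "profile N g = profile N g'" "b \<in> carrier G" "len b \<le> N"
  shows "int (S1.len (g \<otimes> b)) - int (S1.len g) = int (S1.len (g' \<otimes> b)) - int (S1.len g')"
    and "int (S2.len (g \<otimes> b)) - int (S2.len g) = int (S2.len (g' \<otimes> b)) - int (S2.len g')"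
  using fun_cong[OF assms(1), of b] assms(2,3) by (simp_all add: profile_def)

text \<open>If \<open>g'\<close> is almost between \<open>\<one>\<close> and
  \<open>g' \<otimes> w\<close>, shortest words for \<open>g' \<otimes> w\<close> over either
  generating set pass near \<open>g'\<close>. There the profile allows \<open>g'\<close> to be
  replaced by \<open>g\<close>, so the growth at \<open>g\<close> is at most that at
  \<open>g'\<close>; exchanging the roles gives equality.\<close>

lemma finitely_many_types: "finite (type ` carrier G)"
proof -
  obtain \<kappa> where \<kappa>: "\<forall>g\<in>carrier G. \<forall>h\<in>carrier G. S1.len (g \<otimes> h) = S1.len g + S1.len h \<longrightarrow> almost_between \<kappa> g (g \<otimes> h)"
    using product_almost_between[OF S1.word_metric_axioms] by (elim exE)
  \<comment> \<open>\<open>\<kappa>\<close> for an element of the cone and \<open>2 * A\<close> for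
    one further factor of length at most \<open>A\<close>: the next letter in the induction, an
    inverse letter when last letters are compared.\<close>
  define D where "D = \<kappa> + 2 * real A"
  obtain N1 where N1: "\<forall>g\<in>carrier G. \<forall>x\<in>carrier G. almost_between D g x \<longrightarrow>
    (\<exists>v\<in>carrier G. S1.len v + S1.dst v x = S1.len x \<and> dst g v \<le> N1)"
    using between_near[OF S1.word_metric_axioms, of D] by (elim exE)
  obtain N2 where N2: "\<forall>g\<in>carrier G. \<forall>x\<in>carrier G. almost_between D g x \<longrightarrow>
    (\<exists>v\<in>carrier G. S2.len v + S2.dst v x = S2.len x \<and> dst g v \<le> N2)"
    using between_near[OF S2.word_metric_axioms, of D] by (elim exE)
  define N where "N = N1 + N2"
  have grow_le: "int (S1.len (g \<otimes> w)) - int (S1.len g) \<le> int (S1.len (g' \<otimes> w)) - int (S1.len g')"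
      "int (S2.len (g \<otimes> w)) - int (S2.len g) \<le> int (S2.len (g' \<otimes> w)) - int (S2.len g')"
    if eq: "profile N g = profile N g'" and c: "g \<in> carrier G" "g' \<in> carrier G" "w \<in> carrier G"
      and b: "almost_between D g' (g' \<otimes> w)" for g g' w
  proof -
    have cw: "g' \<otimes> w \<in> carrier G" using c by simp
    have shift: "g' \<otimes> (inv g' \<otimes> v) = v \<and>
        (g \<otimes> (inv g' \<otimes> v)) \<otimes> (inv v \<otimes> (g' \<otimes> w)) = g \<otimes> w" if v: "v \<in> carrier G" for v
    proof (intro conjI)
      show "g' \<otimes> (inv g' \<otimes> v) = v" using v c by (simp add: m_assoc[symmetric])
      have "(g \<otimes> (inv g' \<otimes> v)) \<otimes> (inv v \<otimes> (g' \<otimes> w)) = g \<otimes> ((inv g' \<otimes> v) \<otimes> (inv v \<otimes> (g' \<otimes> w)))"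
        using v c by (simp add: m_assoc)
      also have "(inv g' \<otimes> v) \<otimes> (inv v \<otimes> (g' \<otimes> w)) = inv g' \<otimes> (g' \<otimes> w)"
        using v c by (intro inv_mult_chain) auto
      also have "\<dots> = w" using c by (simp add: m_assoc[symmetric])
      finally show "(g \<otimes> (inv g' \<otimes> v)) \<otimes> (inv v \<otimes> (g' \<otimes> w)) = g \<otimes> w" .
    qed
    obtain v where v: "v \<in> carrier G" "S1.len v + S1.dst v (g' \<otimes> w) = S1.len (g' \<otimes> w)" "dst g' v \<le> N1"
      using N1 c cw b by blast
    note sh = shift[OF v(1)]
    have "S1.len (g \<otimes> w) \<le> S1.len (g \<otimes> (inv g' \<otimes> v)) + S1.dst v (g' \<otimes> w)"
      using S1.len_mult[of "g \<otimes> (inv g' \<otimes> v)" "inv v \<otimes> (g' \<otimes> w)"] conjunct2[OF sh] v(1) c by (simp add: S1.dst_def)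
    moreover have "int (S1.len (g \<otimes> (inv g' \<otimes> v))) - int (S1.len g) = int (S1.len v) - int (S1.len g')"
      using profile_eqD(1)[OF eq, of "inv g' \<otimes> v"] v c sh by (simp add: dst_def N_def)
    ultimately show "int (S1.len (g \<otimes> w)) - int (S1.len g) \<le> int (S1.len (g' \<otimes> w)) - int (S1.len g')"
      using v(2) by linarith
    obtain v where v: "v \<in> carrier G" "S2.len v + S2.dst v (g' \<otimes> w) = S2.len (g' \<otimes> w)" "dst g' v \<le> N2"
      using N2 c cw b by blast
    note sh = shift[OF v(1)]
    have "S2.len (g \<otimes> w) \<le> S2.len (g \<otimes> (inv g' \<otimes> v)) + S2.dst v (g' \<otimes> w)"
      using S2.len_mult[of "g \<otimes> (inv g' \<otimes> v)" "inv v \<otimes> (g' \<otimes> w)"] conjunct2[OF sh] v(1) c by (simp add: S2.dst_def)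
    moreover have "int (S2.len (g \<otimes> (inv g' \<otimes> v))) - int (S2.len g) = int (S2.len v) - int (S2.len g')"
      using profile_eqD(2)[OF eq, of "inv g' \<otimes> v"] v c sh by (simp add: dst_def N_def)
    ultimately show "int (S2.len (g \<otimes> w)) - int (S2.len g) \<le> int (S2.len (g' \<otimes> w)) - int (S2.len g')"
      using v(2) by linarith
  qed
  have grow_eq: "int (S1.len (g \<otimes> w)) - int (S1.len g) = int (S1.len (g' \<otimes> w)) - int (S1.len g')"
      "int (S2.len (g \<otimes> w)) - int (S2.len g) = int (S2.len (g' \<otimes> w)) - int (S2.len g')"
    if "profile N g = profile N g'" "g \<in> carrier G" "g' \<in> carrier G" "w \<in> carrier G"
      "almost_between D g (g \<otimes> w)" "almost_between D g' (g' \<otimes> w)" for g g' w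
    using grow_le[of g g' w] grow_le[of g' g w] that by auto
  have extend: "almost_between D g (g \<otimes> (w \<otimes> s))"
    if c: "g \<in> carrier G" "w \<in> carrier G" "s \<in> carrier G" and w: "w \<in> cone g" and s: "len s \<le> A" for g w s
  proof -
    have "almost_between \<kappa> g (g \<otimes> w)" using \<kappa> c w by (simp add: cone_def)
    moreover have "dst (g \<otimes> w) (g \<otimes> (w \<otimes> s)) = len s"
      using dst_right_mult[of "g \<otimes> w" s] c by (simp add: m_assoc)
    ultimately show ?thesis unfolding D_def using c s
      by (intro almost_between_shift[of g "g \<otimes> w"]) auto
  qed
  \<comment> \<open>Equality of growth requires betweenness at both \<open>g\<close> and
    \<open>g'\<close>; at \<open>g'\<close> it comes from the shorter prefix, already known to lie
    in the cone of \<open>g'\<close>.\<close>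
  have cone_le: "n = S1.len w \<Longrightarrow> w \<in> cone g \<Longrightarrow> w \<in> cone g'"
    if eq: "profile N g = profile N g'" and c: "g \<in> carrier G" "g' \<in> carrier G" for g g' w n
  proof (induction n arbitrary: w)
    case 0
    then have "w = \<one>" using S1.len_eq_0[of w] by (simp add: cone_def)
    then show ?case using c by (simp add: cone_def)
  next
    case (Suc n)
    have w: "w \<in> carrier G" "S1.len (g \<otimes> w) = S1.len g + S1.len w" using Suc.prems by (auto simp: cone_def)
    have "n \<le> S1.len w" using Suc.prems by simp
    then obtain v s where vs: "v \<in> carrier G" "s \<in> carrier G" "w = v \<otimes> s" "S1.len v = n" "S1.len s = S1.len w - n"
      using S1.len_split[OF w(1)] by blast
    have s1: "S1.len s = 1" using vs(5) Suc.prems by simp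
    have gv: "g \<otimes> v \<in> carrier G" "g \<otimes> w = (g \<otimes> v) \<otimes> s" using vs c by (auto simp: m_assoc)
    have "S1.len (g \<otimes> w) \<le> S1.len (g \<otimes> v) + 1" "S1.len (g \<otimes> v) \<le> S1.len g + n"
      using S1.len_mult[OF gv(1) vs(2)] S1.len_mult[OF c(1) vs(1)] gv(2) s1 vs(4) by auto
    then have v: "v \<in> cone g" using w(2) vs Suc.prems(1) by (simp add: cone_def)
    then have v': "v \<in> cone g'" using Suc.IH vs(4) by simp
    have "len s \<le> A" using A(2)[OF vs(2)] s1 by simp
    then have "almost_between D g (g \<otimes> w)" "almost_between D g' (g' \<otimes> w)"
      using extend[OF c(1) vs(1,2) v] extend[OF c(2) vs(1,2) v'] vs(3) by auto
    then have "int (S1.len (g \<otimes> w)) - int (S1.len g) = int (S1.len (g' \<otimes> w)) - int (S1.len g')"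
      using grow_eq(1)[OF eq c w(1)] by simp
    then show ?case using w by (simp add: cone_def)
  qed
  have type_eq: "type g = type g'" if eq: "profile N g = profile N g'" and c: "g \<in> carrier G" "g' \<in> carrier G" for g g'
  proof
    fix w
    have cone_iff: "w \<in> cone g \<longleftrightarrow> w \<in> cone g'" using cone_le[OF eq c] cone_le[OF eq[symmetric] c(2,1)] by blast
    show "type g w = type g' w"
    proof (cases "w \<in> cone g")
      case True
      then have w: "w \<in> cone g" "w \<in> cone g'" "w \<in> carrier G" using cone_iff by (auto simp: cone_def)
      have grow: "int (S1.len (g \<otimes> (w \<otimes> s))) - int (S1.len g) = int (S1.len (g' \<otimes> (w \<otimes> s))) - int (S1.len g')"
          "int (S2.len (g \<otimes> (w \<otimes> s))) - int (S2.len g) = int (S2.len (g' \<otimes> (w \<otimes> s))) - int (S2.len g')"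
        if s: "s \<in> carrier G" "len s \<le> A" for s
        using grow_eq[OF eq c, of "w \<otimes> s"] extend[OF c(1) w(3) s(1) w(1) s(2)] extend[OF c(2) w(3) s(1) w(2) s(2)] w(3) s(1)
        by auto
      have g0: "int (S1.len (g \<otimes> w)) - int (S1.len g) = int (S1.len (g' \<otimes> w)) - int (S1.len g')"
          "int (S2.len (g \<otimes> w)) - int (S2.len g) = int (S2.len (g' \<otimes> w)) - int (S2.len g')"
        using grow[of \<one>] w(3) by auto
      have "last_letters (g \<otimes> w) = last_letters (g' \<otimes> w)"
      proof -
        have "S1.len (g \<otimes> w \<otimes> inv s) + 1 = S1.len (g \<otimes> w) \<longleftrightarrow> S1.len (g' \<otimes> w \<otimes> inv s) + 1 = S1.len (g' \<otimes> w)"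
          if s: "s \<in> S1" for s
        proof -
          have sc: "s \<in> carrier G" using s S1.T_carrier by blast
          have "A * S1.len s \<le> A * 1" using S1.len_letter[OF s] by (rule mult_le_mono2)
          then have "len (inv s) \<le> A" using A(2)[OF sc] len_inv[OF sc] by linarith
          from grow(1)[OF inv_closed[OF sc] this] have
            "int (S1.len (g \<otimes> w \<otimes> inv s)) - int (S1.len g) = int (S1.len (g' \<otimes> w \<otimes> inv s)) - int (S1.len g')"
            using c w(3) sc by (simp add: m_assoc)
          then show ?thesis using g0(1) by linarith
        qed
        then show ?thesis unfolding last_letters_def by auto
      qed
      then show ?thesis using w g0(2) by (simp add: type_def)
    qed (use cone_iff in \<open>simp add: type_def\<close>)
  qed
  define rep where "rep t = (SOME g. g \<in> carrier G \<and> profile N g = t)" for t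
  have "type ` carrier G \<subseteq> (\<lambda>t. type (rep t)) ` (profile N ` carrier G)"
  proof
    fix \<theta> assume "\<theta> \<in> type ` carrier G"
    then obtain g where g: "g \<in> carrier G" "\<theta> = type g" by blast
    have "\<exists>h. h \<in> carrier G \<and> profile N h = profile N g" using g(1) by (intro exI[of _ g]) simp
    from someI_ex[OF this] have "rep (profile N g) \<in> carrier G" "profile N (rep (profile N g)) = profile N g"
      unfolding rep_def by simp_all
    then have "\<theta> = type (rep (profile N g))" using type_eq[of "rep (profile N g)" g] g by simp
    then show "\<theta> \<in> (\<lambda>t. type (rep t)) ` (profile N ` carrier G)" using g(1) by blast
  qed
  then show ?thesis using finite_profiles finite_subset by blast
qed

text \<open>Every nontrivial element is made a child of exactly one element, by selecting one of its last letters.\<close>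

definition select :: "'a set \<Rightarrow> 'a" where "select P = (SOME s. s \<in> P)"

text \<open>Read off from the type alone: \<open>P\<close> is the set of last letters of the child,
  and only the letter selected from it assigns the child to this parent.\<close>

definition out :: "('a \<Rightarrow> (int \<times> 'a set) option) \<Rightarrow> 'a set" where
  "out \<theta> = {s \<in> S1. \<exists>j P. \<theta> s = Some (j, P) \<and> s \<in> P \<and> select P = s}"

definition inc :: "('a \<Rightarrow> (int \<times> 'a set) option) \<Rightarrow> 'a \<Rightarrow> int" where
  "inc \<theta> s = fst (the (\<theta> s))"

text \<open>Cones nest: \<open>w\<close> continues \<open>g \<otimes> s\<close> exactly if
  \<open>s \<otimes> w\<close> continues \<open>g\<close> and is not shortened by cancellation.
  Subtracting \<open>inc \<theta> s\<close> rebases the growth at the child.\<close>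

definition next_type :: "('a \<Rightarrow> (int \<times> 'a set) option) \<Rightarrow> 'a \<Rightarrow> 'a \<Rightarrow> (int \<times> 'a set) option" where
  "next_type \<theta> s = (\<lambda>w. if w \<in> carrier G \<and> S1.len (s \<otimes> w) = 1 + S1.len w
     then map_option (\<lambda>(j, P). (j - inc \<theta> s, P)) (\<theta> (s \<otimes> w)) else None)"

lemma outD:
  assumes "g \<in> carrier G" "s \<in> out (type g)"
  shows "s \<in> S1" "s \<in> carrier G" "s \<in> cone g" "S1.len s = 1" "S1.len (g \<otimes> s) = S1.len g + 1"
    "s \<in> last_letters (g \<otimes> s)" "select (last_letters (g \<otimes> s)) = s"
proof -
  show s: "s \<in> S1" using assms by (simp add: out_def)
  then show sc: "s \<in> carrier G" using S1.T_carrier by blast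
  show "s \<in> cone g" "s \<in> last_letters (g \<otimes> s)" "select (last_letters (g \<otimes> s)) = s"
    using assms(2) by (auto simp: out_def type_def split: if_splits)
  then show len: "S1.len (g \<otimes> s) = S1.len g + 1"
    using assms(1) sc by (simp add: last_letters_def m_assoc)
  then show "S1.len s = 1" using \<open>s \<in> cone g\<close> by (simp add: cone_def)
qed

lemma outI:
  assumes "g \<in> carrier G" "s \<in> last_letters (g \<otimes> s)" "select (last_letters (g \<otimes> s)) = s"
  shows "s \<in> out (type g)"
proof -
  have s: "s \<in> S1" "s \<in> carrier G" using assms(2) S1.T_carrier by (auto simp: last_letters_def)
  have "S1.len (g \<otimes> s) = S1.len g + 1" using assms s by (simp add: last_letters_def m_assoc)
  moreover have "S1.len (g \<otimes> s) \<le> S1.len g + S1.len s" using assms(1) s by (intro S1.len_mult)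
  ultimately have "s \<in> cone g" using S1.len_letter[OF s(1)] s by (simp add: cone_def)
  then show ?thesis using assms s by (simp add: out_def type_def)
qed

lemma S2_len_child:
  assumes "g \<in> carrier G" "s \<in> out (type g)"
  shows "int (S2.len (g \<otimes> s)) = int (S2.len g) + inc (type g) s"
  using outD(3)[OF assms] by (simp add: inc_def type_def)

lemma type_child:
  assumes g: "g \<in> carrier G" and s: "s \<in> out (type g)"
  shows "type (g \<otimes> s) = next_type (type g) s"
proof
  fix w
  note S = outD[OF g s]
  show "type (g \<otimes> s) w = next_type (type g) s w"
  proof (cases "w \<in> carrier G")
    case True
    have assoc: "g \<otimes> s \<otimes> w = g \<otimes> (s \<otimes> w)" using True S(2) g by (simp add: m_assoc)
    have le: "S1.len (g \<otimes> (s \<otimes> w)) \<le> S1.len g + S1.len (s \<otimes> w)" "S1.len (s \<otimes> w) \<le> 1 + S1.len w"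
      using S1.len_mult[of g "s \<otimes> w"] S1.len_mult[of s w] True S(2,4) g by auto
    have "w \<in> cone (g \<otimes> s) \<longleftrightarrow> S1.len (g \<otimes> (s \<otimes> w)) = S1.len g + 1 + S1.len w"
      using True by (simp add: cone_def assoc S(5))
    also have "\<dots> \<longleftrightarrow> S1.len (s \<otimes> w) = 1 + S1.len w \<and> s \<otimes> w \<in> cone g"
      using le True S(2) by (auto simp: cone_def)
    finally show ?thesis
      using True S2_len_child[OF g s] by (auto simp: type_def next_type_def assoc)
  qed (simp add: type_def next_type_def cone_def)
qed

text \<open>The inverse map removes the selected last letter, which depends on the child
  only.\<close>

lemma child_bijection:
  "bij_betw (\<lambda>(g, s). g \<otimes> s) (SIGMA g:word_sphere G S1 n. out (type g)) (word_sphere G S1 (Suc n))"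
  unfolding bij_betw_def
proof (intro conjI)
  show "inj_on (\<lambda>(g, s). g \<otimes> s) (SIGMA g:word_sphere G S1 n. out (type g))"
  proof (rule inj_onI, clarify)
    fix g s g' s'
    assume g: "g \<in> word_sphere G S1 n" "g' \<in> word_sphere G S1 n" and s: "s \<in> out (type g)" "s' \<in> out (type g')"
      and eq: "g \<otimes> s = g' \<otimes> s'"
    have c: "g \<in> carrier G" "g' \<in> carrier G" using g by (auto simp: word_sphere_def)
    note S = outD[OF c(1) s(1)] and S' = outD[OF c(2) s(2)]
    have "s = s'" using S(7) S'(7) eq by metis
    then show "g = g' \<and> s = s'" using eq c S(2) by simp
  qed
  show "(\<lambda>(g, s). g \<otimes> s) ` (SIGMA g:word_sphere G S1 n. out (type g)) = word_sphere G S1 (Suc n)"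
  proof (intro equalityI subsetI)
    fix x assume "x \<in> (\<lambda>(g, s). g \<otimes> s) ` (SIGMA g:word_sphere G S1 n. out (type g))"
    then obtain g s where gs: "g \<in> word_sphere G S1 n" "s \<in> out (type g)" "x = g \<otimes> s" by auto
    then have "g \<in> carrier G" "S1.len g = n" by (auto simp: word_sphere_def)
    then show "x \<in> word_sphere G S1 (Suc n)" using gs outD[of g s] by (simp add: word_sphere_def)
  next
    fix x assume "x \<in> word_sphere G S1 (Suc n)"
    then have x: "x \<in> carrier G" "S1.len x = Suc n" by (auto simp: word_sphere_def)
    obtain a t where a: "a \<in> carrier G" "t \<in> carrier G" "x = a \<otimes> t" "S1.len a = n" "S1.len t = S1.len x - n"
      using S1.len_split[OF x(1), of n] x(2) by auto
    obtain v where v: "set v \<subseteq> S1" "length v = S1.len t" "word_value v = t"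
      using S1.word_of_len[OF a(2)] by blast
    then have "length v = 1" using a(5) x(2) by simp
    then obtain u where "v = [u]" by (auto simp: length_Suc_conv)
    then have "t \<in> S1" using v S1.T_carrier by auto
    then have "t \<in> last_letters x" using a x by (simp add: last_letters_def m_assoc)
    then have sel: "select (last_letters x) \<in> last_letters x" unfolding select_def by (rule someI)
    define s where "s = select (last_letters x)"
    have s: "s \<in> S1" "s \<in> carrier G" "S1.len (x \<otimes> inv s) = n"
      using sel S1.T_carrier x(2) by (auto simp: s_def last_letters_def)
    have gs: "(x \<otimes> inv s) \<otimes> s = x" using x s by (simp add: m_assoc)
    have "x \<otimes> inv s \<in> word_sphere G S1 n" using x s by (simp add: word_sphere_def)
    moreover have "s \<in> out (type (x \<otimes> inv s))"
      using sel x s by (intro outI) (auto simp: gs s_def[symmetric])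
    ultimately have "(\<lambda>(g, s). g \<otimes> s) (x \<otimes> inv s, s) \<in> (\<lambda>(g, s). g \<otimes> s) ` (SIGMA g:word_sphere G S1 n. out (type g))"
      by (intro imageI) simp
    then show "x \<in> (\<lambda>(g, s). g \<otimes> s) ` (SIGMA g:word_sphere G S1 n. out (type g))" using gs by simp
  qed
qed

text \<open>Both word lengths are compared with that of \<open>S\<close> at a factor
  \<open>A\<close> each; this gives the speed bounds \<open>A * A\<close> and
  \<open>1 / (A * A)\<close>.\<close>

lemma automatic:
  "\<exists>C. automatic_spheres (word_sphere G S1) (\<lambda>x. real (S2.len x)) (real C) (real (A * A)) type (type ` carrier G)
     out next_type inc (\<otimes>) (1 / real (A * A))"
proof -
  have A1: "real (A * A) > 0" using A(1) by simp
  have comp: "S2.len x \<le> A * A * S1.len x" "S1.len x \<le> A * A * S2.len x" if x: "x \<in> carrier G" for x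
    using order_trans[OF A(5)[OF x] mult_le_mono2[OF A(2)[OF x], of A]]
      order_trans[OF A(3)[OF x] mult_le_mono2[OF A(4)[OF x], of A]]
    by (simp_all only: mult.assoc)
  obtain C1 where C1: "\<forall>n m. \<exists>\<psi>. inj_on \<psi> (word_sphere G S1 (n + m)) \<and> (\<forall>x\<in>word_sphere G S1 (n + m).
     fst (\<psi> x) \<in> word_sphere G S1 n \<and> snd (\<psi> x) \<in> word_sphere G S1 m \<and>
     \<bar>real (S2.len x) - real (S2.len (fst (\<psi> x))) - real (S2.len (snd (\<psi> x)))\<bar> \<le> real C1)"
    using split_spheres by (elim exE)
  obtain C2 where C2: "\<forall>n m. \<exists>\<phi>. (\<forall>p\<in>word_sphere G S1 n \<times> word_sphere G S1 m. \<phi> p \<in> word_sphere G S1 (n + m) \<and>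
       \<bar>real (S2.len (\<phi> p)) - real (S2.len (fst p)) - real (S2.len (snd p))\<bar> \<le> real C2) \<and>
     (\<forall>x\<in>word_sphere G S1 (n + m). card {p\<in>word_sphere G S1 n \<times> word_sphere G S1 m. \<phi> p = x} \<le> C2)"
    using join_spheres by (elim exE)
  define C where "C = C1 + C2 + 1"
  have C: "real C1 \<le> real C" "real C2 \<le> real C" by (simp_all add: C_def)
  have "automatic_spheres (word_sphere G S1) (\<lambda>x. real (S2.len x)) (real C) (real (A * A)) type (type ` carrier G)
     out next_type inc (\<otimes>) (1 / real (A * A))"
  proof
    show "1 \<le> real C" by (simp add: C_def)
    show "finite (word_sphere G S1 n)" for n by (rule S1.finite_sphere)
    show "word_sphere G S1 n \<noteq> {}" for n by (rule S1.infinite_imp_sphere_nonempty[OF infinite_carrier])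
    show "\<exists>\<psi>. inj_on \<psi> (word_sphere G S1 (n + m)) \<and> (\<forall>x\<in>word_sphere G S1 (n + m). fst (\<psi> x) \<in> word_sphere G S1 n \<and>
      snd (\<psi> x) \<in> word_sphere G S1 m \<and> \<bar>real (S2.len x) - real (S2.len (fst (\<psi> x))) - real (S2.len (snd (\<psi> x)))\<bar> \<le> real C)" for n m
    proof -
      obtain \<psi> where "inj_on \<psi> (word_sphere G S1 (n + m)) \<and> (\<forall>x\<in>word_sphere G S1 (n + m).
       fst (\<psi> x) \<in> word_sphere G S1 n \<and> snd (\<psi> x) \<in> word_sphere G S1 m \<and>
       \<bar>real (S2.len x) - real (S2.len (fst (\<psi> x))) - real (S2.len (snd (\<psi> x)))\<bar> \<le> real C1)"
        using C1[rule_format, of n m] by (elim exE)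
      then show ?thesis using C(1) by (intro exI[of _ \<psi>]) (auto intro: order_trans)
    qed
    show "\<exists>\<phi>. (\<forall>p\<in>word_sphere G S1 n \<times> word_sphere G S1 m. \<phi> p \<in> word_sphere G S1 (n + m) \<and>
        \<bar>real (S2.len (\<phi> p)) - real (S2.len (fst p)) - real (S2.len (snd p))\<bar> \<le> real C) \<and>
      (\<forall>x\<in>word_sphere G S1 (n + m). real (card {p\<in>word_sphere G S1 n \<times> word_sphere G S1 m. \<phi> p = x}) \<le> real C)" for n m
    proof -
      obtain \<phi> where \<phi>: "(\<forall>p\<in>word_sphere G S1 n \<times> word_sphere G S1 m. \<phi> p \<in> word_sphere G S1 (n + m) \<and>
        \<bar>real (S2.len (\<phi> p)) - real (S2.len (fst p)) - real (S2.len (snd p))\<bar> \<le> real C2) \<and>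
        (\<forall>x\<in>word_sphere G S1 (n + m). card {p\<in>word_sphere G S1 n \<times> word_sphere G S1 m. \<phi> p = x} \<le> C2)"
        using C2[rule_format, of n m] by (elim exE)
      show ?thesis
      proof (intro exI[of _ \<phi>] conjI ballI)
        fix p assume "p \<in> word_sphere G S1 n \<times> word_sphere G S1 m"
        from conjunct1[OF \<phi>, rule_format, OF this]
        show "\<phi> p \<in> word_sphere G S1 (n + m)"
          "\<bar>real (S2.len (\<phi> p)) - real (S2.len (fst p)) - real (S2.len (snd p))\<bar> \<le> real C"
          using C(2) by linarith+
      next
        fix x assume "x \<in> word_sphere G S1 (n + m)"
        from conjunct2[OF \<phi>, rule_format, OF this]
        show "real (card {p\<in>word_sphere G S1 n \<times> word_sphere G S1 m. \<phi> p = x}) \<le> real C"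
          unfolding C_def by simp
      qed
    qed
    show "\<bar>real (S2.len x)\<bar> \<le> real (A * A) * real n" if "x \<in> word_sphere G S1 n" for x n
      using comp(1)[of x] that by (auto simp: word_sphere_def simp flip: of_nat_mult)
    show "finite (type ` carrier G)" by (rule finitely_many_types)
    show "type x \<in> type ` carrier G" if "x \<in> word_sphere G S1 n" for x n
      using that by (simp add: word_sphere_def)
    show "finite (out q)" for q
      by (rule finite_subset[OF _ S1.finite_T]) (auto simp: out_def)
    show "bij_betw (\<lambda>(g, s). g \<otimes> s) (SIGMA g:word_sphere G S1 n. out (type g)) (word_sphere G S1 (Suc n))" for n
      by (rule child_bijection)
    show "type (g \<otimes> s) = next_type (type g) s" if "g \<in> word_sphere G S1 n" "s \<in> out (type g)" for g n s
      using that by (intro type_child) (auto simp: word_sphere_def)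
    show "real (S2.len (g \<otimes> s)) = real (S2.len g) + real_of_int (inc (type g) s)"
      if "g \<in> word_sphere G S1 n" "s \<in> out (type g)" for g n s
    proof -
      have "int (S2.len (g \<otimes> s)) = int (S2.len g) + inc (type g) s"
        using that by (intro S2_len_child) (auto simp: word_sphere_def)
      then have "real_of_int (int (S2.len (g \<otimes> s))) = real_of_int (int (S2.len g) + inc (type g) s)" by (rule arg_cong)
      then show ?thesis by simp
    qed
    show "real (S2.len x) \<in> \<int>" for x by simp
    show "0 < 1 / real (A * A)" using A1 by simp
    show "1 / real (A * A) * real n \<le> real (S2.len x)" if "x \<in> word_sphere G S1 n" for x n
    proof -
      have "n \<le> A * A * S2.len x" using comp(2)[of x] that by (auto simp: word_sphere_def)
      then have "real n \<le> real (A * A) * real (S2.len x)" by (simp only: of_nat_mult[symmetric] of_nat_le_iff)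
      then show ?thesis using A1 by (simp add: pos_divide_le_eq mult.commute)
    qed
  qed
  then show ?thesis by blast
qed

end

lemma word_hyperbolic_imp_hyperbolic_group:
  assumes "word_hyperbolic G"
  shows "\<exists>S \<Delta>. hyperbolic_group G S \<Delta>"
proof -
  obtain S \<delta> where S: "group G" "finite S" "semigroup_generates G S" "\<forall>s\<in>S. inv\<^bsub>G\<^esub> s \<in> S"
    and \<delta>: "0 \<le> \<delta>" "cayley_slim_triangles G S \<delta>"
    using assms unfolding word_hyperbolic_def by blast
  interpret symmetric_word_metric G S
    by (intro symmetric_word_metric.intro word_metric.intro S(1) word_metric_axioms.intro
        symmetric_word_metric_axioms.intro) (use S in auto)
  have "hyperbolic_group G S (6 * \<delta> + 2)"
    by unfold_locales (use \<delta>(1) slim_imp_four_point[OF \<delta>(2,1)] in auto)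
  then show ?thesis by blast
qed

theorem corollary4p27:
  fixes G :: "('a, 'b) monoid_scheme" and S1 S2 :: "'a set"
  assumes "word_hyperbolic G" and "\<not> elementary_group G"
    and "finite S1" and "semigroup_generates G S1"
    and "finite S2" and "semigroup_generates G S2"
  shows "\<exists>lam::real. algebraic lam \<and>
    (\<forall>\<epsilon>::real. \<epsilon> > 0 \<longrightarrow>
      (\<exists>(K::real) (N::nat). \<forall>n\<ge>N.
        \<exists>G'. G' \<subseteq> word_sphere G S1 n \<and>
          real (card G') / real (card (word_sphere G S1 n)) \<ge> 1 - \<epsilon> \<and>
          (\<forall>g\<in>G'. \<bar>real (word_length G S1 g) - lam * real (word_length G S2 g)\<bar> \<le> K * sqrt (real n))))"
proof -
  obtain S \<Delta> where "hyperbolic_group G S \<Delta>"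
    using word_hyperbolic_imp_hyperbolic_group[OF assms(1)] by blast
  then interpret H: hyperbolic_group G S \<Delta> .
  interpret S1: word_metric G S1 by unfold_locales (use assms in auto)
  interpret S2: word_metric G S2 by unfold_locales (use assms in auto)
  interpret two_generating_sets G S \<Delta> S1 S2 by unfold_locales (rule assms(2))
  obtain C where "automatic_spheres (word_sphere G S1) (\<lambda>x. real (S2.len x)) (real C) (real (A * A)) type (type ` carrier G)
     out next_type inc (\<otimes>\<^bsub>G\<^esub>) (1 / real (A * A))"
    using automatic by blast
  then interpret automatic_spheres "word_sphere G S1" "\<lambda>x. real (S2.len x)" "real C" "real (A * A)" type "type ` carrier G"
    out next_type inc "(\<otimes>\<^bsub>G\<^esub>)" "1 / real (A * A)" .
  obtain lam :: real where lam: "algebraic lam \<and> (\<forall>\<epsilon>>0. \<exists>K' n0. \<forall>n\<ge>n0. \<exists>G' \<subseteq> word_sphere G S1 n.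
     real (card G') / real (card (word_sphere G S1 n)) \<ge> 1 - \<epsilon> \<and> (\<forall>g\<in>G'. \<bar>real n - lam * real (S2.len g)\<bar> \<le> K' * sqrt (real n)))"
    using typical_ratio by (elim exE)
  show ?thesis
  proof (rule exI[of _ lam], intro conjI allI impI)
    show "algebraic lam" using lam by (rule conjunct1)
    fix \<epsilon> :: real assume "\<epsilon> > 0"
    with lam obtain K' n0 where K': "\<forall>n\<ge>n0. \<exists>G' \<subseteq> word_sphere G S1 n.
       real (card G') / real (card (word_sphere G S1 n)) \<ge> 1 - \<epsilon> \<and> (\<forall>g\<in>G'. \<bar>real n - lam * real (S2.len g)\<bar> \<le> K' * sqrt (real n))"
      by meson
    have "\<exists>G'. G' \<subseteq> word_sphere G S1 n \<and> real (card G') / real (card (word_sphere G S1 n)) \<ge> 1 - \<epsilon> \<and>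
        (\<forall>g\<in>G'. \<bar>real (S1.len g) - lam * real (S2.len g)\<bar> \<le> K' * sqrt (real n))" if n: "n \<ge> n0" for n
    proof -
      obtain G' where G': "G' \<subseteq> word_sphere G S1 n" "real (card G') / real (card (word_sphere G S1 n)) \<ge> 1 - \<epsilon>"
        "\<forall>g\<in>G'. \<bar>real n - lam * real (S2.len g)\<bar> \<le> K' * sqrt (real n)"
        using K' n by blast
      have "S1.len g = n" if "g \<in> G'" for g using G'(1) that by (auto simp: word_sphere_def)
      then show ?thesis using G' by (intro exI[of _ G']) auto
    qed
    then show "\<exists>(K::real) (N::nat). \<forall>n\<ge>N. \<exists>G'. G' \<subseteq> word_sphere G S1 n \<and>
        real (card G') / real (card (word_sphere G S1 n)) \<ge> 1 - \<epsilon> \<and>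
        (\<forall>g\<in>G'. \<bar>real (word_length G S1 g) - lam * real (word_length G S2 g)\<bar> \<le> K * sqrt (real n))"
      by blast
  qed
qed

end
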